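(* The stochastic convolution $Z_{\mathcal R}(t)=\int_0^t\mathcal R(t-\tau)\,dZ(\tau)$, $t\in[0,T]$, has integrable trajectories and satisfies, for every $t\in[0,T]$ and every $\xi\in\mathcal D(A^* )$, $$\langle Z_{\mathcal R}(t),\xi\rangle_H=\int_0^t\langle a(t-\tau)Z_{\mathcal R}(\tau),A^*\xi\rangle_H\,d\tau+\langle Z(t),\xi\rangle_H\quad P\text{-a.s.}$$
   Context: $H$ is a real separable Hilbert space with inner product $\langle\cdot,\cdot\rangle_H$; $A$ is a closed densely defined linear operator in $H$ with adjoint $A^*$, $a\in L^1_{\mathrm{loc}}(\mathbb R_+)$, and the equation $X(t)=\int_0^t a(t-\tau)AX(\tau)\,d\tau+X_0+Z(t)$ is well-posed with resolvent family $\{\mathcal R(t)\}_{t\ge0}$ of bounded operators, uniformly bounded on compact intervals, strongly continuous, $\mathcal R(0)=I$, satisfying $\mathcal R(t)x=x+\int_0^t a(t-\tau)A\mathcal R(\tau)x\,d\tau$ for $x\in\mathcal D(A)$. $Z$ is an $H$-valued Lévy process (independent stationary increments, continuous in probability, càdlàg, $Z(0)=0$) on a filtered probability space. The stochastic convolution $\int_0^t\mathcal R(t-\tau)\,dZ(\tau)$ is the limit in probability of $\sum_i\mathcal R(s_i)(Z(t-t_{i-1})-Z(t-t_i))$ over partitions $0=t_0<\dots<t_n=t$ with mesh $\to0$, $s_i\in[t_{i-1},t_i]$. *)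

theory Defs
  imports "HOL-Probability.Probability"
begin

text \<open>The Hilbert space H is modelled by a type 'h of class real_inner, banach
  (complete) and second_countable_topology (separable).\<close>

definition closed_dense_operator :: "'h::real_inner set \<Rightarrow> ('h \<Rightarrow> 'h) \<Rightarrow> bool" where
  "closed_dense_operator DA A \<longleftrightarrow>
     subspace DA \<and>
     (\<forall>x\<in>DA. \<forall>y\<in>DA. A (x + y) = A x + A y) \<and>
     (\<forall>x\<in>DA. \<forall>c. A (c *\<^sub>R x) = c *\<^sub>R A x) \<and>
     closed {(x, A x) | x. x \<in> DA} \<and>
     closure DA = UNIV"

definition adj_dom :: "'h::real_inner set \<Rightarrow> ('h \<Rightarrow> 'h) \<Rightarrow> 'h set" where
  "adj_dom DA A = {y. \<exists>z. \<forall>x\<in>DA. inner (A x) y = inner x z}"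

definition adj :: "'h::real_inner set \<Rightarrow> ('h \<Rightarrow> 'h) \<Rightarrow> 'h \<Rightarrow> 'h" where
  "adj DA A y = (THE z. \<forall>x\<in>DA. inner (A x) y = inner x z)"

definition loc_integrable_Rplus :: "(real \<Rightarrow> real) \<Rightarrow> bool" where
  "loc_integrable_Rplus a \<longleftrightarrow> (\<forall>T\<ge>0. set_integrable lborel {0..T} a)"

text \<open>Resolvent family of the Volterra equation X(t) = int_0^t a(t-s) A X(s) ds + f(t).\<close>
definition resolvent_family ::
  "'h::{real_inner,banach,second_countable_topology} set \<Rightarrow> ('h \<Rightarrow> 'h) \<Rightarrow> (real \<Rightarrow> real)
     \<Rightarrow> (real \<Rightarrow> 'h \<Rightarrow> 'h) \<Rightarrow> bool" where
  "resolvent_family DA A a R \<longleftrightarrow>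
     (\<forall>t\<ge>0. bounded_linear (R t)) \<and>
     (\<forall>T\<ge>0. \<exists>C. \<forall>t\<in>{0..T}. \<forall>x. norm (R t x) \<le> C * norm x) \<and>
     (\<forall>x. continuous_on {0..} (\<lambda>t. R t x)) \<and>
     R 0 = id \<and>
     (\<forall>x\<in>DA. \<forall>t\<ge>0.
        (\<forall>\<tau>\<in>{0..t}. R \<tau> x \<in> DA) \<and>
        set_integrable lborel {0..t} (\<lambda>\<tau>. a (t - \<tau>) *\<^sub>R A (R \<tau> x)) \<and>
        R t x = x + (LINT \<tau>:{0..t}|lborel. a (t - \<tau>) *\<^sub>R A (R \<tau> x)))"

definition levy_process ::
  "'w measure \<Rightarrow> (real \<Rightarrow> 'w \<Rightarrow> 'h::{real_normed_vector,second_countable_topology}) \<Rightarrow> bool" where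
  "levy_process M Z \<longleftrightarrow>
     prob_space M \<and>
     (\<forall>t\<ge>0. Z t \<in> borel_measurable M) \<and>
     (\<forall>\<omega>\<in>space M. Z 0 \<omega> = 0) \<and>
     \<comment> \<open>independent increments\<close>
     (\<forall>n tt. 0 \<le> tt 0 \<and> (\<forall>i<n. tt i \<le> tt (Suc i)) \<longrightarrow>
        prob_space.indep_vars M (\<lambda>_. borel) (\<lambda>i \<omega>. Z (tt (Suc i)) \<omega> - Z (tt i) \<omega>) {..<n}) \<and>
     \<comment> \<open>stationary increments\<close>
     (\<forall>s t. 0 \<le> s \<and> s \<le> t \<longrightarrow>
        distr M borel (\<lambda>\<omega>. Z t \<omega> - Z s \<omega>) = distr M borel (Z (t - s))) \<and>
     \<comment> \<open>continuity in probability\<close>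
     (\<forall>t\<ge>0. \<forall>e>0. ((\<lambda>s. measure M {\<omega>\<in>space M. dist (Z s \<omega>) (Z t \<omega>) > e}) \<longlongrightarrow> 0)
                     (at t within {0..})) \<and>
     \<comment> \<open>cadlag paths\<close>
     (\<forall>\<omega>\<in>space M. \<forall>t\<ge>0. continuous (at_right t) (\<lambda>s. Z s \<omega>) \<and>
        (t > 0 \<longrightarrow> (\<exists>l. ((\<lambda>s. Z s \<omega>) \<longlongrightarrow> l) (at_left t))))"

definition conv_sum ::
  "(real \<Rightarrow> 'h \<Rightarrow> 'h::real_normed_vector) \<Rightarrow> (real \<Rightarrow> 'w \<Rightarrow> 'h) \<Rightarrow> real \<Rightarrow> nat
     \<Rightarrow> (nat \<Rightarrow> real) \<Rightarrow> (nat \<Rightarrow> real) \<Rightarrow> 'w \<Rightarrow> 'h" where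
  "conv_sum R Z t n tt s \<omega> =
     (\<Sum>i\<in>{1..n}. R (s i) (Z (t - tt (i - 1)) \<omega> - Z (t - tt i) \<omega>))"

definition tagged_partition :: "real \<Rightarrow> nat \<Rightarrow> (nat \<Rightarrow> real) \<Rightarrow> (nat \<Rightarrow> real) \<Rightarrow> bool" where
  "tagged_partition t n tt s \<longleftrightarrow>
     tt 0 = 0 \<and> tt n = t \<and> (\<forall>i<n. tt i < tt (Suc i)) \<and>
     (\<forall>i\<in>{1..n}. tt (i - 1) \<le> s i \<and> s i \<le> tt i)"

text \<open>Y is (a version of) the stochastic convolution int_0^t R(t-s) dZ(s):
  the limit in probability of the Riemann sums as the mesh tends to 0.\<close>
definition is_stoch_conv ::
  "'w measure \<Rightarrow> (real \<Rightarrow> 'h \<Rightarrow> 'h::{real_normed_vector,second_countable_topology})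
     \<Rightarrow> (real \<Rightarrow> 'w \<Rightarrow> 'h) \<Rightarrow> real \<Rightarrow> ('w \<Rightarrow> 'h) \<Rightarrow> bool" where
  "is_stoch_conv M R Z t Y \<longleftrightarrow>
     Y \<in> borel_measurable M \<and>
     (\<forall>e>0. \<exists>d>0. \<forall>n tt s. tagged_partition t n tt s \<and> (\<forall>i<n. tt (Suc i) - tt i < d) \<longrightarrow>
        measure M {\<omega>\<in>space M. norm (conv_sum R Z t n tt s \<omega> - Y \<omega>) > e} < e)"

end

theory Submission
  imports Defs
begin

text \<open>
  The key estimate is the following. Let \<open>W\<close> have stationary independent increments and be small
  in probability, uniformly on \<open>[0, T]\<close>. Expanding \<open>E exp (- |W|\<^sup>2 / 2)\<close> to second order along a
  partition, where the first-order term is controlled by the characteristic function, gives a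
  telescoping bound for the summed truncated second moments and means of the increments
  \<open>X\<^sub>i\<close>. By orthogonality \<open>\<Sum> B\<^sub>i X\<^sub>i\<close> is then small in probability for all uniformly bounded operators
  \<open>B\<^sub>i\<close>. Splitting \<open>Z\<close> into a finite-dimensional projection and a small remainder, this shows that
  the Riemann sums of the stochastic convolution are Cauchy in probability, uniformly in \<open>t\<close>.

  The approximants \<open>V\<^sub>n(t) = \<Sum> R(t - j\<delta>) (Z((j+1)\<delta>) - Z(j\<delta>))\<close>, the sum being over \<open>j\<delta> < t\<close>, involve \<open>Z\<close>
  only at the grid points and satisfy the weak equation exactly, with \<open>Z\<close> evaluated at the next
  grid point after \<open>t\<close>. Along a fast subsequence they converge almost surely to a jointly
  measurable process. On the event that the path of \<open>Z\<close> is bounded by a constant they are bounded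
  in \<open>L\<^sup>2\<close>, uniformly in \<open>t\<close>, which yields the integrability of the limit and allows passing to the
  limit in the equation.
\<close>

section \<open>Pointwise estimates\<close>

text \<open>Two obstacles shape the argument. \<open>Z\<close> need not have moments, so the
  estimates concern truncations by \<open>unit_trunc\<close>, the radial projection onto the unit
  ball, while large increments are counted by their probability. And \<open>R\<close> is continuous
  only strongly: operators at neighbouring times are close on finitely many vectors, not in norm, so
  sums with merely bounded operators must be controlled through smallness of the process itself. The
  Gaussian kernel serves because it is bounded and because the drop of its mean from time 0 is at
  most the mean of \<open>min 1 (norm (W t))\<close>; the energy of the increments is thus bounded
  by the displacement, without splitting the process into drift, Gaussian part and jumps. Its linear
  term involves the mean of a truncated increment, which the imaginary part of a characteristic
  function approximates; that function is multiplicative in time. One mesh sequence serves all t,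
  because the path integrals and Fubini require joint measurability in time and path.\<close>

definition unit_trunc :: "'a::real_normed_vector \<Rightarrow> 'a" where
  "unit_trunc x = (1 / max 1 (norm x)) *\<^sub>R x"

lemma norm_unit_trunc: "norm (unit_trunc x) = min 1 (norm x)"
  by (auto simp: unit_trunc_def max_def min_def field_simps)

lemma norm_unit_trunc_le_1: "norm (unit_trunc x) \<le> 1"
  by (simp add: norm_unit_trunc)

lemma norm_unit_trunc_sq: "(norm (unit_trunc x))\<^sup>2 = min 1 ((norm x)\<^sup>2)"
proof (cases "norm x \<le> 1")
  case True
  then show ?thesis by (simp add: norm_unit_trunc power_le_one)
next
  case False
  then show ?thesis by (simp add: norm_unit_trunc one_le_power)
qed

lemma unit_trunc_id: "norm x \<le> 1 \<Longrightarrow> unit_trunc x = x"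
  by (simp add: unit_trunc_def max_def)

lemma unit_trunc_measurable [measurable]:
  "(unit_trunc :: 'a::{real_normed_vector, second_countable_topology} \<Rightarrow> 'a) \<in> borel_measurable borel"
  unfolding unit_trunc_def by measurable

text \<open>Multiplying by \<open>exp q\<close> and inserting its quadratic Taylor polynomial leaves
  a cubic inequality. By concavity every slope up to 2 (1 - exp (-1/2)), about 0.787, is possible on
  [0, 1/2]; 3/4 leaves room for the polynomial bound.\<close>

lemma one_minus_exp_ge:
  fixes q :: real
  assumes "0 \<le> q" "q \<le> 1/2"
  shows "3 * q / 4 \<le> 1 - exp (- q)"
proof -
  have "1 + q + q\<^sup>2 / 2 \<le> exp q"
    using assms by (rule_tac exp_lower_Taylor_quadratic)
  moreover have "1 \<le> (1 - 3 * q / 4) * (1 + q + q\<^sup>2 / 2)"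
  proof -
    have "q\<^sup>2 \<le> q / 2" using mult_left_mono[OF assms(2,1)] by (simp add: power2_eq_square)
    moreover have "q ^ 3 \<le> q / 4"
      using mult_left_mono[OF \<open>q\<^sup>2 \<le> q / 2\<close> assms(1)] \<open>q\<^sup>2 \<le> q / 2\<close>
      by (simp add: power2_eq_square power3_eq_cube)
    ultimately have "0 \<le> q / 4 - q\<^sup>2 / 4 - 3 * q ^ 3 / 8" using assms(1) by linarith
    then show ?thesis by (simp add: algebra_simps power2_eq_square power3_eq_cube)
  qed
  ultimately have "1 \<le> (1 - 3 * q / 4) * exp q"
    using mult_left_mono[of "1 + q + q\<^sup>2 / 2" "exp q" "1 - 3 * q / 4"] assms by linarith
  then show ?thesis by (simp add: exp_minus field_simps)
qed

text \<open>The value 5/8 is matched to the slope 3/4: an increment of norm above one gains 1 - 5/8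
  = 3/8, a small one gains 3/4 of half its square, so both cases of
  \<open>gauss_kernel_increment\<close> share the constant 3/8.\<close>

lemma exp_neg_half_le: "exp (- (1/2)) \<le> (5/8 :: real)"
proof -
  have "1 + (1/2) + (1/2)\<^sup>2 / 2 \<le> exp (1/2 :: real)"
    by (rule exp_lower_Taylor_quadratic) simp
  then have "8/5 \<le> exp (1/2 :: real)" by (simp add: power2_eq_square)
  then show ?thesis by (simp add: exp_minus field_simps)
qed

lemma exp_le_quadratic:
  fixes z s :: real
  assumes "\<bar>z\<bar> \<le> s"
  shows "exp z \<le> 1 + z + z\<^sup>2 * exp s / 2"
proof -
  obtain t where t: "\<bar>t\<bar> \<le> \<bar>z\<bar>" "exp z = (\<Sum>m<2. z ^ m / fact m) + exp t / fact 2 * z ^ 2"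
    using Maclaurin_exp_le[of z 2] by blast
  have "exp t \<le> exp s" using t(1) assms by simp
  then have "exp t * z\<^sup>2 \<le> exp s * z\<^sup>2" by (rule mult_right_mono) simp
  then show ?thesis using t(2) by (simp add: lessThan_nat_numeral mult.commute)
qed

text \<open>The Gaussian factor tames powers of s and even \<open>exp s\<close>, so each error term
  is dominated by a multiple of \<open>min 1 s\<close>, the one quantity whose mean is known to be
  small. Boundedness handles large s, a spare factor s handles small s.\<close>

lemma gauss_mult_le:
  fixes s :: real
  assumes "0 \<le> s"
  shows "exp (- s\<^sup>2 / 2) * s \<le> min 1 s"
    and "exp (- s\<^sup>2 / 2) * (s\<^sup>2 * exp s) \<le> 4 * min 1 s"
    and "1 - min 1 s \<le> exp (- s\<^sup>2 / 2)"
proof -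
  have "1 + s\<^sup>2 / 2 \<le> exp (s\<^sup>2 / 2)" by (rule exp_ge_add_one_self)
  moreover have "s \<le> 1 + s\<^sup>2 / 2" using sum_squares_ge_zero[of "s - 1" 1]
    by (simp add: power2_eq_square algebra_simps) 
  ultimately have "s \<le> exp (s\<^sup>2 / 2)" by linarith
  then have "exp (- s\<^sup>2 / 2) * s \<le> 1" by (simp add: exp_minus field_simps)
  moreover have "exp (- s\<^sup>2 / 2) * s \<le> s" using assms by (simp add: mult_left_le_one_le)
  ultimately show "exp (- s\<^sup>2 / 2) * s \<le> min 1 s" by simp
  have E: "exp (- s\<^sup>2 / 2) * exp s * exp (s\<^sup>2 / 2 - s) = 1" by (simp flip: exp_add)
  have "1 + (s\<^sup>2 / 2 - s) \<le> exp (s\<^sup>2 / 2 - s)" by (rule exp_ge_add_one_self)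
  \<comment> \<open>Completing the square: 4 (1 + s^2/2 - s) - s^2 = (s - 2)^2. This is the origin
    of the factor 4.\<close>
  moreover have "s\<^sup>2 \<le> 4 * (1 + (s\<^sup>2 / 2 - s))" using zero_le_power2[of "s - 2"]
    by (simp add: power2_eq_square algebra_simps) 
  ultimately have "s\<^sup>2 \<le> 4 * exp (s\<^sup>2 / 2 - s)" by argo
  then have "exp (- s\<^sup>2 / 2) * exp s * s\<^sup>2 \<le> exp (- s\<^sup>2 / 2) * exp s * (4 * exp (s\<^sup>2 / 2 - s))"
    by (rule mult_left_mono) simp
  also have "\<dots> = 4 * (exp (- s\<^sup>2 / 2) * exp s * exp (s\<^sup>2 / 2 - s))" by simp
  finally have 1: "exp (- s\<^sup>2 / 2) * (s\<^sup>2 * exp s) \<le> 4" unfolding E by (simp add: mult_ac)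
  have 2: "exp (- s\<^sup>2 / 2) * (s\<^sup>2 * exp s) \<le> 4 * s" if "s \<le> 1"
  proof -
    have "exp (- s\<^sup>2 / 2) \<le> 1" by simp
    moreover have "s\<^sup>2 \<le> s" using that assms by (simp add: power2_eq_square mult_left_le)
    moreover have "exp s \<le> 4" using that exp_le exp_le_cancel_iff[of s 1] by linarith
    ultimately have "exp (- s\<^sup>2 / 2) * (s\<^sup>2 * exp s) \<le> 1 * (s * 4)"
      using assms by (intro mult_mono) auto
    then show ?thesis by simp
  qed
  show "exp (- s\<^sup>2 / 2) * (s\<^sup>2 * exp s) \<le> 4 * min 1 s" using 1 2 by (cases "s \<le> 1") auto
  show "1 - min 1 s \<le> exp (- s\<^sup>2 / 2)"
  proof (cases "s \<le> 1")
    case True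
    have "s\<^sup>2 \<le> s" using True assms by (simp add: power2_eq_square mult_left_le)
    moreover have "1 + (- s\<^sup>2 / 2) \<le> exp (- s\<^sup>2 / 2)" by (rule exp_ge_add_one_self)
    ultimately show ?thesis using assms True by simp
  qed simp
qed

text \<open>The slope of the Gaussian is bounded, so moving its argument by s costs a multiple of s;
  for s > 1 the right side exceeds one and the bound is trivial. With \<open>1 \<le> r\<close> the
  shifted point r - s is nonnegative for s \<le> 1, so squares can be compared.\<close>

lemma gauss_shift_le:
  fixes r s :: real
  assumes "0 \<le> s" "1 \<le> r" "r - s \<le> z" "0 \<le> z"
  shows "exp (- z\<^sup>2 / 2) \<le> exp (- r\<^sup>2 / 2) + 2 * min 1 s"
proof (cases "s \<le> 1")
  case False
  have "exp (- z\<^sup>2 / 2) \<le> 1" by simp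
  moreover have "0 \<le> exp (- r\<^sup>2 / 2)" by simp
  ultimately show ?thesis using False by linarith
next
  case True
  define a where "a = r - s"
  have a0: "0 \<le> a" using True assms by (simp add: a_def)
  have "a\<^sup>2 \<le> z\<^sup>2" using a0 assms by (intro power_mono) (auto simp: a_def)
  then have "exp (- z\<^sup>2 / 2) \<le> exp (- a\<^sup>2 / 2)" by simp
  also have "\<dots> \<le> exp (- r\<^sup>2 / 2) + 2 * s"
  proof -
  have "exp (- r\<^sup>2 / 2) = exp (- a\<^sup>2 / 2) * exp (- (a * s + s\<^sup>2 / 2))"
    by (simp add: a_def power2_eq_square field_simps flip: exp_add)
  moreover have "1 + (- (a * s + s\<^sup>2 / 2)) \<le> exp (- (a * s + s\<^sup>2 / 2))"
    by (rule exp_ge_add_one_self)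
  then have "exp (- a\<^sup>2 / 2) * (1 + (- (a * s + s\<^sup>2 / 2))) \<le> exp (- a\<^sup>2 / 2) * exp (- (a * s + s\<^sup>2 / 2))"
    by (rule mult_left_mono) simp
  moreover have "exp (- a\<^sup>2 / 2) * a * s \<le> 1 * s"
    using gauss_mult_le(1)[OF a0] assms(1) by (intro mult_right_mono) auto
  moreover have "exp (- a\<^sup>2 / 2) * (s\<^sup>2 / 2) \<le> 1 * s"
    using True assms(1) mult_left_le[of s s] by (intro mult_mono) (auto simp: power2_eq_square)
  ultimately show ?thesis by (simp add: algebra_simps)
  qed
  finally show ?thesis using True by simp
qed

text \<open>The right side is the second-order remainder of the Gaussian kernel. This lower bound makes the
  summed truncated second moments of the increments of a process telescope.\<close>
lemma gauss_kernel_increment: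
  fixes x y :: "'a::real_inner"
  shows "(3/8 - 4 * min 1 (norm y)) * min 1 ((norm x)\<^sup>2)
    \<le> exp (- (norm y)\<^sup>2 / 2) - exp (- (norm (y + x))\<^sup>2 / 2)
      - exp (- (norm y)\<^sup>2 / 2) * (y \<bullet> unit_trunc x)"
proof -
  define s where "s = norm y"
  define E e where "E = exp (- s\<^sup>2 / 2)" and "e = min 1 s"
  have s0: "0 \<le> s" by (simp add: s_def)
  have Es: "E * s \<le> e" "E * (s\<^sup>2 * exp s) \<le> 4 * e" "1 - e \<le> E" "0 \<le> E" "E \<le> 1"
    using gauss_mult_le[OF s0] by (auto simp: E_def s_def e_def)
  show ?thesis
  proof (cases "norm x \<le> 1")
    case True
    define p q where "p = y \<bullet> x" and "q = (norm x)\<^sup>2 / 2"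
    have q: "0 \<le> q" "q \<le> 1/2" using True by (auto simp: q_def abs_square_le_1)
    have p: "\<bar>p\<bar> \<le> s * norm x" unfolding p_def s_def by (rule Cauchy_Schwarz_ineq2)
    then have ps: "\<bar>p\<bar> \<le> s" using True s0 by (meson mult_left_le order_trans)
    have "p\<^sup>2 \<le> (s * norm x)\<^sup>2" using p by (metis abs_ge_zero power2_abs power_mono)
    then have p2: "p\<^sup>2 \<le> s\<^sup>2 * (2 * q)" by (simp add: q_def power_mult_distrib)
    \<comment> \<open>The cross term of |y + x|^2 sits in the factor exp (- p), whose first-order
      part is cancelled by the subtracted inner product up to d p. That mismatch is of higher order
      and is absorbed into \<open>q * s\<close>.\<close>
    have exp_split: "exp (- (norm (y + x))\<^sup>2 / 2) = E * (exp (- q) * exp (- p))"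
      unfolding E_def q_def p_def s_def
      by (simp add: power2_norm_eq_inner inner_add inner_commute field_simps flip: exp_add)
    define d where "d = 1 - exp (- q)"
    have d: "3 * q / 4 \<le> d" "d \<le> q" "0 \<le> d"
      using one_minus_exp_ge[OF q] q exp_ge_add_one_self[of "- q"] by (auto simp: d_def)
    have "exp (- p) \<le> 1 - p + p\<^sup>2 * exp s / 2" using exp_le_quadratic[of "- p" s] ps by simp
    then have "exp (- q) * exp (- p) \<le> exp (- q) * (1 - p + p\<^sup>2 * exp s / 2)" by simp
    also have "\<dots> = exp (- q) * (1 - p) + exp (- q) * (p\<^sup>2 * exp s / 2)" by (simp add: algebra_simps)
    also have "exp (- q) * (p\<^sup>2 * exp s / 2) \<le> 1 * (s\<^sup>2 * (2 * q) * exp s / 2)"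
      using q p2 by (intro mult_mono) auto
    finally have "1 - exp (- q) * exp (- p) - p \<ge> d - d * p - s\<^sup>2 * q * exp s"
      by (simp add: d_def algebra_simps)
    moreover have "d * p \<le> q * s" using d ps q by (intro order_trans[OF mult_left_mono[of p s d] mult_right_mono]) auto
    ultimately have "1 - exp (- q) * exp (- p) - p \<ge> q * (3/4 - s - s\<^sup>2 * exp s)"
      using d by (simp add: algebra_simps)
    note key = this
    have "q * (3/4 - 8 * e) \<le> q * (E * (3/4) - E * s - E * (s\<^sup>2 * exp s))"
      using Es s0 by (intro mult_left_mono q) (auto simp: e_def min_def)
    also have "\<dots> = E * (q * (3/4 - s - s\<^sup>2 * exp s))" by (simp add: algebra_simps)
    also have "\<dots> \<le> E * (1 - exp (- q) * exp (- p) - p)"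
      using key by (rule mult_left_mono) (rule Es)
    also have "\<dots> = E - E * (exp (- q) * exp (- p)) - E * p" by (simp add: right_diff_distrib)
    finally have "q * (3/4 - 8 * e) \<le> E - E * (exp (- q) * exp (- p)) - E * p" .
    moreover have "q * (3/4 - 8 * e) = (3/8 - 4 * e) * (norm x)\<^sup>2"
      by (simp add: q_def algebra_simps)
    moreover have "unit_trunc x = x" using True by (rule unit_trunc_id)
    moreover have "min 1 ((norm x)\<^sup>2) = (norm x)\<^sup>2" using True by (simp add: abs_square_le_1)
    ultimately show ?thesis
      unfolding s_def[symmetric] exp_split unfolding E_def[symmetric] e_def[symmetric] p_def by simp
  next
    case False
    \<comment> \<open>No expansion for a large increment: the kernel drops from at least 1 - e to at
      most 5/8 + 2 e, and the linear term costs another e. The errors add up to 4 e.\<close>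
    have x1: "min 1 ((norm x)\<^sup>2) = 1" using False by (simp add: one_le_power)
    have "norm x - s \<le> norm (y + x)" by (metis s_def add.commute norm_diff_ineq)
    then have "exp (- (norm (y + x))\<^sup>2 / 2) \<le> exp (- (norm x)\<^sup>2 / 2) + 2 * e"
      using gauss_shift_le[OF s0, of "norm x" "norm (y + x)"] False by (simp add: e_def)
    moreover have "exp (- (norm x)\<^sup>2 / 2) \<le> exp (- (1/2))" using False by (simp add: one_le_power)
    moreover have "y \<bullet> unit_trunc x \<le> s * 1"
      unfolding s_def by (intro order_trans[OF norm_cauchy_schwarz] mult_left_mono norm_unit_trunc_le_1) simp
    then have "E * (y \<bullet> unit_trunc x) \<le> E * s" using mult_left_mono[OF _ Es(4)] by fastforce
    ultimately show ?thesis using Es exp_neg_half_le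
      unfolding s_def[symmetric] unfolding E_def[symmetric] e_def[symmetric] x1 mult_1_right
      by linarith
  qed
qed

text \<open>Both terms are bounded and agree with \<open>u \<bullet> x\<close> up to second order at
  the origin. So the mean of the truncation in direction u can be exchanged for the mean of a sine,
  at the price of the truncated second moment. The constant 2 comes from large x.\<close>

lemma sin_minus_unit_trunc:
  fixes u x :: "'a::real_inner"
  assumes "norm u \<le> 1"
  shows "\<bar>sin (u \<bullet> x) - u \<bullet> unit_trunc x\<bar> \<le> 2 * min 1 ((norm x)\<^sup>2)"
proof (cases "norm x \<le> 1")
  case True
  define p where "p = u \<bullet> x"
  have "\<bar>p\<bar> \<le> norm u * norm x" unfolding p_def by (rule Cauchy_Schwarz_ineq2)
  also have "\<dots> \<le> norm x" using assms by (simp add: mult_left_le_one_le)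
  finally have p: "\<bar>p\<bar> \<le> norm x" .
  have "\<bar>sin p - p\<bar> * 2 \<le> p\<^sup>2"
    using Maclaurin_sin_bound[of p 2] by (simp add: lessThan_nat_numeral sin_coeff_def)
  then have "\<bar>sin p - p\<bar> \<le> p\<^sup>2" by (rule order_trans[rotated]) simp
  also have "\<dots> \<le> (norm x)\<^sup>2" using p by (metis abs_ge_zero power2_abs power_mono)
  finally show ?thesis
    using True by (simp add: unit_trunc_id p_def[symmetric] abs_square_le_1)
next
  case False
  have "\<bar>u \<bullet> unit_trunc x\<bar> \<le> norm u * norm (unit_trunc x)" by (rule Cauchy_Schwarz_ineq2)
  also have "\<dots> \<le> 1" using assms norm_unit_trunc_le_1[of x] by (simp add: mult_le_one)
  finally have "\<bar>u \<bullet> unit_trunc x\<bar> \<le> 1" .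
  moreover have "\<bar>sin (u \<bullet> x)\<bar> \<le> 1" by simp
  moreover have "min 1 ((norm x)\<^sup>2) = 1" using False by (simp add: one_le_power)
  ultimately show ?thesis by linarith
qed

section \<open>Expectations, tail events and independence in a probability space\<close>

lemma (in prob_space) integrable_bounded:
  fixes f :: "'a \<Rightarrow> 'b::{banach, second_countable_topology}"
  assumes "f \<in> borel_measurable M" "\<And>\<omega>. \<omega> \<in> space M \<Longrightarrow> norm (f \<omega>) \<le> c"
  shows "integrable M f"
  using assms by (intro integrable_const_bound[where B=c]) (auto intro: AE_I2)

lemma (in prob_space) prob_norm_add_less:
  fixes f g :: "'a \<Rightarrow> 'b::{real_normed_vector, second_countable_topology}"
  assumes [measurable]: "f \<in> borel_measurable M" "g \<in> borel_measurable M"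
    and "prob {\<omega>\<in>space M. norm (f \<omega>) > e/2} < e/2" "prob {\<omega>\<in>space M. norm (g \<omega>) > e/2} < e/2"
  shows "prob {\<omega>\<in>space M. norm (f \<omega> + g \<omega>) > e} < e"
proof -
  have "norm (f \<omega>) > e/2 \<or> norm (g \<omega>) > e/2" if "norm (f \<omega> + g \<omega>) > e" for \<omega>
    using that norm_triangle_ineq[of "f \<omega>" "g \<omega>"] by linarith
  then have "prob {\<omega>\<in>space M. norm (f \<omega> + g \<omega>) > e}
      \<le> prob ({\<omega>\<in>space M. norm (f \<omega>) > e/2} \<union> {\<omega>\<in>space M. norm (g \<omega>) > e/2})"
    by (intro finite_measure_mono) auto
  also have "\<dots> \<le> prob {\<omega>\<in>space M. norm (f \<omega>) > e/2} + prob {\<omega>\<in>space M. norm (g \<omega>) > e/2}"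
    by (intro measure_Un_le) auto
  finally show ?thesis using assms(3,4) by linarith
qed

text \<open>The joint law of independent variables is the product of their laws, so Fubini reduces
  the claim to linearity of the inner product in each argument. Cauchy-Schwarz supplies the
  integrability from first moments alone.\<close>

lemma (in prob_space) expectation_inner_indep:
  fixes U V :: "'a \<Rightarrow> 'h::{real_inner, banach, second_countable_topology}"
  assumes indep: "indep_var borel U borel V"
    and U: "integrable M U" and V: "integrable M V"
  shows "integrable M (\<lambda>\<omega>. U \<omega> \<bullet> V \<omega>)"
    and "expectation (\<lambda>\<omega>. U \<omega> \<bullet> V \<omega>) = expectation U \<bullet> expectation V"
proof -
  have [measurable]: "U \<in> borel_measurable M" "V \<in> borel_measurable M"
    using U V by (auto dest: borel_measurable_integrable)
  have eq: "distr M borel U \<Otimes>\<^sub>M distr M borel V = distr M (borel \<Otimes>\<^sub>M borel) (\<lambda>x. (U x, V x))"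
    using indep by (auto simp: indep_var_distribution_eq)
  interpret A: prob_space "distr M borel U" by (rule prob_space_distr) simp
  interpret B: prob_space "distr M borel V" by (rule prob_space_distr) simp
  interpret pair_prob_space "distr M borel U" "distr M borel V" ..
  have iU: "integrable (distr M borel U) (\<lambda>x. x)" and iV: "integrable (distr M borel V) (\<lambda>x. x)"
    using U V by (simp_all add: integrable_distr_eq)
  have EU: "integral\<^sup>L (distr M borel U) (\<lambda>x. x) = integral\<^sup>L M U"
    and EV: "integral\<^sup>L (distr M borel V) (\<lambda>x. x) = integral\<^sup>L M V"
    by (subst integral_distr; simp)+
  have int: "integrable (distr M borel U \<Otimes>\<^sub>M distr M borel V) (\<lambda>(x, y). x \<bullet> y)"
  proof (rule Fubini_integrable)
    show "(\<lambda>(x, y). x \<bullet> y) \<in> borel_measurable (distr M borel U \<Otimes>\<^sub>M distr M borel V)"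
      by (simp add: split_beta')
    show "AE x in distr M borel U. integrable (distr M borel V) (\<lambda>y. case (x, y) of (x, y) \<Rightarrow> x \<bullet> y)"
      using iV by simp
    have "integrable (distr M borel U) (\<lambda>x. norm x * (\<integral>y. norm y \<partial>distr M borel V))"
      using iU by simp
    then show "integrable (distr M borel U) (\<lambda>x. \<integral>y. norm (case (x, y) of (x, y) \<Rightarrow> x \<bullet> y) \<partial>distr M borel V)"
    proof (rule Bochner_Integration.integrable_bound)
      show "(\<lambda>x. \<integral>y. norm (case (x, y) of (x, y) \<Rightarrow> x \<bullet> y) \<partial>distr M borel V)
          \<in> borel_measurable (distr M borel U)"
        by (simp add: split_beta')
      have "(\<integral>y. \<bar>x \<bullet> y\<bar> \<partial>distr M borel V) \<le> (\<integral>y. norm x * norm y \<partial>distr M borel V)" for x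
        using iV by (intro integral_mono) (auto intro: Cauchy_Schwarz_ineq2)
      then show "AE x in distr M borel U. norm (\<integral>y. norm (case (x, y) of (x, y) \<Rightarrow> x \<bullet> y) \<partial>distr M borel V)
          \<le> norm (norm x * (\<integral>y. norm y \<partial>distr M borel V))"
        by (simp add: abs_mult)
    qed
  qed
  then show "integrable M (\<lambda>\<omega>. U \<omega> \<bullet> V \<omega>)"
    unfolding eq by (subst (asm) integrable_distr_eq) (auto simp: split_beta')
  have "integral\<^sup>L M (\<lambda>\<omega>. U \<omega> \<bullet> V \<omega>) = (\<integral>z. (case z of (x, y) \<Rightarrow> x \<bullet> y) \<partial>distr M (borel \<Otimes>\<^sub>M borel) (\<lambda>x. (U x, V x)))"
    by (subst integral_distr) (auto simp: split_beta')
  also have "\<dots> = (\<integral>x. \<integral>y. x \<bullet> y \<partial>distr M borel V \<partial>distr M borel U)"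
    using integral_fst[OF int] by (simp add: eq)
  also have "\<dots> = (\<integral>x. x \<bullet> integral\<^sup>L M V \<partial>distr M borel U)"
    using iV by (simp add: EV)
  also have "\<dots> = integral\<^sup>L M U \<bullet> integral\<^sup>L M V"
    using iU by (simp add: EU)
  finally show "integral\<^sup>L M (\<lambda>\<omega>. U \<omega> \<bullet> V \<omega>) = integral\<^sup>L M U \<bullet> integral\<^sup>L M V" .
qed

text \<open>The part of the Levy property that the moment estimates work with. It passes to bounded
  linear images and is interpreted for \<open>Z\<close>, for its rescalings and for the remainder of
  a projection; smallness enters separately through \<open>small_on\<close>.\<close>

locale stationary_increments = prob_space M for M :: "'w measure" +
  fixes W :: "real \<Rightarrow> 'w \<Rightarrow> 'h::{real_inner, banach, second_countable_topology}"
  assumes measurable_W: "0 \<le> t \<Longrightarrow> W t \<in> borel_measurable M"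
    and W_0: "\<omega> \<in> space M \<Longrightarrow> W 0 \<omega> = 0"
    and indep_increments: "0 \<le> u 0 \<Longrightarrow> (\<And>i. i < n \<Longrightarrow> u i \<le> u (Suc i)) \<Longrightarrow>
      indep_vars (\<lambda>_. borel) (\<lambda>i \<omega>. W (u (Suc i)) \<omega> - W (u i) \<omega>) {..<n::nat}"
    and stationary: "0 \<le> s \<Longrightarrow> s \<le> t \<Longrightarrow>
      distr M borel (\<lambda>\<omega>. W t \<omega> - W s \<omega>) = distr M borel (W (t - s))"
begin

lemma expectation_increment:
  fixes f :: "'h \<Rightarrow> 'b::{banach, second_countable_topology}"
  assumes "0 \<le> s" "s \<le> t" and [measurable]: "f \<in> borel_measurable borel"
  shows "expectation (\<lambda>\<omega>. f (W t \<omega> - W s \<omega>)) = expectation (\<lambda>\<omega>. f (W (t - s) \<omega>))"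
proof -
  have [measurable]: "W t \<in> borel_measurable M" "W s \<in> borel_measurable M" "W (t - s) \<in> borel_measurable M"
    using assms measurable_W by auto
  show ?thesis
    using arg_cong[OF stationary[OF assms(1,2)], of "\<lambda>N. integral\<^sup>L N f"] by (simp add: integral_distr)
qed

lemma indep_var_increments:
  assumes u: "0 \<le> u 0" "\<And>i. i < n \<Longrightarrow> u i \<le> u (Suc i)" and ij: "i < n" "j < n" "i \<noteq> (j::nat)"
  shows "indep_var borel (\<lambda>\<omega>. W (u (Suc i)) \<omega> - W (u i) \<omega>) borel (\<lambda>\<omega>. W (u (Suc j)) \<omega> - W (u j) \<omega>)"
proof -
  have "indep_var borel ((\<lambda>f. f i) \<circ> (\<lambda>\<omega>. restrict (\<lambda>i. W (u (Suc i)) \<omega> - W (u i) \<omega>) {i}))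
                  borel ((\<lambda>f. f j) \<circ> (\<lambda>\<omega>. restrict (\<lambda>i. W (u (Suc i)) \<omega> - W (u i) \<omega>) {j}))"
    using ij by (intro indep_var_compose[OF indep_var_restrict[OF indep_increments[OF u]]]) auto
  then show ?thesis by (simp add: comp_def)
qed

lemma indep_var_W_increment:
  assumes "0 \<le> t" "0 \<le> h"
  shows "indep_var borel (W t) borel (\<lambda>\<omega>. W (t + h) \<omega> - W t \<omega>)"
proof -
  \<comment> \<open>The grid 0, t, t + h; its first increment is \<open>W t\<close> because the
    process starts at zero.\<close>
  define u where "u = (\<lambda>i::nat. if i = 0 then 0 else if i = 1 then t else t + h)"
  have "indep_var borel (\<lambda>\<omega>. W (u (Suc 0)) \<omega> - W (u 0) \<omega>) borel (\<lambda>\<omega>. W (u (Suc 1)) \<omega> - W (u 1) \<omega>)"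
    using assms by (intro indep_var_increments[where n=2]) (auto simp: u_def)
  then have indep: "indep_var borel (\<lambda>\<omega>. W t \<omega> - W 0 \<omega>) borel (\<lambda>\<omega>. W (t + h) \<omega> - W t \<omega>)"
    by (simp add: u_def)
  \<comment> \<open>\<open>W 0\<close> vanishes only on \<open>space M\<close>, so the exchange of
    \<open>W t - W 0\<close> for \<open>W t\<close> is made at the level of the laws.\<close>
  have "distr M borel (\<lambda>\<omega>. W t \<omega> - W 0 \<omega>) = distr M borel (W t)"
    "distr M (borel \<Otimes>\<^sub>M borel) (\<lambda>\<omega>. (W t \<omega> - W 0 \<omega>, W (t + h) \<omega> - W t \<omega>))
      = distr M (borel \<Otimes>\<^sub>M borel) (\<lambda>\<omega>. (W t \<omega>, W (t + h) \<omega> - W t \<omega>))"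
    by (intro distr_cong; simp add: W_0)+
  then show ?thesis
    using indep measurable_W[OF assms(1)] unfolding indep_var_distribution_eq by simp
qed

end

section \<open>Increments of a process that is small in probability\<close>

lemma grid_mono:
  fixes \<sigma> :: "nat \<Rightarrow> real"
  assumes "\<And>i. i < n \<Longrightarrow> \<sigma> i \<le> \<sigma> (Suc i)" "i \<le> j" "j \<le> n"
  shows "\<sigma> i \<le> \<sigma> j"
  using assms(2,3)
proof (induction j rule: dec_induct)
  case (step m)
  then show ?case using assms(1)[of m] by simp
qed simp

text \<open>The mean of \<open>min 1 (norm x)\<close> metrizes convergence in probability. Being the
  expectation of a bounded function, it can be inserted directly into integrated
  inequalities.\<close>

definition small_on :: "'w measure \<Rightarrow> (real \<Rightarrow> 'w \<Rightarrow> 'h::real_normed_vector) \<Rightarrow> real \<Rightarrow> real \<Rightarrow> bool" where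
  "small_on M W T \<eta> \<longleftrightarrow> (\<forall>t\<in>{0..T}. (\<integral>\<omega>. min 1 (norm (W t \<omega>)) \<partial>M) \<le> \<eta>)"

lemma small_on_nonneg:
  assumes "small_on M W T \<eta>" "0 \<le> t" "t \<le> T"
  shows "0 \<le> \<eta>"
proof -
  have "0 \<le> (\<integral>\<omega>. min 1 (norm (W t \<omega>)) \<partial>M)" by simp
  also have "\<dots> \<le> \<eta>" using assms by (auto simp: small_on_def)
  finally show ?thesis .
qed

section \<open>Characteristic function, drift and truncated second moments\<close>

context stationary_increments
begin

abbreviation "char_fun u t \<equiv> expectation (\<lambda>\<omega>. iexp (u \<bullet> W t \<omega>))"
abbreviation "trunc_mean t \<equiv> expectation (\<lambda>\<omega>. unit_trunc (W t \<omega>))"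
abbreviation "trunc_moment t \<equiv> expectation (\<lambda>\<omega>. min 1 ((norm (W t \<omega>))\<^sup>2))"
abbreviation "gauss_mean t \<equiv> expectation (\<lambda>\<omega>. exp (- (norm (W t \<omega>))\<^sup>2 / 2))"

lemma char_add:
  assumes "0 \<le> s" "0 \<le> t"
  shows "char_fun u (s + t)
    = char_fun u s * char_fun u t"
proof -
  have [measurable]: "W s \<in> borel_measurable M" "W t \<in> borel_measurable M" "W (s + t) \<in> borel_measurable M"
    using assms measurable_W by auto
  have "char_fun u (s + t)
      = expectation (\<lambda>\<omega>. iexp (u \<bullet> W s \<omega>) * iexp (u \<bullet> (W (s + t) \<omega> - W s \<omega>)))"
    by (simp add: inner_diff_right ring_distribs flip: exp_add)
  also have "\<dots> = char_fun u s * expectation (\<lambda>\<omega>. iexp (u \<bullet> (W (s + t) \<omega> - W s \<omega>)))"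
    by (intro indep_var_lebesgue_integral
          indep_var_compose[unfolded comp_def, OF indep_var_W_increment[OF assms], of "\<lambda>x. iexp (u \<bullet> x)" _ "\<lambda>x. iexp (u \<bullet> x)"])
       (auto intro!: integrable_iexp)
  also have "expectation (\<lambda>\<omega>. iexp (u \<bullet> (W (s + t) \<omega> - W s \<omega>))) = char_fun u t"
    using expectation_increment[of s "s + t" "\<lambda>x. iexp (u \<bullet> x)"] assms by simp
  finally show ?thesis .
qed

lemma char_0: "char_fun u 0 = 1"
proof -
  have "char_fun u 0 = expectation (\<lambda>\<omega>. 1)"
    by (intro Bochner_Integration.integral_cong) (auto simp: W_0)
  then show ?thesis by (simp add: prob_space)
qed

lemma char_power:
  assumes "0 \<le> h"
  shows "char_fun u (of_nat n * h) = (char_fun u h) ^ n"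
proof (induction n)
  case 0
  show ?case using char_0 by simp
next
  case (Suc n)
  have "of_nat (Suc n) * h = of_nat n * h + h" by (simp add: algebra_simps)
  then show ?case using Suc char_add[of "of_nat n * h" h u] assms by (simp add: mult.commute)
qed

lemma char_minus_1_le:
  assumes "small_on M W T \<eta>" "norm u \<le> 1" "t \<in> {0..T}"
  shows "norm (char_fun u t - 1) \<le> 2 * \<eta>"
proof -
  have [measurable]: "W t \<in> borel_measurable M"
    using assms measurable_W by auto
  have le_2: "norm (iexp (u \<bullet> W t \<omega>) - 1) \<le> 2" for \<omega>
    using iexp_approx2[of "u \<bullet> W t \<omega>" 0] by simp
  have "char_fun u t - 1 = expectation (\<lambda>\<omega>. iexp (u \<bullet> W t \<omega>) - 1)"
    by (subst Bochner_Integration.integral_diff) (auto intro!: integrable_iexp simp: prob_space)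
  also have "norm \<dots> \<le> expectation (\<lambda>\<omega>. norm (iexp (u \<bullet> W t \<omega>) - 1))"
    by (rule integral_norm_bound)
  also have "\<dots> \<le> expectation (\<lambda>\<omega>. 2 * min 1 (norm (W t \<omega>)))"
  proof (rule integral_mono)
    fix \<omega>
    have "\<bar>u \<bullet> W t \<omega>\<bar> \<le> norm u * norm (W t \<omega>)" by (rule Cauchy_Schwarz_ineq2)
    also have "\<dots> \<le> norm (W t \<omega>)" using assms(2) by (simp add: mult_left_le_one_le)
    finally have "norm (iexp (u \<bullet> W t \<omega>) - 1) \<le> norm (W t \<omega>)"
      using iexp_approx1[of "u \<bullet> W t \<omega>" 0] by simp
    with le_2[of \<omega>] show "norm (iexp (u \<bullet> W t \<omega>) - 1) \<le> 2 * min 1 (norm (W t \<omega>))" 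
      by (smt (verit) norm_ge_zero)
  qed (auto intro!: integrable_bounded[where c=2] le_2)
  also have "\<dots> \<le> 2 * \<eta>" using assms by (simp add: small_on_def)
  finally show ?thesis .
qed

text \<open>Iterating the semigroup law over the \<open>n\<close> steps of length \<open>h\<close> that fit into \<open>[0, T]\<close> shows
  that the characteristic function leaves \<open>1\<close> at most linearly fast.\<close>
lemma char_minus_1_linear:
  assumes small: "small_on M W T \<eta>" and \<eta>: "\<eta> \<le> 1/4" and u: "norm u \<le> 1" and h: "0 \<le> h" "h \<le> T" and T: "0 < T"
  shows "norm (char_fun u h - 1) \<le> 8 * \<eta> * h / T"
proof (cases "h = 0")
  case True
  then show ?thesis by (simp add: char_0)
next
  case False
  then have h0: "0 < h" using h by simp
  define z where "z = char_fun u h"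
  define n where "n = nat \<lfloor>T / h\<rfloor>"
  have "1 \<le> T / h" using h h0 by simp
  then have n1: "1 \<le> \<lfloor>T / h\<rfloor>" by simp
  \<comment> \<open>Since T / h is at least one, rounding down loses at most a factor two; this
    turns the final 4 into 8.\<close>
  have n: "real n \<le> T / h" "T / h \<le> 2 * real n" "0 < real n"
  proof -
    have "real n = of_int \<lfloor>T / h\<rfloor>" using n1 by (simp add: n_def)
    moreover have "(1::real) \<le> of_int \<lfloor>T / h\<rfloor>" using n1 by linarith
    ultimately show "real n \<le> T / h" "T / h \<le> 2 * real n" "0 < real n"
      using floor_correct[of "T / h"] by linarith+
  qed
  have nh: "real n * h \<le> T" using n(1) h0 by (simp add: field_simps)
  have pow: "norm (z ^ k - 1) \<le> 2 * \<eta>" if "k \<le> n" for k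
  proof -
    have "real k * h \<le> real n * h" using that h by (intro mult_right_mono) auto
    then show ?thesis
      using char_minus_1_le[OF small u, of "of_nat k * h"] nh h char_power[of h u k] by (simp add: z_def)
  qed
  \<comment> \<open>From \<eta> \<le> 1/4 every power of z up to n lies within 1/2 of 1, so the
    geometric sum cannot cancel. Dividing z^n - 1 by it bounds z - 1 with the gain 1/n.\<close>
  have "real n / 2 \<le> (\<Sum>k<n. Re (z ^ k))"
  proof -
    have "1/2 \<le> Re (z ^ k)" if "k < n" for k
      using pow[of k] that \<eta> abs_Re_le_cmod[of "z ^ k - 1"] by simp
    then have "(\<Sum>k<n. 1/2) \<le> (\<Sum>k<n. Re (z ^ k))" by (intro sum_mono) auto
    then show ?thesis by simp
  qed
  also have "\<dots> \<le> norm (\<Sum>k<n. z ^ k)"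
    using complex_Re_le_cmod[of "\<Sum>k<n. z ^ k"] by simp
  finally have "norm (z - 1) * (real n / 2) \<le> norm (z - 1) * norm (\<Sum>k<n. z ^ k)"
    by (rule mult_left_mono) simp
  also have "\<dots> = norm (z ^ n - 1)"
    by (simp add: power_diff_1_eq norm_mult)
  also have "\<dots> \<le> 2 * \<eta>" by (rule pow) simp
  finally have "norm (z - 1) * real n \<le> 4 * \<eta>" by simp
  moreover have "norm (z - 1) * (T / h) \<le> norm (z - 1) * (2 * real n)"
    using n by (intro mult_left_mono) auto
  ultimately have "norm (z - 1) * (T / h) \<le> 8 * \<eta>" by simp
  then show ?thesis using T h0 by (simp add: z_def field_simps)
qed

lemma integrable_trunc [intro]:
  assumes "0 \<le> t"
  shows "integrable M (\<lambda>\<omega>. unit_trunc (W t \<omega>))" "integrable M (\<lambda>\<omega>. min 1 ((norm (W t \<omega>))\<^sup>2))"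
    "integrable M (\<lambda>\<omega>. min 1 (norm (W t \<omega>)))" "integrable M (\<lambda>\<omega>. exp (- ((norm (W t \<omega>))\<^sup>2 / 2)))"
  using measurable_W[OF assms] norm_unit_trunc_le_1
  by (auto intro!: integrable_bounded[where c=1] simp del: norm_unit_trunc)

text \<open>Pairing the mean with its own direction \<open>sgn m\<close> turns its norm into the
  mean of a scalar. There the truncation is replaced by a sine, whose mean is the imaginary part of
  a characteristic function and hence small by \<open>char_minus_1_linear\<close>.\<close>

lemma drift_bound:
  assumes small: "small_on M W T \<eta>" and \<eta>: "\<eta> \<le> 1/4" and h: "0 \<le> h" "h \<le> T" and T: "0 < T"
  shows "norm (trunc_mean h)
    \<le> 8 * \<eta> * h / T + 2 * trunc_moment h"
proof -
  define m where "m = trunc_mean h"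
  define u where "u = sgn m"
  have u: "norm u \<le> 1" by (simp add: u_def norm_sgn)
  have [measurable]: "W h \<in> borel_measurable M" using h by (intro measurable_W)
  have "norm m = u \<bullet> m" by (cases "m = 0") (simp_all add: u_def sgn_div_norm power2_norm_eq_inner[symmetric] power2_eq_square)
  also have "\<dots> = expectation (\<lambda>\<omega>. u \<bullet> unit_trunc (W h \<omega>))"
    unfolding m_def using h by (intro integral_inner_right[symmetric]) auto
  also have "\<dots> \<le> expectation (\<lambda>\<omega>. sin (u \<bullet> W h \<omega>) + 2 * min 1 ((norm (W h \<omega>))\<^sup>2))"
  proof (rule integral_mono)
    show "u \<bullet> unit_trunc (W h \<omega>) \<le> sin (u \<bullet> W h \<omega>) + 2 * min 1 ((norm (W h \<omega>))\<^sup>2)" for \<omega>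
      using sin_minus_unit_trunc[OF u, of "W h \<omega>"] by linarith
  qed (use h in \<open>auto intro!: Bochner_Integration.integrable_add integrable_trunc integrable_bounded[where c=1 and f="\<lambda>\<omega>. sin (_ \<omega>)"]\<close>)
  also have "\<dots> = expectation (\<lambda>\<omega>. sin (u \<bullet> W h \<omega>)) + 2 * trunc_moment h"
    using h by (subst Bochner_Integration.integral_add)
      (auto intro!: integrable_trunc integrable_bounded[where c=1 and f="\<lambda>\<omega>. sin (_ \<omega>)"])
  also have "expectation (\<lambda>\<omega>. sin (u \<bullet> W h \<omega>)) = Im (char_fun u h)"
    using integral_Im[of M "\<lambda>\<omega>. iexp (u \<bullet> W h \<omega>)"] integrable_iexp[of "\<lambda>\<omega>. of_real (u \<bullet> W h \<omega>)"]
    by (simp add: Im_exp)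
  also have "\<dots> \<le> 8 * \<eta> * h / T"
    using char_minus_1_linear[OF small \<eta> u h T] abs_Im_le_cmod[of "char_fun u h - 1"] by simp
  finally show ?thesis by (simp add: m_def)
qed

text \<open>\<open>gauss_kernel_increment\<close> is integrated at \<open>W t\<close> and an
  independent increment. With G the truncated second moment, the errors cost 4 \<eta> G directly and
  2 \<eta> G through the drift; 3/8 - 6 \<eta> \<ge> 1/4 holds exactly for \<eta> \<le> 1/48, which
  is the origin of that threshold.\<close>

lemma second_moment_increment:
  assumes small: "small_on M W T \<eta>" and \<eta>: "\<eta> \<le> 1/48"
    and t: "0 \<le> t" "t \<le> T" and h: "0 \<le> h" "h \<le> T" and T: "0 < T"
  shows "trunc_moment h / 4
    \<le> gauss_mean t - gauss_mean (t + h)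
      + 8 * \<eta>\<^sup>2 * h / T"
proof -
  define G m where "G = trunc_moment h"
    and "m = trunc_mean h"
  define X where "X = (\<lambda>\<omega>. W (t + h) \<omega> - W t \<omega>)"
  \<comment> \<open>Minus the gradient of the Gaussian kernel at \<open>W t\<close>. Its norm is at
    most \<open>min 1 (norm (W t \<omega>))\<close>, so its mean is bounded by \<eta> although
    \<open>W t\<close> itself may have no mean.\<close>
  define U where "U = (\<lambda>\<omega>. exp (- (norm (W t \<omega>))\<^sup>2 / 2) *\<^sub>R W t \<omega>)"
  have [measurable]: "W t \<in> borel_measurable M" "W (t + h) \<in> borel_measurable M"
    using t h measurable_W by auto
  have [measurable]: "X \<in> borel_measurable M" "U \<in> borel_measurable M" by (auto simp: X_def U_def)
  have \<eta>0: "0 \<le> \<eta>" using small_on_nonneg[OF small t] .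
  have G0: "0 \<le> G" by (simp add: G_def)
  have indep: "indep_var borel (W t) borel X"
    unfolding X_def by (rule indep_var_W_increment[OF t(1) h(1)])
  have GX: "expectation (\<lambda>\<omega>. min 1 ((norm (X \<omega>))\<^sup>2)) = G"
    and mX: "expectation (\<lambda>\<omega>. unit_trunc (X \<omega>)) = m"
    using expectation_increment[of t "t + h" "\<lambda>x. min 1 ((norm x)\<^sup>2)"]
      expectation_increment[of t "t + h" unit_trunc] t h
    by (auto simp: X_def G_def m_def)
  have intX: "integrable M (\<lambda>\<omega>. unit_trunc (X \<omega>))" "integrable M (\<lambda>\<omega>. min 1 ((norm (X \<omega>))\<^sup>2))"
    by (auto intro!: integrable_bounded[where c=1] norm_unit_trunc_le_1)
  have normU: "norm (U \<omega>) \<le> min 1 (norm (W t \<omega>))" for \<omega>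
    using gauss_mult_le(1)[of "norm (W t \<omega>)"] by (simp add: U_def)
  have intU: "integrable M U"
    using normU by (intro integrable_bounded[where c=1]) auto
  have "norm (expectation U) \<le> expectation (\<lambda>\<omega>. min 1 (norm (W t \<omega>)))"
    using t intU by (intro order_trans[OF integral_norm_bound] integral_mono normU) auto
  also have "\<dots> \<le> \<eta>" using small t by (auto simp: small_on_def)
  finally have EU: "norm (expectation U) \<le> \<eta>" .
  have iUX: "integrable M (\<lambda>\<omega>. U \<omega> \<bullet> unit_trunc (X \<omega>))"
    and "expectation (\<lambda>\<omega>. U \<omega> \<bullet> unit_trunc (X \<omega>)) = expectation U \<bullet> m"
    using expectation_inner_indep[OF _ intU intX(1)] mX
      indep_var_compose[unfolded comp_def, OF indep, of "\<lambda>x. exp (- (norm x)\<^sup>2 / 2) *\<^sub>R x" borel unit_trunc borel]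
    by (auto simp: U_def)
  moreover have "\<bar>expectation U \<bullet> m\<bar> \<le> \<eta> * norm m"
    using EU by (intro order_trans[OF Cauchy_Schwarz_ineq2] mult_right_mono) auto
  ultimately have lin: "- (\<eta> * norm m) \<le> expectation (\<lambda>\<omega>. U \<omega> \<bullet> unit_trunc (X \<omega>))" by simp
  have iP: "integrable M (\<lambda>\<omega>. min 1 (norm (W t \<omega>)) * min 1 ((norm (X \<omega>))\<^sup>2))"
    and "expectation (\<lambda>\<omega>. min 1 (norm (W t \<omega>)) * min 1 ((norm (X \<omega>))\<^sup>2))
      = expectation (\<lambda>\<omega>. min 1 (norm (W t \<omega>))) * G"
    using indep_var_lebesgue_integral[OF indep_var_compose[unfolded comp_def, OF indep, of "\<lambda>x. min 1 (norm x)" borel "\<lambda>x. min 1 ((norm x)\<^sup>2)" borel]]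
      indep_var_integrable[OF indep_var_compose[unfolded comp_def, OF indep, of "\<lambda>x. min 1 (norm x)" borel "\<lambda>x. min 1 ((norm x)\<^sup>2)" borel]]
      intX t GX by auto
  moreover have "expectation (\<lambda>\<omega>. min 1 (norm (W t \<omega>))) * G \<le> \<eta> * G"
    using small t G0 by (intro mult_right_mono) (auto simp: small_on_def)
  ultimately have quad: "expectation (\<lambda>\<omega>. min 1 (norm (W t \<omega>)) * min 1 ((norm (X \<omega>))\<^sup>2)) \<le> \<eta> * G"
    by simp
  have "3/8 * G - 4 * expectation (\<lambda>\<omega>. min 1 (norm (W t \<omega>)) * min 1 ((norm (X \<omega>))\<^sup>2))
    = expectation (\<lambda>\<omega>. 3/8 * min 1 ((norm (X \<omega>))\<^sup>2) - 4 * (min 1 (norm (W t \<omega>)) * min 1 ((norm (X \<omega>))\<^sup>2)))"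
    using intX iP by (subst Bochner_Integration.integral_diff) (auto simp: GX)
  also have "\<dots> \<le> expectation (\<lambda>\<omega>. exp (- (norm (W t \<omega>))\<^sup>2 / 2) - exp (- (norm (W (t + h) \<omega>))\<^sup>2 / 2)
      - U \<omega> \<bullet> unit_trunc (X \<omega>))"
  proof (rule integral_mono)
    show "3/8 * min 1 ((norm (X \<omega>))\<^sup>2) - 4 * (min 1 (norm (W t \<omega>)) * min 1 ((norm (X \<omega>))\<^sup>2))
      \<le> exp (- (norm (W t \<omega>))\<^sup>2 / 2) - exp (- (norm (W (t + h) \<omega>))\<^sup>2 / 2) - U \<omega> \<bullet> unit_trunc (X \<omega>)" for \<omega>
      using gauss_kernel_increment[of "W t \<omega>" "X \<omega>"] by (simp add: X_def U_def algebra_simps)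
  qed (use intX iP iUX t h in \<open>auto intro!: Bochner_Integration.integrable_diff integrable_trunc\<close>)
  also have "\<dots> = gauss_mean t
      - gauss_mean (t + h) - expectation (\<lambda>\<omega>. U \<omega> \<bullet> unit_trunc (X \<omega>))"
    using iUX t h by (simp add: integrable_trunc)
  finally have main: "3/8 * G - 4 * \<eta> * G \<le> gauss_mean t
      - gauss_mean (t + h) + \<eta> * norm m"
    using quad lin by linarith
  have "norm m \<le> 8 * \<eta> * h / T + 2 * G"
    using drift_bound[OF small _ h T] \<eta> by (simp add: m_def G_def)
  then have "\<eta> * norm m \<le> \<eta> * (8 * \<eta> * h / T + 2 * G)" by (intro mult_left_mono \<eta>0)
  moreover have "\<eta> * G \<le> 1/48 * G" using \<eta> G0 by (intro mult_right_mono)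
  moreover have "\<eta> * (8 * \<eta> * h / T + 2 * G) = 8 * \<eta>\<^sup>2 * h / T + 2 * (\<eta> * G)"
    by (simp add: power2_eq_square algebra_simps)
  ultimately show ?thesis using main unfolding G_def[symmetric] by linarith
qed

text \<open>The Gaussian means telescope, and their total drop 1 - \<open>gauss_mean (u n)\<close>
  is at most \<eta>, however fine the grid. The \<eta>^2 terms are weighted by time fractions that
  sum to at most one. Numerically 4 (\<eta> + 8 \<eta>^2) \<le> 8 \<eta>; the drift bound then gives
  8 \<eta> + 16 \<eta>.\<close>

lemma sum_second_moments:
  assumes small: "small_on M W T \<eta>" and \<eta>: "\<eta> \<le> 1/48" and T: "0 < T"
    and u: "u 0 = 0" "\<And>i. i < n \<Longrightarrow> u i \<le> u (Suc i)" "u n \<le> T"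
  shows "(\<Sum>i<n. trunc_moment (u (Suc i) - u i)) \<le> 8 * \<eta>"
    and "(\<Sum>i<n. norm (trunc_mean (u (Suc i) - u i))) \<le> 24 * \<eta>"
proof -
  define k where "k = (\<lambda>i. gauss_mean (u i))"
  define G where "G = (\<lambda>i. trunc_moment (u (Suc i) - u i))"
  have mono: "i \<le> j \<Longrightarrow> j \<le> n \<Longrightarrow> u i \<le> u j" for i j
    using u(2) by (rule grid_mono)
  have ui: "0 \<le> u i" "u i \<le> T" if "i \<le> n" for i
    using mono[of 0 i] mono[of i n] that u by auto
  have \<eta>0: "0 \<le> \<eta>" using small_on_nonneg[OF small order_refl] T by simp
  have step: "0 \<le> u (Suc i) - u i" "u (Suc i) - u i \<le> T" if "i < n" for i
    using u(2)[OF that] ui[of i] ui[of "Suc i"] that by auto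
  have tel: "(\<Sum>i<n. 8 * c * (u (Suc i) - u i) / T) \<le> 8 * c" if "0 \<le> c" for c
  proof -
    have "(\<Sum>i<n. 8 * c * (u (Suc i) - u i) / T) = 8 * c / T * (\<Sum>i<n. u (Suc i) - u i)"
      by (simp add: sum_distrib_left)
    also have "\<dots> = 8 * c / T * u n" by (simp add: sum_lessThan_telescope u)
    also have "\<dots> \<le> 8 * c / T * T" using that T u by (intro mult_left_mono) auto
    finally show ?thesis using T by simp
  qed
  have "(\<Sum>i<n. G i / 4) \<le> (\<Sum>i<n. (k i - k (Suc i)) + 8 * \<eta>\<^sup>2 * (u (Suc i) - u i) / T)"
  proof (rule sum_mono)
    fix i assume "i \<in> {..<n}"
    then show "G i / 4 \<le> (k i - k (Suc i)) + 8 * \<eta>\<^sup>2 * (u (Suc i) - u i) / T"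
      using second_moment_increment[OF small \<eta> _ _ _ _ T, of "u i" "u (Suc i) - u i"] ui[of i] step[of i]
      by (simp add: G_def k_def)
  qed
  also have "\<dots> \<le> (k 0 - k n) + 8 * \<eta>\<^sup>2"
    using tel[of "\<eta>\<^sup>2"] by (simp add: sum.distrib sum_lessThan_telescope')
  also have "k 0 = 1"
  proof -
    have "k 0 = expectation (\<lambda>\<omega>. 1)"
      unfolding k_def u(1) by (intro Bochner_Integration.integral_cong) (auto simp: W_0)
    then show ?thesis by (simp add: prob_space)
  qed
  also have "1 - k n = expectation (\<lambda>\<omega>. 1 - exp (- (norm (W (u n) \<omega>))\<^sup>2 / 2))"
    unfolding k_def using ui[of n]
    by (subst Bochner_Integration.integral_diff) (auto simp: prob_space)
  also have "\<dots> \<le> expectation (\<lambda>\<omega>. min 1 (norm (W (u n) \<omega>)))"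
  proof (rule integral_mono)
    show "1 - exp (- (norm (W (u n) \<omega>))\<^sup>2 / 2) \<le> min 1 (norm (W (u n) \<omega>))" for \<omega>
      using gauss_mult_le(3)[of "norm (W (u n) \<omega>)"] by simp
  qed (use ui[of n] in auto)
  also have "\<dots> \<le> \<eta>" using small ui[of n] by (auto simp: small_on_def)
  finally have "(\<Sum>i<n. G i) / 4 \<le> \<eta> + 8 * \<eta>\<^sup>2" by (simp add: sum_divide_distrib)
  moreover have "\<eta>\<^sup>2 \<le> \<eta> / 48"
    using \<eta> \<eta>0 mult_left_mono[of \<eta> "1/48" \<eta>] by (simp add: power2_eq_square)
  ultimately have sumG: "(\<Sum>i<n. G i) \<le> 8 * \<eta>" using \<eta>0 by linarith
  then show "(\<Sum>i<n. trunc_moment (u (Suc i) - u i)) \<le> 8 * \<eta>"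
    by (simp add: G_def)
  have "(\<Sum>i<n. norm (trunc_mean (u (Suc i) - u i)))
      \<le> (\<Sum>i<n. 8 * \<eta> * (u (Suc i) - u i) / T + 2 * G i)"
    unfolding G_def using \<eta> step by (intro sum_mono drift_bound[OF small _ _ _ T]) auto
  also have "\<dots> = (\<Sum>i<n. 8 * \<eta> * (u (Suc i) - u i) / T) + 2 * (\<Sum>i<n. G i)"
    by (simp add: sum.distrib sum_distrib_left)
  also have "\<dots> \<le> 24 * \<eta>" using tel[OF \<eta>0] sumG by linarith
  finally show "(\<Sum>i<n. norm (trunc_mean (u (Suc i) - u i))) \<le> 24 * \<eta>" .
qed

text \<open>After centring, the terms are independent with mean zero, hence orthogonal, and their
  second moments add up to at most 8 \<eta> C^2. The means contribute a vector b of norm at most 24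
  \<eta> C. Then |v + b|^2 \<le> 2 |v|^2 + 2 |b|^2 produces 16 and 2 times 576. Only a common norm
  bound on the operators enters.\<close>

lemma truncated_sum_second_moment:
  fixes B :: "nat \<Rightarrow> 'h \<Rightarrow> 'h"
  assumes small: "small_on M W T \<eta>" and \<eta>: "\<eta> \<le> 1/48" and T: "0 < T"
    and u: "u 0 = 0" "\<And>i. i < n \<Longrightarrow> u i \<le> u (Suc i)" "u n \<le> T"
    and B: "\<And>i. i < n \<Longrightarrow> bounded_linear (B i)" "\<And>i x. i < n \<Longrightarrow> norm (B i x) \<le> C * norm x"
    and C: "0 \<le> C"
  shows "integrable M (\<lambda>\<omega>. (norm (\<Sum>i<n. B i (unit_trunc (W (u (Suc i)) \<omega> - W (u i) \<omega>))))\<^sup>2)"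
    and "expectation (\<lambda>\<omega>. (norm (\<Sum>i<n. B i (unit_trunc (W (u (Suc i)) \<omega> - W (u i) \<omega>))))\<^sup>2)
      \<le> C\<^sup>2 * (16 * \<eta> + 1152 * \<eta>\<^sup>2)"
proof -
  define X where "X = (\<lambda>i \<omega>. W (u (Suc i)) \<omega> - W (u i) \<omega>)"
  define m where "m = (\<lambda>i. trunc_mean (u (Suc i) - u i))"
  define V where "V = (\<lambda>i \<omega>. B i (unit_trunc (X i \<omega>)))"
  define V0 where "V0 = (\<lambda>i \<omega>. V i \<omega> - B i (m i))"
  have u0: "0 \<le> u i" if "i \<le> n" for i
    using grid_mono[of n u 0 i] u that by simp
  have [measurable]: "X i \<in> borel_measurable M" if "i < n" for i
    unfolding X_def using u0[of i] u0[of "Suc i"] that by (intro borel_measurable_diff measurable_W) auto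
  have BM [measurable]: "B i \<in> borel_measurable borel" if "i < n" for i
    using B(1)[OF that] by (intro borel_measurable_continuous_onI linear_continuous_on)
  have VM [measurable]: "V i \<in> borel_measurable M" if "i < n" for i
    unfolding V_def using that by measurable
  have V0M [measurable]: "V0 i \<in> borel_measurable M" if "i < n" for i
    unfolding V0_def using that by measurable
  have bV: "norm (V i \<omega>) \<le> C * min 1 (norm (X i \<omega>))" if "i < n" for i \<omega>
    using B(2)[OF that, of "unit_trunc (X i \<omega>)"] by (simp add: V_def norm_unit_trunc)
  have bV1: "norm (V i \<omega>) \<le> C" if "i < n" for i \<omega>
    using bV[OF that, of \<omega>] C by (meson min.cobounded1 mult_left_le norm_ge_zero order_trans)
  have iV: "integrable M (V i)" if "i < n" for i
    using VM[OF that] bV1[OF that] by (rule integrable_bounded)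
  have iX: "integrable M (\<lambda>\<omega>. unit_trunc (X i \<omega>))" if "i < n" for i
    using that by (intro integrable_bounded[where c=1] norm_unit_trunc_le_1) measurable
  have EX: "expectation (\<lambda>\<omega>. f (X i \<omega>)) = expectation (\<lambda>\<omega>. f (W (u (Suc i) - u i) \<omega>))"
    if "i < n" "f \<in> borel_measurable borel" for f :: "'h \<Rightarrow> 'b::{banach, second_countable_topology}" and i
    unfolding X_def using that u(2) u0[of i] by (intro expectation_increment) auto
  have EV: "expectation (V i) = B i (m i)" if "i < n" for i
    unfolding V_def m_def
    using integral_bounded_linear[OF B(1)[OF that] iX[OF that]] EX[OF that, of unit_trunc] by simp
  have bV0: "norm (V0 i \<omega>) \<le> C + norm (B i (m i))" if "i < n" for i \<omega>
    unfolding V0_def using bV1[OF that, of \<omega>] norm_triangle_ineq4[of "V i \<omega>" "B i (m i)"] by linarith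
  have iV0: "integrable M (V0 i)" "expectation (V0 i) = 0" if "i < n" for i
    unfolding V0_def using iV[OF that] EV[OF that] by (auto simp: prob_space)
  have orth: "expectation (\<lambda>\<omega>. V0 i \<omega> \<bullet> V0 j \<omega>) = 0" if "i < n" "j < n" "i \<noteq> j" for i j
  proof -
    have "indep_var borel (V0 i) borel (V0 j)"
      using indep_var_compose[unfolded comp_def, OF indep_var_increments[of u n i j],
          of "\<lambda>x. B i (unit_trunc x) - B i (m i)" borel "\<lambda>x. B j (unit_trunc x) - B j (m j)" borel]
        that u BM by (auto simp: V0_def V_def X_def)
    then show ?thesis using expectation_inner_indep(2)[of "V0 i" "V0 j"] iV0 that by simp
  qed
  have iprod: "integrable M (\<lambda>\<omega>. V0 i \<omega> \<bullet> V0 j \<omega>)" if "i < n" "j < n" for i j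
  proof (rule integrable_bounded[where c="(C + norm (B i (m i))) * (C + norm (B j (m j)))"])
    show "(\<lambda>\<omega>. V0 i \<omega> \<bullet> V0 j \<omega>) \<in> borel_measurable M" using that by measurable
    show "norm (V0 i \<omega> \<bullet> V0 j \<omega>) \<le> (C + norm (B i (m i))) * (C + norm (B j (m j)))" for \<omega>
      using bV0 that C by (auto intro!: order_trans[OF Cauchy_Schwarz_ineq2] mult_mono)
  qed
  have sq: "(norm (\<Sum>i<n. V0 i \<omega>))\<^sup>2 = (\<Sum>i<n. \<Sum>j<n. V0 i \<omega> \<bullet> V0 j \<omega>)" for \<omega>
    unfolding power2_norm_eq_inner inner_sum_left unfolding inner_sum_right ..
  have iS0: "integrable M (\<lambda>\<omega>. (norm (\<Sum>i<n. V0 i \<omega>))\<^sup>2)"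
    unfolding sq using iprod by (intro Bochner_Integration.integrable_sum) auto
  have "expectation (\<lambda>\<omega>. (norm (\<Sum>i<n. V0 i \<omega>))\<^sup>2) = (\<Sum>i<n. \<Sum>j<n. expectation (\<lambda>\<omega>. V0 i \<omega> \<bullet> V0 j \<omega>))"
    unfolding sq using iprod
    by (subst Bochner_Integration.integral_sum)
      (auto intro!: sum.cong Bochner_Integration.integral_sum Bochner_Integration.integrable_sum)
  also have "\<dots> = (\<Sum>i<n. expectation (\<lambda>\<omega>. V0 i \<omega> \<bullet> V0 i \<omega>))"
  proof (rule sum.cong[OF refl])
    fix i assume i: "i \<in> {..<n}"
    have "(\<Sum>j<n. expectation (\<lambda>\<omega>. V0 i \<omega> \<bullet> V0 j \<omega>)) = (\<Sum>j\<in>{i}. expectation (\<lambda>\<omega>. V0 i \<omega> \<bullet> V0 j \<omega>))"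
      using i orth by (intro sum.mono_neutral_right) auto
    then show "(\<Sum>j<n. expectation (\<lambda>\<omega>. V0 i \<omega> \<bullet> V0 j \<omega>)) = expectation (\<lambda>\<omega>. V0 i \<omega> \<bullet> V0 i \<omega>)" by simp
  qed
  also have "\<dots> \<le> (\<Sum>i<n. C\<^sup>2 * (trunc_moment (u (Suc i) - u i)))"
  proof (rule sum_mono)
    fix i assume "i \<in> {..<n}"
    then have i: "i < n" by simp
    have iVV: "integrable M (\<lambda>\<omega>. V i \<omega> \<bullet> V i \<omega>)"
    proof (rule integrable_bounded[where c="C * C"])
      show "(\<lambda>\<omega>. V i \<omega> \<bullet> V i \<omega>) \<in> borel_measurable M" using i by measurable
      show "norm (V i \<omega> \<bullet> V i \<omega>) \<le> C * C" for \<omega>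
        unfolding real_norm_def
        by (intro order_trans[OF Cauchy_Schwarz_ineq2] mult_mono bV1 i C) auto
    qed
    have "expectation (\<lambda>\<omega>. V0 i \<omega> \<bullet> V0 i \<omega>)
        = expectation (\<lambda>\<omega>. V i \<omega> \<bullet> V i \<omega> - 2 * (V i \<omega> \<bullet> B i (m i)) + B i (m i) \<bullet> B i (m i))"
      by (simp add: V0_def inner_diff inner_commute algebra_simps)
    also have "\<dots> = expectation (\<lambda>\<omega>. V i \<omega> \<bullet> V i \<omega>) - B i (m i) \<bullet> B i (m i)"
      using iVV iV[OF i] EV[OF i] by (simp add: prob_space)
    also have "\<dots> \<le> expectation (\<lambda>\<omega>. V i \<omega> \<bullet> V i \<omega>)" by simp
    also have "\<dots> \<le> expectation (\<lambda>\<omega>. C\<^sup>2 * min 1 ((norm (X i \<omega>))\<^sup>2))"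
    proof (rule integral_mono[OF iVV])
      show "integrable M (\<lambda>\<omega>. C\<^sup>2 * min 1 ((norm (X i \<omega>))\<^sup>2))"
        using i by (intro integrable_mult_right integrable_bounded[where c=1]) auto
      show "V i \<omega> \<bullet> V i \<omega> \<le> C\<^sup>2 * min 1 ((norm (X i \<omega>))\<^sup>2)" for \<omega>
        using power_mono[OF bV[OF i, of \<omega>], of 2]
        by (simp add: power_mult_distrib norm_unit_trunc[symmetric] norm_unit_trunc_sq power2_norm_eq_inner[symmetric])
    qed
    also have "\<dots> = C\<^sup>2 * expectation (\<lambda>\<omega>. min 1 ((norm (X i \<omega>))\<^sup>2))" by simp
    also have "expectation (\<lambda>\<omega>. min 1 ((norm (X i \<omega>))\<^sup>2)) = trunc_moment (u (Suc i) - u i)"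
      using EX[OF i, of "\<lambda>x. min 1 ((norm x)\<^sup>2)"] by simp
    finally show "expectation (\<lambda>\<omega>. V0 i \<omega> \<bullet> V0 i \<omega>) \<le> C\<^sup>2 * trunc_moment (u (Suc i) - u i)" .
  qed
  also have "\<dots> \<le> C\<^sup>2 * (8 * \<eta>)"
    unfolding sum_distrib_left[symmetric] by (intro mult_left_mono sum_second_moments(1)[OF small \<eta> T u]) auto
  finally have S0: "expectation (\<lambda>\<omega>. (norm (\<Sum>i<n. V0 i \<omega>))\<^sup>2) \<le> C\<^sup>2 * (8 * \<eta>)" .
  define b where "b = (\<Sum>i<n. B i (m i))"
  have "norm b \<le> (\<Sum>i<n. C * norm (m i))"
    unfolding b_def using B(2) by (intro order_trans[OF norm_sum] sum_mono) auto
  also have "\<dots> \<le> C * (24 * \<eta>)"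
    unfolding sum_distrib_left[symmetric] m_def
    by (intro mult_left_mono sum_second_moments(2)[OF small \<eta> T u] C)
  finally have "(norm b)\<^sup>2 \<le> (C * (24 * \<eta>))\<^sup>2" by (intro power_mono) auto
  then have b: "(norm b)\<^sup>2 \<le> C\<^sup>2 * (576 * \<eta>\<^sup>2)" by (simp add: power_mult_distrib)
  have S: "(\<Sum>i<n. V i \<omega>) = (\<Sum>i<n. V0 i \<omega>) + b" for \<omega>
    by (simp add: V0_def b_def sum_subtractf)
  have bound: "(norm (\<Sum>i<n. V i \<omega>))\<^sup>2 \<le> 2 * (norm (\<Sum>i<n. V0 i \<omega>))\<^sup>2 + 2 * (norm b)\<^sup>2" for \<omega>
  proof -
    have "(norm (\<Sum>i<n. V i \<omega>))\<^sup>2 \<le> (norm (\<Sum>i<n. V0 i \<omega>) + norm b)\<^sup>2"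
      unfolding S by (intro power_mono norm_triangle_ineq) auto
    also have "\<dots> \<le> 2 * (norm (\<Sum>i<n. V0 i \<omega>))\<^sup>2 + 2 * (norm b)\<^sup>2" 
      using zero_le_power2[of "norm (\<Sum>i<n. V0 i \<omega>) - norm b"] by (simp add: power2_eq_square algebra_simps)
    finally show ?thesis .
  qed
  have i2: "integrable M (\<lambda>\<omega>. 2 * (norm (\<Sum>i<n. V0 i \<omega>))\<^sup>2 + 2 * (norm b)\<^sup>2)"
    using iS0 by simp
  have iS: "integrable M (\<lambda>\<omega>. (norm (\<Sum>i<n. V i \<omega>))\<^sup>2)"
  proof (rule Bochner_Integration.integrable_bound[OF i2])
    show "(\<lambda>\<omega>. (norm (\<Sum>i<n. V i \<omega>))\<^sup>2) \<in> borel_measurable M"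
      using VM by (intro borel_measurable_power borel_measurable_norm[THEN measurable_compose[rotated]] borel_measurable_sum) auto
    show "AE \<omega> in M. norm ((norm (\<Sum>i<n. V i \<omega>))\<^sup>2) \<le> norm (2 * (norm (\<Sum>i<n. V0 i \<omega>))\<^sup>2 + 2 * (norm b)\<^sup>2)"
      using bound by (intro AE_I2) (auto intro: order_trans)
  qed
  then show "integrable M (\<lambda>\<omega>. (norm (\<Sum>i<n. B i (unit_trunc (W (u (Suc i)) \<omega> - W (u i) \<omega>))))\<^sup>2)"
    by (simp add: V_def X_def)
  have "expectation (\<lambda>\<omega>. (norm (\<Sum>i<n. V i \<omega>))\<^sup>2) \<le> expectation (\<lambda>\<omega>. 2 * (norm (\<Sum>i<n. V0 i \<omega>))\<^sup>2 + 2 * (norm b)\<^sup>2)"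
    by (intro integral_mono iS i2 bound)
  also have "\<dots> = 2 * expectation (\<lambda>\<omega>. (norm (\<Sum>i<n. V0 i \<omega>))\<^sup>2) + 2 * (norm b)\<^sup>2"
    using iS0 by (simp add: prob_space)
  also have "\<dots> \<le> C\<^sup>2 * (16 * \<eta> + 1152 * \<eta>\<^sup>2)" using S0 b by (simp add: algebra_simps)
  finally show "expectation (\<lambda>\<omega>. (norm (\<Sum>i<n. B i (unit_trunc (W (u (Suc i)) \<omega> - W (u i) \<omega>))))\<^sup>2)
      \<le> C\<^sup>2 * (16 * \<eta> + 1152 * \<eta>\<^sup>2)"
    by (simp add: V_def X_def)
qed

end

text \<open>Unless some increment exceeds one in norm, truncation changes nothing. That event has
  probability at most 8 \<eta>, because the truncated square dominates the indicator of a large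
  increment; for the truncated sum the second moment and Markov's inequality apply.\<close>

lemma (in stationary_increments) operator_sum_tail:
  fixes B :: "nat \<Rightarrow> 'h \<Rightarrow> 'h"
  assumes small: "small_on M W T \<eta>" and \<eta>: "\<eta> \<le> 1/48" and T: "0 < T"
    and u: "u 0 = 0" "\<And>i. i < n \<Longrightarrow> u i \<le> u (Suc i)" "u n \<le> T"
    and B: "\<And>i. i < n \<Longrightarrow> bounded_linear (B i)" "\<And>i x. i < n \<Longrightarrow> norm (B i x) \<le> C * norm x"
    and C: "0 \<le> C" and \<epsilon>: "0 < \<epsilon>"
  shows "prob {\<omega>\<in>space M. norm (\<Sum>i<n. B i (W (u (Suc i)) \<omega> - W (u i) \<omega>)) > \<epsilon>}
    \<le> 8 * \<eta> + C\<^sup>2 * (16 * \<eta> + 1152 * \<eta>\<^sup>2) / \<epsilon>\<^sup>2"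
proof -
  define X where "X = (\<lambda>i \<omega>. W (u (Suc i)) \<omega> - W (u i) \<omega>)"
  define S where "S = (\<lambda>\<omega>. (norm (\<Sum>i<n. B i (unit_trunc (X i \<omega>))))\<^sup>2)"
  have u0: "0 \<le> u i" if "i \<le> n" for i
    using grid_mono[of n u 0 i] u that by simp
  have XM: "X i \<in> borel_measurable M" if "i < n" for i
    unfolding X_def using u0[of i] u0[of "Suc i"] that by (intro borel_measurable_diff measurable_W) auto
  have S: "integrable M S" "expectation S \<le> C\<^sup>2 * (16 * \<eta> + 1152 * \<eta>\<^sup>2)"
    unfolding S_def X_def using truncated_sum_second_moment[OF small \<eta> T u B C] by auto
  have SM: "S \<in> borel_measurable M" using S(1) by (rule borel_measurable_integrable)
  have E1: "{\<omega>\<in>space M. norm (X i \<omega>) > 1} \<in> sets M" if "i < n" for i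
    using XM[OF that] by measurable
  have E2: "{\<omega>\<in>space M. \<epsilon>\<^sup>2 \<le> S \<omega>} \<in> sets M" using SM by measurable
  have "{\<omega>\<in>space M. norm (\<Sum>i<n. B i (X i \<omega>)) > \<epsilon>}
      \<subseteq> (\<Union>i<n. {\<omega>\<in>space M. norm (X i \<omega>) > 1}) \<union> {\<omega>\<in>space M. \<epsilon>\<^sup>2 \<le> S \<omega>}"
  proof (intro subsetI, rule UnCI, elim CollectE conjE)
    fix \<omega> assume \<omega>: "\<omega> \<in> space M" "norm (\<Sum>i<n. B i (X i \<omega>)) > \<epsilon>"
      "\<omega> \<notin> {\<omega>\<in>space M. \<epsilon>\<^sup>2 \<le> S \<omega>}"
    show "\<omega> \<in> (\<Union>i<n. {\<omega>\<in>space M. norm (X i \<omega>) > 1})"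
    proof (rule ccontr)
      assume "\<not> ?thesis"
      then have "unit_trunc (X i \<omega>) = X i \<omega>" if "i < n" for i
        using that \<omega>(1) by (intro unit_trunc_id) (auto simp: not_less)
      then have "S \<omega> = (norm (\<Sum>i<n. B i (X i \<omega>)))\<^sup>2" by (simp add: S_def)
      moreover have "\<epsilon>\<^sup>2 \<le> (norm (\<Sum>i<n. B i (X i \<omega>)))\<^sup>2"
        using \<omega>(2) \<epsilon> by (intro power_mono) auto
      ultimately show False using \<omega>(1,3) by simp
    qed
  qed
  then have "prob {\<omega>\<in>space M. norm (\<Sum>i<n. B i (X i \<omega>)) > \<epsilon>}
      \<le> prob ((\<Union>i<n. {\<omega>\<in>space M. norm (X i \<omega>) > 1}) \<union> {\<omega>\<in>space M. \<epsilon>\<^sup>2 \<le> S \<omega>})"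
    using E1 E2 by (intro finite_measure_mono) auto
  also have "\<dots> \<le> (\<Sum>i<n. prob {\<omega>\<in>space M. norm (X i \<omega>) > 1}) + prob {\<omega>\<in>space M. \<epsilon>\<^sup>2 \<le> S \<omega>}"
    using E1 E2 by (intro order_trans[OF measure_Un_le] add_mono order_refl finite_measure_subadditive_finite) auto
  also have "prob {\<omega>\<in>space M. \<epsilon>\<^sup>2 \<le> S \<omega>} \<le> expectation S / \<epsilon>\<^sup>2"
    using integral_Markov_inequality_measure[OF S(1) E2, of "\<epsilon>\<^sup>2"] \<epsilon> by (auto simp: S_def)
  also have "\<dots> \<le> C\<^sup>2 * (16 * \<eta> + 1152 * \<eta>\<^sup>2) / \<epsilon>\<^sup>2"
    using S(2) by (intro divide_right_mono) auto
  also have "(\<Sum>i<n. prob {\<omega>\<in>space M. norm (X i \<omega>) > 1})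
      \<le> (\<Sum>i<n. trunc_moment (u (Suc i) - u i))"
  proof (rule sum_mono)
    fix i assume "i \<in> {..<n}"
    then have i: "i < n" by simp
    have iX: "integrable M (\<lambda>\<omega>. min 1 ((norm (X i \<omega>))\<^sup>2))"
      using XM[OF i] by (intro integrable_bounded[where c=1]) auto
    have "prob {\<omega>\<in>space M. norm (X i \<omega>) > 1} = expectation (indicator {\<omega>\<in>space M. norm (X i \<omega>) > 1})"
      using E1[OF i] by simp
    also have "\<dots> \<le> expectation (\<lambda>\<omega>. min 1 ((norm (X i \<omega>))\<^sup>2))"
      using E1[OF i] iX
      by (intro integral_mono) (auto simp: indicator_def one_le_power integrable_indicator_iff less_top[symmetric])
    also have "\<dots> = trunc_moment (u (Suc i) - u i)"
      using expectation_increment[of "u i" "u (Suc i)" "\<lambda>x. min 1 ((norm x)\<^sup>2)"] u(2)[OF i] u0[of i] i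
      by (simp add: X_def)
    finally show "prob {\<omega>\<in>space M. norm (X i \<omega>) > 1} \<le> trunc_moment (u (Suc i) - u i)" .
  qed
  also have "\<dots> \<le> 8 * \<eta>" by (rule sum_second_moments(1)[OF small \<eta> T u])
  finally show ?thesis by (simp add: X_def)
qed

section \<open>Operator sums over partitions\<close>

lemma levy_process_D:
  assumes "levy_process M Z"
  shows "prob_space M" "0 \<le> t \<Longrightarrow> Z t \<in> borel_measurable M" "\<omega> \<in> space M \<Longrightarrow> Z 0 \<omega> = 0"
    "0 \<le> u 0 \<Longrightarrow> (\<And>i. i < n \<Longrightarrow> u i \<le> u (Suc i)) \<Longrightarrow>
      prob_space.indep_vars M (\<lambda>_. borel) (\<lambda>i \<omega>. Z (u (Suc i)) \<omega> - Z (u i) \<omega>) {..<n::nat}"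
    "0 \<le> s \<Longrightarrow> s \<le> t \<Longrightarrow> distr M borel (\<lambda>\<omega>. Z t \<omega> - Z s \<omega>) = distr M borel (Z (t - s))"
    "0 \<le> t \<Longrightarrow> 0 < e \<Longrightarrow>
      ((\<lambda>s. measure M {\<omega>\<in>space M. dist (Z s \<omega>) (Z t \<omega>) > e}) \<longlongrightarrow> 0) (at t within {0..})"
    "\<omega> \<in> space M \<Longrightarrow> 0 \<le> t \<Longrightarrow> continuous (at_right t) (\<lambda>s. Z s \<omega>)"
    "\<omega> \<in> space M \<Longrightarrow> 0 < t \<Longrightarrow> \<exists>l. ((\<lambda>s. Z s \<omega>) \<longlongrightarrow> l) (at_left t)"
proof -
  note L = assms[unfolded levy_process_def]
  note L1 = L[THEN conjunct2] note L2 = L1[THEN conjunct2] note L3 = L2[THEN conjunct2]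
  note L4 = L3[THEN conjunct2] note L5 = L4[THEN conjunct2] note L6 = L5[THEN conjunct2]
  show "prob_space M" "0 \<le> t \<Longrightarrow> Z t \<in> borel_measurable M" "\<omega> \<in> space M \<Longrightarrow> Z 0 \<omega> = 0"
    using L[THEN conjunct1] L1[THEN conjunct1] L2[THEN conjunct1] by simp_all
  show "0 \<le> u 0 \<Longrightarrow> (\<And>i. i < n \<Longrightarrow> u i \<le> u (Suc i)) \<Longrightarrow>
      prob_space.indep_vars M (\<lambda>_. borel) (\<lambda>i \<omega>. Z (u (Suc i)) \<omega> - Z (u i) \<omega>) {..<n::nat}"
    using L3[THEN conjunct1] by simp
  show "0 \<le> s \<Longrightarrow> s \<le> t \<Longrightarrow> distr M borel (\<lambda>\<omega>. Z t \<omega> - Z s \<omega>) = distr M borel (Z (t - s))"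
    using L4[THEN conjunct1] by simp
  show "0 \<le> t \<Longrightarrow> 0 < e \<Longrightarrow>
      ((\<lambda>s. measure M {\<omega>\<in>space M. dist (Z s \<omega>) (Z t \<omega>) > e}) \<longlongrightarrow> 0) (at t within {0..})"
    using L5[THEN conjunct1] by simp
  show "\<omega> \<in> space M \<Longrightarrow> 0 \<le> t \<Longrightarrow> continuous (at_right t) (\<lambda>s. Z s \<omega>)"
    "\<omega> \<in> space M \<Longrightarrow> 0 < t \<Longrightarrow> \<exists>l. ((\<lambda>s. Z s \<omega>) \<longlongrightarrow> l) (at_left t)"
    using L6 by simp_all
qed

lemma stationary_increments_linear_image:
  fixes Z :: "real \<Rightarrow> 'w \<Rightarrow> 'h::{real_inner, banach, second_countable_topology}"
  assumes Z: "levy_process M Z" and L: "bounded_linear L"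
  shows "stationary_increments M (\<lambda>t \<omega>. L (Z t \<omega>) :: 'h)"
proof -
  interpret L: bounded_linear L by (rule L)
  interpret prob_space M by (rule levy_process_D[OF Z])
  have LM [measurable]: "L \<in> borel_measurable borel"
    using L by (intro borel_measurable_continuous_onI linear_continuous_on)
  have ZM: "Z t \<in> borel_measurable M" if "0 \<le> t" for t
    by (rule levy_process_D(2)[OF Z that])
  show ?thesis
  proof
    show "(\<lambda>\<omega>. L (Z t \<omega>)) \<in> borel_measurable M" if "0 \<le> t" for t
      using ZM[OF that] by measurable
    show "L (Z 0 \<omega>) = 0" if "\<omega> \<in> space M" for \<omega>
      using levy_process_D(3)[OF Z that] by (simp add: L.zero)
    show "indep_vars (\<lambda>_. borel) (\<lambda>i \<omega>. L (Z (u (Suc i)) \<omega>) - L (Z (u i) \<omega>)) {..<n}"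
      if "0 \<le> u 0" "\<And>i. i < n \<Longrightarrow> u i \<le> u (Suc i)" for u :: "nat \<Rightarrow> real" and n
    proof -
      have "indep_vars (\<lambda>_. borel) (\<lambda>i \<omega>. Z (u (Suc i)) \<omega> - Z (u i) \<omega>) {..<n}"
        using that by (rule levy_process_D(4)[OF Z])
      from indep_vars_compose2[OF this, of "\<lambda>_. L" "\<lambda>_. borel"] show ?thesis
        by (simp add: L.diff)
    qed
    show "distr M borel (\<lambda>\<omega>. L (Z t \<omega>) - L (Z s \<omega>)) = distr M borel (\<lambda>\<omega>. L (Z (t - s) \<omega>))"
      if "0 \<le> s" "s \<le> t" for s t
    proof -
      have [measurable]: "Z t \<in> borel_measurable M" "Z s \<in> borel_measurable M" "Z (t - s) \<in> borel_measurable M"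
        using ZM that by auto
      have "distr M borel (\<lambda>\<omega>. Z t \<omega> - Z s \<omega>) = distr M borel (Z (t - s))"
        using that by (rule levy_process_D(5)[OF Z])
      then have "distr (distr M borel (\<lambda>\<omega>. Z t \<omega> - Z s \<omega>)) borel L = distr (distr M borel (Z (t - s))) borel L"
        by simp
      then show ?thesis by (simp add: distr_distr comp_def L.diff)
    qed
  qed
qed

text \<open>This uses continuity in probability at time 0; stationarity later carries it to
  increments starting anywhere. The bounded function is split at the level \<eta>/2.\<close>

lemma levy_process_small_time:
  fixes Z :: "real \<Rightarrow> 'w \<Rightarrow> 'h::{real_inner, banach, second_countable_topology}"
  assumes Z: "levy_process M Z" and \<eta>: "0 < \<eta>"
  shows "\<exists>d>0. \<forall>h. 0 \<le> h \<longrightarrow> h < d \<longrightarrow> (\<integral>\<omega>. min 1 (norm (Z h \<omega>)) \<partial>M) \<le> \<eta>"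
proof -
  interpret prob_space M by (rule levy_process_D[OF Z])
  have Z0: "Z 0 \<omega> = 0" if "\<omega> \<in> space M" for \<omega> by (rule levy_process_D(3)[OF Z that])
  have "((\<lambda>s. prob {\<omega>\<in>space M. dist (Z s \<omega>) (Z 0 \<omega>) > \<eta>/2}) \<longlongrightarrow> 0) (at 0 within {0..})"
    using levy_process_D(6)[OF Z, of 0 "\<eta>/2"] \<eta> by simp
  then have "\<forall>\<^sub>F s in at 0 within {0..}. prob {\<omega>\<in>space M. dist (Z s \<omega>) (Z 0 \<omega>) > \<eta>/2} < \<eta>/2"
    using \<eta> by (intro order_tendstoD(2)) auto
  then obtain d where d: "d > 0" "\<And>h. h > 0 \<Longrightarrow> h < d \<Longrightarrow> prob {\<omega>\<in>space M. dist (Z h \<omega>) (Z 0 \<omega>) > \<eta>/2} < \<eta>/2"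
    by (auto simp: eventually_at)
  have "(\<integral>\<omega>. min 1 (norm (Z h \<omega>)) \<partial>M) \<le> \<eta>" if h: "0 \<le> h" "h < d" for h
  proof -
    have M: "Z h \<in> borel_measurable M" by (rule levy_process_D(2)[OF Z h(1)])
    define A where "A = {\<omega>\<in>space M. dist (Z h \<omega>) (Z 0 \<omega>) > \<eta>/2}"
    have A_eq: "A = {\<omega>\<in>space M. norm (Z h \<omega>) > \<eta>/2}" using Z0 by (auto simp: A_def)
    then have AM: "A \<in> sets M" using M by simp
    \<comment> \<open>The limit at 0 runs over the punctured filter and says nothing about h = 0,
      where the event is empty.\<close>
    have "prob A \<le> \<eta>/2"
    proof (cases "h = 0")
      case True
      then have "A = {}" using \<eta> by (auto simp: A_def)
      then show ?thesis using \<eta> by simp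
    next
      case False
      then show ?thesis using d(2)[of h] h by (simp add: A_def)
    qed
    have iM: "integrable M (\<lambda>\<omega>. min 1 (norm (Z h \<omega>)))"
      using M by (intro integrable_bounded[where c=1]) auto
    have iA: "integrable M (indicator A :: _ \<Rightarrow> real)" using AM by (simp add: less_top[symmetric])
    have "(\<integral>\<omega>. min 1 (norm (Z h \<omega>)) \<partial>M) \<le> (\<integral>\<omega>. \<eta>/2 + indicator A \<omega> \<partial>M)"
      using iM iA \<eta> by (intro integral_mono Bochner_Integration.integrable_add)
        (auto simp: A_eq split: split_indicator)
    also have "\<dots> = \<eta>/2 + prob A" using iA AM by (simp add: prob_space)
    finally show ?thesis using \<open>prob A \<le> \<eta>/2\<close> by simp
  qed
  with d(1) show ?thesis by blast
qed

text \<open>\<open>L n\<close> converges only pointwise, so uniformity in time needs a finite grid: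
  at the multiples of h dominated convergence applies, and between them contractivity bounds the
  change by an increment of \<open>Z\<close> over a time below d, small by stationarity.\<close>

lemma small_on_eventually:
  fixes Z :: "real \<Rightarrow> 'w \<Rightarrow> 'h::{real_inner, banach, second_countable_topology}" and L :: "nat \<Rightarrow> 'h \<Rightarrow> 'h"
  assumes Z: "levy_process M Z" and L: "\<And>n. bounded_linear (L n)"
    and contr: "\<And>n x. norm (L n x) \<le> norm x" and lim: "\<And>x. (\<lambda>n. L n x) \<longlonglongrightarrow> 0" and \<eta>: "0 < \<eta>"
  shows "\<forall>\<^sub>F n in sequentially. small_on M (\<lambda>t \<omega>. L n (Z t \<omega>)) T \<eta>"
proof -
  interpret stationary_increments M Z
    using stationary_increments_linear_image[OF Z bounded_linear_ident] .
  have LM [measurable]: "L n \<in> borel_measurable borel" for n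
    using L by (intro borel_measurable_continuous_onI linear_continuous_on)
  have int: "integrable M (\<lambda>\<omega>. min 1 (norm (f \<omega>)))" if "f \<in> borel_measurable M" for f :: "'w \<Rightarrow> 'h"
    using that by (intro integrable_bounded[where c=1]) auto
  obtain d where d: "d > 0" "\<And>h. 0 \<le> h \<Longrightarrow> h < d \<Longrightarrow> expectation (\<lambda>\<omega>. min 1 (norm (Z h \<omega>))) \<le> \<eta>/2"
    using levy_process_small_time[OF Z, of "\<eta>/2"] \<eta> by auto
  define h where "h = d / 2"
  have h: "0 < h" "h < d" using d by (auto simp: h_def)
  define k where "k = nat \<lfloor>T / h\<rfloor>"
  have "(\<lambda>n. expectation (\<lambda>\<omega>. min 1 (norm (L n (Z (real j * h) \<omega>))))) \<longlonglongrightarrow> 0" for j :: nat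
  proof -
    have [measurable]: "Z (real j * h) \<in> borel_measurable M" using h by (intro measurable_W) simp
    have "(\<lambda>n. expectation (\<lambda>\<omega>. min 1 (norm (L n (Z (real j * h) \<omega>))))) \<longlonglongrightarrow> expectation (\<lambda>\<omega>. 0)"
    proof (rule integral_dominated_convergence[where w="\<lambda>_. 1"])
      show "AE \<omega> in M. (\<lambda>n. min 1 (norm (L n (Z (real j * h) \<omega>)))) \<longlonglongrightarrow> 0"
      proof (intro AE_I2)
        fix \<omega>
        show "(\<lambda>n. min 1 (norm (L n (Z (real j * h) \<omega>)))) \<longlonglongrightarrow> 0"
          using tendsto_min[OF tendsto_const[of 1] tendsto_norm_zero[OF lim[of "Z (real j * h) \<omega>"]]] by simp
      qed
    qed auto
    then show ?thesis by simp
  qed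
  then have "\<forall>\<^sub>F n in sequentially. expectation (\<lambda>\<omega>. min 1 (norm (L n (Z (real j * h) \<omega>)))) < \<eta>/2" for j :: nat
    using \<eta> by (intro order_tendstoD(2)) auto
  then have "\<forall>\<^sub>F n in sequentially. \<forall>j\<in>{..k}. expectation (\<lambda>\<omega>. min 1 (norm (L n (Z (real j * h) \<omega>)))) < \<eta>/2"
    by (intro eventually_ball_finite) auto
  then show ?thesis
  proof eventually_elim
    case (elim n)
    interpret L: bounded_linear "L n" by (rule L)
    show ?case
      unfolding small_on_def
    proof
      fix t assume t: "t \<in> {0..T}"
      define j where "j = nat \<lfloor>t / h\<rfloor>"
      define s where "s = real j * h"
      have jk: "j \<le> k" unfolding j_def k_def using t h by (intro nat_mono floor_mono divide_right_mono) auto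
      have "real j = of_int \<lfloor>t / h\<rfloor>" using t h by (simp add: j_def)
      then have "real j \<le> t / h" "t / h < real j + 1" using floor_correct[of "t / h"] by linarith+
      then have s: "0 \<le> s" "s \<le> t" "t - s < d" using h by (auto simp: s_def field_simps)
      have [measurable]: "Z t \<in> borel_measurable M" "Z s \<in> borel_measurable M" using measurable_W s t by auto
      have "expectation (\<lambda>\<omega>. min 1 (norm (L n (Z t \<omega>))))
        \<le> expectation (\<lambda>\<omega>. min 1 (norm (L n (Z s \<omega>))) + min 1 (norm (Z t \<omega> - Z s \<omega>)))"
      proof (rule integral_mono)
        fix \<omega>
        have "norm (L n (Z t \<omega>)) \<le> norm (L n (Z s \<omega>)) + norm (L n (Z t \<omega> - Z s \<omega>))"
          using norm_triangle_ineq[of "L n (Z s \<omega>)" "L n (Z t \<omega>) - L n (Z s \<omega>)"] by (simp add: L.diff)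
        then show "min 1 (norm (L n (Z t \<omega>))) \<le> min 1 (norm (L n (Z s \<omega>))) + min 1 (norm (Z t \<omega> - Z s \<omega>))"
          using contr[of n "Z t \<omega> - Z s \<omega>"] by (smt (verit) norm_ge_zero)
      qed (auto intro!: int Bochner_Integration.integrable_add)
      also have "\<dots> = expectation (\<lambda>\<omega>. min 1 (norm (L n (Z s \<omega>)))) + expectation (\<lambda>\<omega>. min 1 (norm (Z t \<omega> - Z s \<omega>)))"
        by (intro Bochner_Integration.integral_add int) auto
      also have "expectation (\<lambda>\<omega>. min 1 (norm (Z t \<omega> - Z s \<omega>))) = expectation (\<lambda>\<omega>. min 1 (norm (Z (t - s) \<omega>)))"
        using expectation_increment[OF s(1,2), of "\<lambda>x. min 1 (norm x)"] by simp
      also have "\<dots> \<le> \<eta>/2" using d(2)[of "t - s"] s by simp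
      also have "expectation (\<lambda>\<omega>. min 1 (norm (L n (Z s \<omega>)))) \<le> \<eta>/2" using elim jk by (force simp: s_def)
      finally show "expectation (\<lambda>\<omega>. min 1 (norm (L n (Z t \<omega>)))) \<le> \<eta>" by simp
    qed
  qed
qed

section \<open>Finite-dimensional approximation by orthogonal projections\<close>

definition span_proj :: "'a::real_inner set \<Rightarrow> 'a \<Rightarrow> 'a" where
  "span_proj C x = (\<Sum>c\<in>C. (x \<bullet> c / (c \<bullet> c)) *\<^sub>R c)"

lemma bounded_linear_span_proj: "bounded_linear (span_proj C)"
  unfolding span_proj_def [abs_def]
  by (intro bounded_linear_sum bounded_linear_compose[OF bounded_linear_scaleR_left]
      bounded_linear_compose[OF bounded_linear_divide] bounded_linear_inner_left)

text \<open>Best approximation, by Pythagoras. It is used twice: v = 0 makes the remainder a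
  contraction, and v from a dense set makes it tend to zero.\<close>

lemma norm_minus_span_proj_le:
  assumes C: "finite C" "pairwise orthogonal C" and v: "v \<in> span C"
  shows "norm (x - span_proj C x) \<le> norm (x - v)"
proof -
  have orth: "(x - span_proj C x) \<bullet> c = 0" if c: "c \<in> C" for c
  proof -
    have "span_proj C x \<bullet> c = (\<Sum>b\<in>C. (x \<bullet> b / (b \<bullet> b)) * (b \<bullet> c))"
      by (simp add: span_proj_def inner_sum_left)
    also have "\<dots> = (\<Sum>b\<in>{c}. (x \<bullet> b / (b \<bullet> b)) * (b \<bullet> c))"
      using C c by (intro sum.mono_neutral_right) (auto simp: pairwise_def orthogonal_def)
    \<comment> \<open>For c = 0 both sides vanish, division by zero being zero, so a zero vector in
      \<open>C\<close> does no harm.\<close>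
    also have "\<dots> = x \<bullet> c" by simp
    finally show ?thesis by (simp add: inner_diff_left)
  qed
  have "span_proj C x \<in> span C"
    unfolding span_proj_def by (intro span_sum span_scale span_base)
  then have "span_proj C x - v \<in> span C" using v by (rule span_diff)
  then have "orthogonal (x - span_proj C x) (span_proj C x - v)"
    by (rule orthogonal_to_span) (simp add: orthogonal_def orth)
  then have "(norm (x - v))\<^sup>2 = (norm (x - span_proj C x))\<^sup>2 + (norm (span_proj C x - v))\<^sup>2"
    using norm_add_Pythagorean[of "x - span_proj C x" "span_proj C x - v"] by simp
  then have "(norm (x - span_proj C x))\<^sup>2 \<le> (norm (x - v))\<^sup>2" by simp
  then show ?thesis by (rule power2_le_imp_le) simp
qed

text \<open>Orthogonalizing the first n points of a countable dense set gives spans that eventually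
  contain a point within r of any given x; best approximation does the rest.\<close>

lemma span_proj_approximation:
  "\<exists>C :: nat \<Rightarrow> 'a::{real_inner, second_countable_topology} set.
     \<forall>n. finite (C n) \<and> pairwise orthogonal (C n) \<and> (\<forall>x. (\<lambda>n. x - span_proj (C n) x) \<longlonglongrightarrow> 0)"
proof -
  obtain D :: "'a set" where D: "countable D" "\<And>X. open X \<Longrightarrow> X \<noteq> {} \<Longrightarrow> \<exists>d\<in>D. d \<in> X"
    by (rule countable_dense_setE) blast
  have "D \<noteq> {}" using D(2)[of UNIV] by auto
  then have range: "range (from_nat_into D) = D" using D(1) by (rule range_from_nat_into)
  have "\<exists>C. finite C \<and> pairwise orthogonal C \<and> span C = span (from_nat_into D ` {..<n})" for n
    using basis_orthogonal[of "from_nat_into D ` {..<n}"] by auto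
  then obtain C where C: "\<And>n. finite (C n)" "\<And>n. pairwise orthogonal (C n)"
    "\<And>n. span (C n) = span (from_nat_into D ` {..<n})"
    by metis
  have "(\<lambda>n. x - span_proj (C n) x) \<longlonglongrightarrow> 0" for x
  proof (rule LIMSEQ_I)
    fix r :: real assume "0 < r"
    then obtain d where "d \<in> D" "d \<in> ball x r" using D(2)[of "ball x r"] by auto
    then obtain k where k: "from_nat_into D k \<in> ball x r" using range by (metis rangeE)
    have "norm (x - span_proj (C n) x - 0) < r" if "n \<ge> Suc k" for n
    proof -
      have "from_nat_into D k \<in> span (C n)" unfolding C using that by (intro span_base) auto
      from norm_minus_span_proj_le[OF C(1,2) this, of x] k show ?thesis by (simp add: dist_norm)
    qed
    then show "\<exists>no. \<forall>n\<ge>no. norm (x - span_proj (C n) x - 0) < r" by blast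
  qed
  with C show ?thesis by blast
qed

lemma tail_constant_exists:
  fixes C \<epsilon> :: real
  assumes "0 < \<epsilon>"
  shows "\<exists>\<eta>. 0 < \<eta> \<and> \<eta> \<le> 1/48 \<and> 8 * \<eta> + C\<^sup>2 * (16 * \<eta> + 1152 * \<eta>\<^sup>2) / \<epsilon>\<^sup>2 < \<epsilon>"
proof -
  have "((\<lambda>\<eta>. 8 * \<eta> + C\<^sup>2 * (16 * \<eta> + 1152 * \<eta>\<^sup>2) / \<epsilon>\<^sup>2) \<longlongrightarrow> 8 * 0 + C\<^sup>2 * (16 * 0 + 1152 * 0\<^sup>2) / \<epsilon>\<^sup>2) (at_right 0)"
    using assms by (intro tendsto_intros) auto
  then have "\<forall>\<^sub>F \<eta> in at_right 0. 8 * \<eta> + C\<^sup>2 * (16 * \<eta> + 1152 * \<eta>\<^sup>2) / \<epsilon>\<^sup>2 < \<epsilon>"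
    using assms by (intro order_tendstoD(2)) auto
  moreover have "\<forall>\<^sub>F \<eta> in at_right (0::real). 0 < \<eta>" by (rule eventually_at_right_less)
  moreover have "\<forall>\<^sub>F \<eta> in at_right (0::real). \<eta> < 1/48"
    using eventually_at_right by (intro order_tendstoD(2)[OF tendsto_ident_at]) auto
  ultimately have "\<forall>\<^sub>F \<eta> in at_right 0. 0 < \<eta> \<and> \<eta> \<le> 1/48 \<and> 8 * \<eta> + C\<^sup>2 * (16 * \<eta> + 1152 * \<eta>\<^sup>2) / \<epsilon>\<^sup>2 < \<epsilon>"
    by eventually_elim auto
  then show ?thesis by (rule eventually_happens'[OF trivial_limit_at_right_real])
qed

text \<open>The process is split into its projection to a finite-dimensional subspace, on which the
  operators are small in norm, and the remainder, which is small as a process.\<close>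
lemma operator_sums_small:
  fixes Z :: "real \<Rightarrow> 'w \<Rightarrow> 'h::{real_inner, banach, second_countable_topology}"
  assumes Z: "levy_process M Z" and \<epsilon>: "0 < \<epsilon>" and C: "0 < C" and T: "0 < T"
  shows "\<exists>F \<delta>. finite F \<and> 0 < \<delta> \<and> (\<forall>n u B. u 0 = 0 \<longrightarrow> (\<forall>i<n. u i \<le> u (Suc i)) \<longrightarrow> u n \<le> T \<longrightarrow>
    (\<forall>i<n. bounded_linear (B i) \<and> (\<forall>x. norm (B i x) \<le> C * norm x) \<and> (\<forall>f\<in>F. norm (B i f) \<le> \<delta>)) \<longrightarrow>
    measure M {\<omega>\<in>space M. norm (\<Sum>i<n. B i (Z (u (Suc i)) \<omega> - Z (u i) \<omega>) :: 'h) > \<epsilon>} < \<epsilon>)"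
proof -
  interpret prob_space M by (rule levy_process_D[OF Z])
  obtain \<eta> where \<eta>: "0 < \<eta>" "\<eta> \<le> 1/48" "8 * \<eta> + C\<^sup>2 * (16 * \<eta> + 1152 * \<eta>\<^sup>2) / (\<epsilon>/2)\<^sup>2 < \<epsilon>/2"
    using tail_constant_exists[of "\<epsilon>/2" C] \<epsilon> by auto
  obtain CC :: "nat \<Rightarrow> 'h set" where CC: "\<And>n. finite (CC n)" "\<And>n. pairwise orthogonal (CC n)"
    "\<And>x. (\<lambda>n. x - span_proj (CC n) x) \<longlonglongrightarrow> 0"
    using span_proj_approximation by metis
  have Lbl: "bounded_linear (\<lambda>x. x - span_proj (CC n) x)" for n
    by (intro bounded_linear_sub bounded_linear_ident bounded_linear_span_proj)
  have "norm (x - span_proj (CC n) x) \<le> norm x" for n x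
    using norm_minus_span_proj_le[OF CC(1,2) span_zero, of x] by simp
  then have "\<forall>\<^sub>F n in sequentially. small_on M (\<lambda>t \<omega>. Z t \<omega> - span_proj (CC n) (Z t \<omega>)) T \<eta>"
    using small_on_eventually[OF Z Lbl _ CC(3) \<eta>(1)] by blast
  then obtain N where N: "small_on M (\<lambda>t \<omega>. Z t \<omega> - span_proj (CC N) (Z t \<omega>)) T \<eta>"
    by (meson eventually_happens sequentially_bot)
  define F where "F = CC N"
  have F: "finite F" by (simp add: F_def CC)
  have "\<forall>\<^sub>F n in sequentially. small_on M (\<lambda>t \<omega>. (1 / real (Suc n)) *\<^sub>R Z t \<omega>) T \<eta>"
  proof (rule small_on_eventually[OF Z _ _ _ \<eta>(1)])
    show "(\<lambda>n. (1 / real (Suc n)) *\<^sub>R x) \<longlonglongrightarrow> 0" for x :: 'h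
      using tendsto_scaleR[OF LIMSEQ_inverse_real_of_nat tendsto_const[of x]] by (simp add: inverse_eq_divide)
    show "norm ((1 / real (Suc n)) *\<^sub>R x) \<le> norm x" for n and x :: 'h
      by (simp add: divide_le_eq mult_le_cancel_left1 mult_left_le)
  qed (rule bounded_linear_scaleR_right)
  then obtain k where k: "small_on M (\<lambda>t \<omega>. (1 / real (Suc k)) *\<^sub>R Z t \<omega>) T \<eta>"
    by (meson eventually_happens sequentially_bot)
  \<comment> \<open>Rescaling by \<beta> makes the whole process small. The operators
    \<open>B2\<close> compensate by 1/\<beta>, which is affordable because the \<open>B i\<close>
    are small on \<open>F\<close>.\<close>
  define \<beta> where "\<beta> = 1 / real (Suc k)"
  have \<beta>: "0 < \<beta>" by (simp add: \<beta>_def)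
  define K where "K = (\<Sum>c\<in>F. 1 / norm c)"
  have K: "0 \<le> K" by (simp add: K_def sum_nonneg)
  \<comment> \<open>\<open>K * \<delta>\<close> bounds the norm of \<open>B i\<close> composed with
    the projection. The choice makes it at most \<beta> C, so division by \<beta> restores the bound
    C; the order matters, \<open>F\<close> and \<beta> being fixed before \<delta>. The summand 1
    covers K = 0.\<close>
  define \<delta> where "\<delta> = \<beta> * C / (K + 1)"
  have \<delta>: "0 < \<delta>" "K * \<delta> \<le> \<beta> * C" using \<beta> C K by (auto simp: \<delta>_def field_simps)
  define P where "P = span_proj F"
  interpret P: bounded_linear P unfolding P_def by (rule bounded_linear_span_proj)
  interpret W1: stationary_increments M "\<lambda>t \<omega>. Z t \<omega> - P (Z t \<omega>)"
    unfolding P_def F_def by (rule stationary_increments_linear_image[OF Z Lbl])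
  interpret W2: stationary_increments M "\<lambda>t \<omega>. \<beta> *\<^sub>R Z t \<omega>"
    by (rule stationary_increments_linear_image[OF Z bounded_linear_scaleR_right])
  have "prob {\<omega>\<in>space M. norm (\<Sum>i<n. B i (Z (u (Suc i)) \<omega> - Z (u i) \<omega>)) > \<epsilon>} < \<epsilon>"
    if u: "u 0 = 0" "\<forall>i<n. u i \<le> u (Suc i)" "u n \<le> T"
      and B: "\<forall>i<n. bounded_linear (B i) \<and> (\<forall>x. norm (B i x) \<le> C * norm x) \<and> (\<forall>f\<in>F. norm (B i f) \<le> \<delta>)"
    for n u and B :: "nat \<Rightarrow> 'h \<Rightarrow> 'h"
  proof -
    have Bl: "bounded_linear (B i)" if "i < n" for i using B that by blast
    define B2 where "B2 = (\<lambda>i x. B i (P ((1/\<beta>) *\<^sub>R x)))"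
    have B2l: "bounded_linear (B2 i)" if "i < n" for i
      unfolding B2_def
      by (intro bounded_linear_compose[OF Bl[OF that]] bounded_linear_compose[OF P.bounded_linear_axioms] bounded_linear_scaleR_right)
    have BP: "norm (B i (P x)) \<le> K * \<delta> * norm x" if i: "i < n" for i x
    proof -
      interpret Bi: bounded_linear "B i" by (rule Bl[OF i])
      have "norm (B i (P x)) = norm (\<Sum>c\<in>F. (x \<bullet> c / (c \<bullet> c)) *\<^sub>R B i c)"
        by (simp add: P_def span_proj_def Bi.sum Bi.scaleR)
      also have "\<dots> \<le> (\<Sum>c\<in>F. norm ((x \<bullet> c / (c \<bullet> c)) *\<^sub>R B i c))" by (rule norm_sum)
      also have "\<dots> \<le> (\<Sum>c\<in>F. 1 / norm c * (norm x * \<delta>))"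
      proof (rule sum_mono)
        fix c assume c: "c \<in> F"
        have "\<bar>x \<bullet> c\<bar> / (c \<bullet> c) \<le> (norm x * norm c) / (c \<bullet> c)"
          by (intro divide_right_mono Cauchy_Schwarz_ineq2) simp
        also have "\<dots> = 1 / norm c * norm x"
          by (cases "c = 0") (simp_all add: power2_norm_eq_inner[symmetric] power2_eq_square)
        finally have "\<bar>x \<bullet> c\<bar> / (c \<bullet> c) * norm (B i c) \<le> (1 / norm c * norm x) * \<delta>"
          using B i c by (intro mult_mono) auto
        then show "norm ((x \<bullet> c / (c \<bullet> c)) *\<^sub>R B i c) \<le> 1 / norm c * (norm x * \<delta>)"
          by (simp add: abs_divide)
      qed
      also have "\<dots> = K * \<delta> * norm x" unfolding K_def sum_distrib_right[symmetric] by simp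
      finally show ?thesis .
    qed
    have B2n: "norm (B2 i x) \<le> C * norm x" if "i < n" for i x
    proof -
      have "norm (B2 i x) \<le> K * \<delta> * norm ((1/\<beta>) *\<^sub>R x)" unfolding B2_def by (rule BP[OF that])
      also have "\<dots> \<le> \<beta> * C * norm ((1/\<beta>) *\<^sub>R x)" using \<delta> by (intro mult_right_mono) auto
      also have "\<dots> = C * norm x" using \<beta> by simp
      finally show ?thesis .
    qed
    let ?S1 = "\<lambda>\<omega>. \<Sum>i<n. B i ((Z (u (Suc i)) \<omega> - P (Z (u (Suc i)) \<omega>)) - (Z (u i) \<omega> - P (Z (u i) \<omega>)))"
    let ?S2 = "\<lambda>\<omega>. \<Sum>i<n. B2 i (\<beta> *\<^sub>R Z (u (Suc i)) \<omega> - \<beta> *\<^sub>R Z (u i) \<omega>)"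
    have u': "\<And>i. i < n \<Longrightarrow> u i \<le> u (Suc i)" and u0: "\<And>i. i \<le> n \<Longrightarrow> 0 \<le> u i"
    proof -
      show *: "\<And>i. i < n \<Longrightarrow> u i \<le> u (Suc i)" using u by blast
      show "0 \<le> u i" if "i \<le> n" for i
        using that by (induction i) (use u * in \<open>auto intro: order_trans[of 0 "u _" "u (Suc _)"]\<close>)
    qed
    have p1: "prob {\<omega>\<in>space M. norm (?S1 \<omega>) > \<epsilon>/2} < \<epsilon>/2"
    proof -
      have "prob {\<omega>\<in>space M. norm (?S1 \<omega>) > \<epsilon>/2} \<le> 8 * \<eta> + C\<^sup>2 * (16 * \<eta> + 1152 * \<eta>\<^sup>2) / (\<epsilon>/2)\<^sup>2"
        using N B C \<epsilon> by (intro W1.operator_sum_tail[OF _ \<eta>(2) T u(1) u' u(3) Bl]) (auto simp: P_def F_def)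
      then show ?thesis using \<eta>(3) by (rule le_less_trans)
    qed
    have p2: "prob {\<omega>\<in>space M. norm (?S2 \<omega>) > \<epsilon>/2} < \<epsilon>/2"
    proof -
      have "prob {\<omega>\<in>space M. norm (?S2 \<omega>) > \<epsilon>/2} \<le> 8 * \<eta> + C\<^sup>2 * (16 * \<eta> + 1152 * \<eta>\<^sup>2) / (\<epsilon>/2)\<^sup>2"
        using k C \<epsilon> by (intro W2.operator_sum_tail[OF _ \<eta>(2) T u(1) u' u(3) B2l B2n]) (auto simp: \<beta>_def)
      then show ?thesis using \<eta>(3) by (rule le_less_trans)
    qed
    have ZM: "Z (u i) \<in> borel_measurable M" if "i \<le> n" for i
      using u0[OF that] by (rule levy_process_D(2)[OF Z])
    have [measurable]: "P \<in> borel_measurable borel"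
      by (intro borel_measurable_continuous_onI linear_continuous_on P.bounded_linear_axioms)
    have BM [measurable]: "B i \<in> borel_measurable borel" "B2 i \<in> borel_measurable borel" if "i < n" for i
      using Bl[OF that] B2l[OF that] by (auto intro!: borel_measurable_continuous_onI linear_continuous_on)
    have M1: "?S1 \<in> borel_measurable M"
    proof (rule borel_measurable_sum)
      fix i assume "i \<in> {..<n}"
      then have [measurable]: "B i \<in> borel_measurable borel" "Z (u (Suc i)) \<in> borel_measurable M" "Z (u i) \<in> borel_measurable M"
        using BM ZM[of i] ZM[of "Suc i"] by auto
      show "(\<lambda>\<omega>. B i ((Z (u (Suc i)) \<omega> - P (Z (u (Suc i)) \<omega>)) - (Z (u i) \<omega> - P (Z (u i) \<omega>)))) \<in> borel_measurable M"
        by measurable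
    qed
    have M2: "?S2 \<in> borel_measurable M"
    proof (rule borel_measurable_sum)
      fix i assume "i \<in> {..<n}"
      then have [measurable]: "B2 i \<in> borel_measurable borel" "Z (u (Suc i)) \<in> borel_measurable M" "Z (u i) \<in> borel_measurable M"
        using BM ZM[of i] ZM[of "Suc i"] by auto
      show "(\<lambda>\<omega>. B2 i (\<beta> *\<^sub>R Z (u (Suc i)) \<omega> - \<beta> *\<^sub>R Z (u i) \<omega>)) \<in> borel_measurable M"
        by measurable
    qed
    have split: "(\<Sum>i<n. B i (Z (u (Suc i)) \<omega> - Z (u i) \<omega>)) = ?S1 \<omega> + ?S2 \<omega>" for \<omega>
      unfolding sum.distrib[symmetric]
    proof (rule sum.cong[OF refl])
      fix i assume "i \<in> {..<n}"
      then interpret Bi: bounded_linear "B i" using Bl by auto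
      have "(1/\<beta>) *\<^sub>R (\<beta> *\<^sub>R Z (u (Suc i)) \<omega> - \<beta> *\<^sub>R Z (u i) \<omega>) = Z (u (Suc i)) \<omega> - Z (u i) \<omega>"
        using \<beta> by (simp add: scaleR_diff_right)
      then show "B i (Z (u (Suc i)) \<omega> - Z (u i) \<omega>) = B i ((Z (u (Suc i)) \<omega> - P (Z (u (Suc i)) \<omega>)) - (Z (u i) \<omega> - P (Z (u i) \<omega>)))
          + B2 i (\<beta> *\<^sub>R Z (u (Suc i)) \<omega> - \<beta> *\<^sub>R Z (u i) \<omega>)"
        by (simp add: B2_def Bi.diff P.diff)
    qed
    show ?thesis unfolding split by (rule prob_norm_add_less[OF M1 M2 p1 p2])
  qed
  note main = this
  show ?thesis
    by (intro exI[of _ F] exI[of _ \<delta>] conjI F \<delta>(1) allI impI) (rule main; assumption)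
qed

section \<open>Comparison of Riemann sums\<close>

text \<open>Increments telescope over a refinement and each operator is additive, so a coarse sum
  equals a fine one whose operator is constant on every coarse cell. Here \<kappa> locates the
  coarse points in the refinement. Two sums over different grids can thus be subtracted term by
  term; the new tags depend on the grids, not on the path f.\<close>

lemma refined_sum:
  fixes R :: "real \<Rightarrow> 'h \<Rightarrow> 'h::real_normed_vector" and \<kappa> :: "nat \<Rightarrow> nat"
  assumes "\<kappa> 0 = 0" "\<And>i. i < n \<Longrightarrow> \<kappa> i \<le> \<kappa> (Suc i)" "\<And>i. i \<le> n \<Longrightarrow> u (\<kappa> i) = \<sigma> i"
    "\<And>i. i < n \<Longrightarrow> bounded_linear (R (\<rho> i))"
  shows "\<exists>r. (\<forall>j<\<kappa> n. \<exists>i<n. \<kappa> i \<le> j \<and> j < \<kappa> (Suc i) \<and> r j = \<rho> i) \<and>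
    (\<forall>f. (\<Sum>i<n. R (\<rho> i) (f (\<sigma> (Suc i)) - f (\<sigma> i))) = (\<Sum>j<\<kappa> n. R (r j) (f (u (Suc j)) - f (u j :: real))))"
  using assms
proof (induction n)
  case 0
  then show ?case by simp
next
  case (Suc n)
  have "\<exists>r. (\<forall>j<\<kappa> n. \<exists>i<n. \<kappa> i \<le> j \<and> j < \<kappa> (Suc i) \<and> r j = \<rho> i) \<and>
    (\<forall>f. (\<Sum>i<n. R (\<rho> i) (f (\<sigma> (Suc i)) - f (\<sigma> i))) = (\<Sum>j<\<kappa> n. R (r j) (f (u (Suc j)) - f (u j))))"
    using Suc.prems by (intro Suc.IH) auto
  then obtain r where r: "\<forall>j<\<kappa> n. \<exists>i<n. \<kappa> i \<le> j \<and> j < \<kappa> (Suc i) \<and> r j = \<rho> i"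
    "\<And>f. (\<Sum>i<n. R (\<rho> i) (f (\<sigma> (Suc i)) - f (\<sigma> i))) = (\<Sum>j<\<kappa> n. R (r j) (f (u (Suc j)) - f (u j)))"
    by blast
  interpret Rn: bounded_linear "R (\<rho> n)" using Suc.prems by simp
  define r' where "r' = (\<lambda>j. if j < \<kappa> n then r j else \<rho> n)"
  have le: "\<kappa> n \<le> \<kappa> (Suc n)" using Suc.prems by simp
  show ?case
  proof (intro exI[of _ r'] conjI allI impI)
    fix j assume j: "j < \<kappa> (Suc n)"
    show "\<exists>i<Suc n. \<kappa> i \<le> j \<and> j < \<kappa> (Suc i) \<and> r' j = \<rho> i"
    proof (cases "j < \<kappa> n")
      case True
      then show ?thesis using r(1) by (auto simp: r'_def intro: less_SucI)
    next
      case False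
      then show ?thesis using j by (auto simp: r'_def)
    qed
  next
    fix f :: "real \<Rightarrow> 'h"
    have "R (\<rho> n) (f (\<sigma> (Suc n)) - f (\<sigma> n)) = R (\<rho> n) (\<Sum>j\<in>{\<kappa> n..<\<kappa> (Suc n)}. f (u (Suc j)) - f (u j))"
      using Suc.prems(3)[of n] Suc.prems(3)[of "Suc n"] sum_Suc_diff'[OF le, of "\<lambda>j. f (u j)"] by simp
    also have "\<dots> = (\<Sum>j\<in>{\<kappa> n..<\<kappa> (Suc n)}. R (r' j) (f (u (Suc j)) - f (u j)))"
      by (simp add: Rn.sum r'_def)
    finally have last: "R (\<rho> n) (f (\<sigma> (Suc n)) - f (\<sigma> n)) = (\<Sum>j\<in>{\<kappa> n..<\<kappa> (Suc n)}. R (r' j) (f (u (Suc j)) - f (u j)))" .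
    have "(\<Sum>i<n. R (\<rho> i) (f (\<sigma> (Suc i)) - f (\<sigma> i))) = (\<Sum>j\<in>{0..<\<kappa> n}. R (r' j) (f (u (Suc j)) - f (u j)))"
      unfolding r(2) by (simp add: r'_def lessThan_atLeast0)
    then have "(\<Sum>i<Suc n. R (\<rho> i) (f (\<sigma> (Suc i)) - f (\<sigma> i)))
        = (\<Sum>j\<in>{0..<\<kappa> n}. R (r' j) (f (u (Suc j)) - f (u j))) + (\<Sum>j\<in>{\<kappa> n..<\<kappa> (Suc n)}. R (r' j) (f (u (Suc j)) - f (u j)))"
      using last by simp
    also have "\<dots> = (\<Sum>j\<in>{0..<\<kappa> (Suc n)}. R (r' j) (f (u (Suc j)) - f (u j)))"
      using le by (intro sum.atLeastLessThan_concat) auto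
    finally show "(\<Sum>i<Suc n. R (\<rho> i) (f (\<sigma> (Suc i)) - f (\<sigma> i))) = (\<Sum>j<\<kappa> (Suc n). R (r' j) (f (u (Suc j)) - f (u j)))"
      by (simp add: lessThan_atLeast0)
  qed
qed

text \<open>Listing a finite refinement in increasing order supplies the index map for
  \<open>refined_sum\<close>. Monotonicity and both end values follow from strictness of the list;
  equal grid points share an index.\<close>

lemma sorted_index_map:
  fixes \<sigma> :: "nat \<Rightarrow> real"
  assumes G: "finite G" "\<sigma> ` {..n} \<subseteq> G" "\<And>x. x \<in> G \<Longrightarrow> \<sigma> 0 \<le> x \<and> x \<le> \<sigma> n"
    and \<sigma>: "\<And>i. i < n \<Longrightarrow> \<sigma> i \<le> \<sigma> (Suc i)"
  shows "\<exists>\<kappa>. \<kappa> 0 = 0 \<and> \<kappa> n = card G - 1 \<and> (\<forall>i<n. \<kappa> i \<le> \<kappa> (Suc i)) \<and>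
    (\<forall>i\<le>n. sorted_list_of_set G ! (\<kappa> i) = \<sigma> i)"
proof -
  let ?xs = "sorted_list_of_set G"
  have len: "length ?xs = card G" and set: "set ?xs = G" using G by auto
  have strict: "?xs ! i < ?xs ! j" if "i < j" "j < card G" for i j
    using that strict_sorted_list_of_set[of G] len by (simp add: sorted_wrt_nth_less)
  have "\<exists>k<card G. ?xs ! k = \<sigma> i" if "i \<le> n" for i
    using that G(2) set len by (metis atMost_iff image_subset_iff in_set_conv_nth)
  then obtain \<kappa> where \<kappa>: "\<And>i. i \<le> n \<Longrightarrow> \<kappa> i < card G \<and> ?xs ! \<kappa> i = \<sigma> i" by metis
  have c: "0 < card G" using \<kappa>[of 0] by auto
  have nth: "?xs ! k \<in> G" if "k < card G" for k using that set len by (metis nth_mem)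
  have "\<kappa> 0 = 0"
  proof (rule ccontr)
    assume "\<kappa> 0 \<noteq> 0"
    then have "?xs ! 0 < \<sigma> 0" using strict[of 0 "\<kappa> 0"] \<kappa>[of 0] by simp
    then show False using G(3)[OF nth[OF c]] by simp
  qed
  moreover have "\<kappa> n = card G - 1"
  proof (rule ccontr)
    assume "\<kappa> n \<noteq> card G - 1"
    then have "\<sigma> n < ?xs ! (card G - 1)" using strict[of "\<kappa> n" "card G - 1"] \<kappa>[of n] c by fastforce
    then show False using G(3)[OF nth[of "card G - 1"]] c by simp
  qed
  moreover have "\<kappa> i \<le> \<kappa> (Suc i)" if "i < n" for i
  proof (rule ccontr)
    assume "\<not> \<kappa> i \<le> \<kappa> (Suc i)"
    then have "\<sigma> (Suc i) < \<sigma> i" using strict[of "\<kappa> (Suc i)" "\<kappa> i"] \<kappa>[of i] \<kappa>[of "Suc i"] that by simp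
    then show False using \<sigma>[OF that] by simp
  qed
  ultimately show ?thesis using \<kappa> by blast
qed

text \<open>Riemann sums read forward in the time of \<open>Z\<close>: the tag
  \<open>\<rho> i\<close> is the argument of \<open>R\<close>, the time elapsed from some moment of
  the i-th cell until t. This covers both reflected tagged partitions and uniform grids stopped at
  t.\<close>

definition forward_grid :: "real \<Rightarrow> real \<Rightarrow> nat \<Rightarrow> (nat \<Rightarrow> real) \<Rightarrow> (nat \<Rightarrow> real) \<Rightarrow> bool" where
  "forward_grid t d n \<sigma> \<rho> \<longleftrightarrow> \<sigma> 0 = 0 \<and> \<sigma> n = t \<and>
    (\<forall>i<n. \<sigma> i \<le> \<sigma> (Suc i) \<and> \<sigma> (Suc i) - \<sigma> i < d \<and> t - \<sigma> (Suc i) \<le> \<rho> i \<and> \<rho> i \<le> t - \<sigma> i)"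

lemma forward_grid_bounds:
  assumes "forward_grid t d n \<sigma> \<rho>" "i \<le> n"
  shows "0 \<le> \<sigma> i" "\<sigma> i \<le> t"
  using grid_mono[of n \<sigma> 0 i] grid_mono[of n \<sigma> i n] assms by (auto simp: forward_grid_def)

text \<open>The ceiling counts the grid points in [0, t), none if t \<le> 0. This strict inequality
  is the endpoint convention of all uniform sums below.\<close>

lemma less_nat_ceiling_divide_iff:
  assumes "0 < d"
  shows "j < nat \<lceil>t / d\<rceil> \<longleftrightarrow> real j * d < t"
  using assms by (simp add: zless_nat_eq_int_zless less_ceiling_iff pos_less_divide_eq)

lemma forward_grid_uniform:
  assumes "0 \<le> t" "0 < d" "d < d'"
  shows "forward_grid t d' (nat \<lceil>t / d\<rceil>) (\<lambda>j. min t (real j * d)) (\<lambda>j. t - real j * d)"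
  unfolding forward_grid_def
proof (intro conjI allI impI)
  note q_iff = less_nat_ceiling_divide_iff[OF assms(2), of _ t]
  show "min t (real 0 * d) = 0" using assms by simp
  show "min t (real (nat \<lceil>t / d\<rceil>) * d) = t" using q_iff[of "nat \<lceil>t / d\<rceil>"] by simp
  fix i assume "i < nat \<lceil>t / d\<rceil>"
  then have i: "real i * d < t" using q_iff by simp
  have "real (Suc i) * d = real i * d + d" by (simp add: algebra_simps)
  then show "min t (real i * d) \<le> min t (real (Suc i) * d)"
    "min t (real (Suc i) * d) - min t (real i * d) < d'"
    "t - min t (real (Suc i) * d) \<le> t - real i * d" "t - real i * d \<le> t - min t (real i * d)"
    using i assms by auto
qed

section \<open>Riemann sums of the convolution, compared uniformly in the endpoint t\<close>

locale levy_convolution =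
  fixes M :: "'w measure" and Z :: "real \<Rightarrow> 'w \<Rightarrow> 'h::{real_inner, banach, second_countable_topology}"
    and R :: "real \<Rightarrow> 'h \<Rightarrow> 'h" and T :: real
  assumes levy: "levy_process M Z"
    and R_linear: "0 \<le> t \<Longrightarrow> bounded_linear (R t)"
    and R_bounded: "0 \<le> t \<Longrightarrow> \<exists>C. \<forall>s\<in>{0..t}. \<forall>x. norm (R s x) \<le> C * norm x"
    and R_continuous: "continuous_on {0..} (\<lambda>t. R t x)"
    and T_nonneg: "0 \<le> T"
begin

sublocale stationary_increments M Z
  by (rule stationary_increments_linear_image[OF levy bounded_linear_ident])

abbreviation grid_sum :: "nat \<Rightarrow> (nat \<Rightarrow> real) \<Rightarrow> (nat \<Rightarrow> real) \<Rightarrow> 'w \<Rightarrow> 'h" where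
  "grid_sum n \<sigma> \<rho> \<omega> \<equiv> \<Sum>i<n. R (\<rho> i) (Z (\<sigma> (Suc i)) \<omega> - Z (\<sigma> i) \<omega>)"

lemma forward_grid_sum_measurable:
  assumes g: "forward_grid t d n \<sigma> \<rho>"
  shows "grid_sum n \<sigma> \<rho> \<in> borel_measurable M"
proof (rule borel_measurable_sum)
  fix i assume "i \<in> {..<n}"
  then have "0 \<le> \<rho> i" "0 \<le> \<sigma> i" "0 \<le> \<sigma> (Suc i)"
    using g forward_grid_bounds[OF g, of i] forward_grid_bounds[OF g, of "Suc i"]
    by (auto simp: forward_grid_def intro: order_trans[rotated])
  then have [measurable]: "R (\<rho> i) \<in> borel_measurable borel" "Z (\<sigma> i) \<in> borel_measurable M"
    "Z (\<sigma> (Suc i)) \<in> borel_measurable M"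
    by (auto intro!: borel_measurable_continuous_onI linear_continuous_on R_linear measurable_W)
  show "(\<lambda>\<omega>. R (\<rho> i) (Z (\<sigma> (Suc i)) \<omega> - Z (\<sigma> i) \<omega>)) \<in> borel_measurable M" by measurable
qed

lemma R_bound_pos: "\<exists>C>0. \<forall>s\<in>{0..T}. \<forall>x. norm (R s x) \<le> C * norm x"
proof -
  obtain C where C: "\<forall>s\<in>{0..T}. \<forall>x. norm (R s x) \<le> C * norm x"
    using R_bounded[OF T_nonneg] by blast
  have "norm (R s x) \<le> max C 1 * norm x" if "s \<in> {0..T}" for s x
    using C that by (meson max.cobounded1 mult_right_mono norm_ge_zero order_trans)
  then show ?thesis by (intro exI[of _ "max C 1"]) auto
qed

text \<open>Strong continuity gives a modulus for each orbit, uniform on the compact interval; a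
  common modulus exists only because \<open>F\<close> is finite.\<close>

lemma R_equicontinuous:
  assumes F: "finite F" and \<delta>: "0 < \<delta>"
  shows "\<exists>d>0. \<forall>f\<in>F. \<forall>r\<in>{0..T}. \<forall>s\<in>{0..T}. \<bar>r - s\<bar> < d \<longrightarrow> norm (R r f - R s f) \<le> \<delta>"
proof -
  have "\<exists>d>0. \<forall>r\<in>{0..T}. \<forall>s\<in>{0..T}. \<bar>r - s\<bar> < d \<longrightarrow> norm (R r f - R s f) \<le> \<delta>" for f
  proof -
    have "uniformly_continuous_on {0..T} (\<lambda>t. R t f)"
      by (intro compact_uniformly_continuous continuous_on_subset[OF R_continuous]) auto
    then obtain d where "d > 0" "\<forall>r\<in>{0..T}. \<forall>s\<in>{0..T}. dist s r < d \<longrightarrow> dist (R s f) (R r f) < \<delta>"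
      using \<delta> unfolding uniformly_continuous_on_def by blast
    then show ?thesis by (auto simp: dist_norm intro!: exI[of _ d] less_imp_le)
  qed
  then obtain d where d: "\<And>f. d f > 0" "\<And>f r s. r \<in> {0..T} \<Longrightarrow> s \<in> {0..T} \<Longrightarrow> \<bar>r - s\<bar> < d f \<Longrightarrow> norm (R r f - R s f) \<le> \<delta>"
    by metis
  \<comment> \<open>Inserting 1 keeps the minimum meaningful when \<open>F\<close> is empty.\<close>
  define e where "e = Min (insert 1 (d ` F))"
  have "e > 0" "\<And>f. f \<in> F \<Longrightarrow> e \<le> d f" using F d(1) by (auto simp: e_def)
  then show ?thesis using d(2) by (intro exI[of _ e]) fastforce
qed

text \<open>On the common refinement the difference of two sums is again an operator sum. Its
  operators are differences of \<open>R\<close> at two times less than d apart, hence bounded by 2 C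
  and small on \<open>F\<close>, and \<open>operator_sums_small\<close> applies. All choices are
  made for the whole of [0, T], so d does not depend on t.\<close>

lemma forward_grids_close:
  assumes \<epsilon>: "0 < \<epsilon>"
  shows "\<exists>d>0. \<forall>t\<in>{0..T}. \<forall>n \<sigma> \<rho> n' \<sigma>' \<rho>'. forward_grid t d n \<sigma> \<rho> \<longrightarrow> forward_grid t d n' \<sigma>' \<rho>' \<longrightarrow>
    prob {\<omega>\<in>space M. norm (grid_sum n \<sigma> \<rho> \<omega>
      - grid_sum n' \<sigma>' \<rho>' \<omega>) > \<epsilon>} < \<epsilon>"
proof -
  obtain C where C: "C > 0" "\<And>s x. s \<in> {0..T} \<Longrightarrow> norm (R s x) \<le> C * norm x"
    using R_bound_pos by blast
  \<comment> \<open>The horizon T + 1 is positive also when T = 0.\<close>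
  have C2: "0 < 2 * C" and T1: "0 < T + 1" using C(1) T_nonneg by auto
  from operator_sums_small[OF levy \<epsilon> C2 T1] obtain F \<delta> where tail0: "finite F \<and> 0 < \<delta> \<and>
    (\<forall>n u (B :: nat \<Rightarrow> 'h \<Rightarrow> 'h). u 0 = 0 \<longrightarrow> (\<forall>i<n. u i \<le> u (Suc i)) \<longrightarrow> u n \<le> T + 1 \<longrightarrow>
    (\<forall>i<n. bounded_linear (B i) \<and> (\<forall>x. norm (B i x) \<le> 2 * C * norm x) \<and> (\<forall>f\<in>F. norm (B i f) \<le> \<delta>)) \<longrightarrow>
    prob {\<omega>\<in>space M. norm (\<Sum>i<n. B i (Z (u (Suc i)) \<omega> - Z (u i) \<omega>)) > \<epsilon>} < \<epsilon>)"
    by (elim exE)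
  note F = tail0[THEN conjunct1] tail0[THEN conjunct2, THEN conjunct1]
  note tail = tail0[THEN conjunct2, THEN conjunct2, THEN spec, THEN spec, THEN spec, THEN mp, THEN mp, THEN mp, THEN mp]
  obtain d where d: "d > 0"
    "\<And>f r s. f \<in> F \<Longrightarrow> r \<in> {0..T} \<Longrightarrow> s \<in> {0..T} \<Longrightarrow> \<bar>r - s\<bar> < d \<Longrightarrow> norm (R r f - R s f) \<le> \<delta>"
    using R_equicontinuous[OF F] by metis
  have "prob {\<omega>\<in>space M. norm (grid_sum n \<sigma> \<rho> \<omega>
      - grid_sum n' \<sigma>' \<rho>' \<omega>) > \<epsilon>} < \<epsilon>"
    if t: "t \<in> {0..T}" and g: "forward_grid t (d/2) n \<sigma> \<rho>" and g': "forward_grid t (d/2) n' \<sigma>' \<rho>'"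
    for t n \<sigma> \<rho> n' \<sigma>' \<rho>'
  proof -
    define G where "G = \<sigma> ` {..n} \<union> \<sigma>' ` {..n'}"
    define u where "u = (\<lambda>j. sorted_list_of_set G ! j)"
    define m where "m = card G - 1"
    have finG: "finite G" by (simp add: G_def)
    have Gb: "0 \<le> x \<and> x \<le> t" if "x \<in> G" for x
      using that forward_grid_bounds[OF g] forward_grid_bounds[OF g'] by (auto simp: G_def)
    obtain \<kappa> where \<kappa>: "\<kappa> 0 = 0" "\<kappa> n = m" "\<And>i. i < n \<Longrightarrow> \<kappa> i \<le> \<kappa> (Suc i)" "\<And>i. i \<le> n \<Longrightarrow> u (\<kappa> i) = \<sigma> i"
      using sorted_index_map[of G \<sigma> n] finG Gb g by (auto simp: G_def u_def m_def forward_grid_def)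
    obtain \<kappa>' where \<kappa>': "\<kappa>' 0 = 0" "\<kappa>' n' = m" "\<And>i. i < n' \<Longrightarrow> \<kappa>' i \<le> \<kappa>' (Suc i)" "\<And>i. i \<le> n' \<Longrightarrow> u (\<kappa>' i) = \<sigma>' i"
      using sorted_index_map[of G \<sigma>' n'] finG Gb g' by (auto simp: G_def u_def m_def forward_grid_def)
    have u0: "u 0 = 0" using \<kappa>(1) \<kappa>(4)[of 0] g by (simp add: forward_grid_def)
    have um: "u m = t" using \<kappa>(2) \<kappa>(4)[of n] g by (simp add: forward_grid_def)
    have u_le: "u i \<le> u j" if "i \<le> j" "j \<le> m" for i j
    proof -
      have "G \<noteq> {}" by (auto simp: G_def)
      then have "card G > 0" using finG by (simp add: card_gt_0_iff)
      then have "j < length (sorted_list_of_set G)" using that finG by (simp add: m_def)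
      then show ?thesis unfolding u_def using that by (intro sorted_nth_mono) auto
    qed
    have lin: "bounded_linear (R (\<rho> i))" if "i < n" for i
      using g that forward_grid_bounds[OF g, of "Suc i"] by (intro R_linear) (force simp: forward_grid_def)
    have lin': "bounded_linear (R (\<rho>' i))" if "i < n'" for i
      using g' that forward_grid_bounds[OF g', of "Suc i"] by (intro R_linear) (force simp: forward_grid_def)
    obtain r where r: "\<And>j. j < m \<Longrightarrow> \<exists>i<n. \<kappa> i \<le> j \<and> j < \<kappa> (Suc i) \<and> r j = \<rho> i"
      "\<And>f. (\<Sum>i<n. R (\<rho> i) (f (\<sigma> (Suc i)) - f (\<sigma> i))) = (\<Sum>j<m. R (r j) (f (u (Suc j)) - f (u j)))"
      using refined_sum[of \<kappa> n u \<sigma> R \<rho>, OF \<kappa>(1,3,4) lin] unfolding \<kappa>(2) by blast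
    obtain r' where r': "\<And>j. j < m \<Longrightarrow> \<exists>i<n'. \<kappa>' i \<le> j \<and> j < \<kappa>' (Suc i) \<and> r' j = \<rho>' i"
      "\<And>f. (\<Sum>i<n'. R (\<rho>' i) (f (\<sigma>' (Suc i)) - f (\<sigma>' i))) = (\<Sum>j<m. R (r' j) (f (u (Suc j)) - f (u j)))"
      using refined_sum[of \<kappa>' n' u \<sigma>' R \<rho>', OF \<kappa>'(1,3,4) lin'] unfolding \<kappa>'(2) by blast
    \<comment> \<open>A tag and the reflected point t - \<open>u j\<close> lie in the same reflected
      coarse cell, whose length is below d/2. Applied to both grids, this puts the two tags within d
      of each other.\<close>
    have loc: "0 \<le> q j \<and> q j \<le> t \<and> \<bar>q j - (t - u j)\<bar> < d/2"
      if gg: "forward_grid t (d/2) nn s p" and kk: "\<And>i. i \<le> nn \<Longrightarrow> u (k i) = s i" "\<And>i. i < nn \<Longrightarrow> k i \<le> k (Suc i)" "k nn = m"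
        and ex: "\<exists>i<nn. k i \<le> j \<and> j < k (Suc i) \<and> q j = p i"
      for nn s p and k :: "nat \<Rightarrow> nat" and q j
    proof -
      obtain i where i: "i < nn" "k i \<le> j" "j < k (Suc i)" "q j = p i" using ex by blast
      have km: "k i' \<le> k j'" if "i' \<le> j'" "j' \<le> nn" for i' j'
        using that by (induction j' rule: dec_induct) (auto intro: order_trans[OF _ kk(2)])
      have "k (Suc i) \<le> m" using km[of "Suc i" nn] i kk(3) by simp
      then have "s i \<le> u j" "u j \<le> s (Suc i)"
        using u_le[of "k i" j] u_le[of j "k (Suc i)"] kk(1)[of i] kk(1)[of "Suc i"] i by auto
      then show ?thesis
        using gg i forward_grid_bounds[OF gg, of i] forward_grid_bounds[OF gg, of "Suc i"]
        unfolding forward_grid_def by (smt (verit) Suc_leI less_imp_le)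
    qed
    have rr: "r j \<in> {0..T}" "r' j \<in> {0..T}" "\<bar>r j - r' j\<bar> < d" if "j < m" for j
      using loc[of n \<sigma> \<rho> \<kappa> j r, OF g \<kappa>(4,3,2) r(1)[OF that]]
        loc[of n' \<sigma>' \<rho>' \<kappa>' j r', OF g' \<kappa>'(4,3,2) r'(1)[OF that]] t
      unfolding atLeastAtMost_iff by (argo | linarith)+
    have diff: "grid_sum n \<sigma> \<rho> \<omega> - grid_sum n' \<sigma>' \<rho>' \<omega>
      = (\<Sum>j<m. R (r j) (Z (u (Suc j)) \<omega> - Z (u j) \<omega>) - R (r' j) (Z (u (Suc j)) \<omega> - Z (u j) \<omega>))" for \<omega>
      using r(2)[of "\<lambda>s. Z s \<omega>"] r'(2)[of "\<lambda>s. Z s \<omega>"] by (simp add: sum_subtractf)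
    show ?thesis
      unfolding diff
    proof (rule tail[of u m "\<lambda>j x. R (r j) x - R (r' j) x"])
      show "u 0 = 0" by (rule u0)
      show "\<forall>i<m. u i \<le> u (Suc i)" using u_le by auto
      show "u m \<le> T + 1" using um t by simp
      show "\<forall>j<m. bounded_linear (\<lambda>x. R (r j) x - R (r' j) x) \<and>
        (\<forall>x. norm (R (r j) x - R (r' j) x) \<le> 2 * C * norm x) \<and> (\<forall>f\<in>F. norm (R (r j) f - R (r' j) f) \<le> \<delta>)"
      proof (intro allI impI conjI ballI)
        fix j assume j: "j < m"
        show "bounded_linear (\<lambda>x. R (r j) x - R (r' j) x)"
          using rr[OF j] by (intro bounded_linear_sub R_linear) auto
        show "norm (R (r j) x - R (r' j) x) \<le> 2 * C * norm x" for x
          using C(2)[OF rr(1)[OF j], of x] C(2)[OF rr(2)[OF j], of x] norm_triangle_ineq4[of "R (r j) x" "R (r' j) x"] by simp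
        show "norm (R (r j) f - R (r' j) f) \<le> \<delta>" if "f \<in> F" for f
          using d(2)[OF that rr[OF j]] .
      qed
    qed
  qed
  note main = this
  show ?thesis
  proof (intro exI[of _ "d/2"] conjI ballI allI impI)
    show "d/2 > 0" using d(1) by simp
  qed (rule main)
qed

definition conv_approx :: "real \<Rightarrow> real \<Rightarrow> 'w \<Rightarrow> 'h" where
  "conv_approx d t \<omega> = (\<Sum>j<nat \<lceil>t / d\<rceil>. R (t - real j * d) (Z (real (Suc j) * d) \<omega> - Z (real j * d) \<omega>))"

lemma conv_approx_measurable:
  assumes "0 < d"
  shows "conv_approx d t \<in> borel_measurable M"
  unfolding conv_approx_def [abs_def]
proof (rule borel_measurable_sum)
  fix j assume "j \<in> {..<nat \<lceil>t / d\<rceil>}"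
  then have "real j * d < t" using less_nat_ceiling_divide_iff[OF assms] by simp
  then have [measurable]: "R (t - real j * d) \<in> borel_measurable borel"
    by (intro borel_measurable_continuous_onI linear_continuous_on R_linear) simp
  have [measurable]: "Z (real (Suc j) * d) \<in> borel_measurable M" "Z (real j * d) \<in> borel_measurable M"
    using assms by (auto intro!: measurable_W)
  show "(\<lambda>\<omega>. R (t - real j * d) (Z (real (Suc j) * d) \<omega> - Z (real j * d) \<omega>)) \<in> borel_measurable M"
    by measurable
qed

text \<open>Stationarity transports smallness in probability from time 0, so d is independent of the
  position of the interval.\<close>

lemma small_time_prob:
  assumes "0 < a" "0 < b"
  shows "\<exists>d>0. \<forall>s t. 0 \<le> s \<longrightarrow> s \<le> t \<longrightarrow> t - s < d \<longrightarrow> prob {\<omega>\<in>space M. norm (Z t \<omega> - Z s \<omega>) > a} < b"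
proof -
  have "\<forall>\<^sub>F h in at 0 within {0..}. prob {\<omega>\<in>space M. dist (Z h \<omega>) (Z 0 \<omega>) > a} < b"
    using levy_process_D(6)[OF levy order_refl assms(1)] assms by (intro order_tendstoD(2)) auto
  then obtain d where d: "d > 0" "\<And>h. h > 0 \<Longrightarrow> h < d \<Longrightarrow> prob {\<omega>\<in>space M. dist (Z h \<omega>) (Z 0 \<omega>) > a} < b"
    by (auto simp: eventually_at)
  have "prob {\<omega>\<in>space M. norm (Z t \<omega> - Z s \<omega>) > a} < b" if st: "0 \<le> s" "s \<le> t" "t - s < d" for s t
  proof (cases "s = t")
    case True
    then show ?thesis using assms by simp
  next
    case False
    have [measurable]: "Z t \<in> borel_measurable M" "Z s \<in> borel_measurable M" "Z (t - s) \<in> borel_measurable M"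
      using st by (auto intro: measurable_W)
    have "prob {\<omega>\<in>space M. norm (Z t \<omega> - Z s \<omega>) > a} = measure (distr M borel (\<lambda>\<omega>. Z t \<omega> - Z s \<omega>)) {x. norm x > a}"
      by (subst measure_distr) (auto intro!: arg_cong[where f=prob])
    also have "\<dots> = prob {\<omega>\<in>space M. norm (Z (t - s) \<omega>) > a}"
      unfolding stationary[OF st(1,2)] by (subst measure_distr) (auto intro!: arg_cong[where f=prob])
    also have "\<dots> = prob {\<omega>\<in>space M. dist (Z (t - s) \<omega>) (Z 0 \<omega>) > a}"
      by (auto simp: W_0 intro!: arg_cong[where f=prob])
    finally show ?thesis using d(2)[of "t - s"] st False by simp
  qed
  with d(1) show ?thesis by blast
qed

text \<open>The uniform sum stopped at t is a legitimate forward grid sum, and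
  \<open>conv_approx\<close> differs from it only in the last increment, which runs past t by less
  than d. That difference is at most C times the norm of a short increment of
  \<open>Z\<close>.\<close>

lemma conv_approx_close:
  assumes \<epsilon>: "0 < \<epsilon>"
  shows "\<exists>d0>0. \<forall>t\<in>{0..T}. \<forall>d n \<sigma> \<rho>. 0 < d \<longrightarrow> d < d0 \<longrightarrow> forward_grid t d0 n \<sigma> \<rho> \<longrightarrow>
    prob {\<omega>\<in>space M. norm (grid_sum n \<sigma> \<rho> \<omega> - conv_approx d t \<omega>) > \<epsilon>} < \<epsilon>"
proof -
  obtain C where C: "C > 0" "\<And>s x. s \<in> {0..T} \<Longrightarrow> norm (R s x) \<le> C * norm x"
    using R_bound_pos by blast
  have \<epsilon>2: "0 < \<epsilon>/2" using \<epsilon> by simp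
  from forward_grids_close[OF \<epsilon>2] obtain d1 where d10: "d1 > 0 \<and> (\<forall>t\<in>{0..T}. \<forall>n \<sigma> \<rho> n' \<sigma>' \<rho>'.
    forward_grid t d1 n \<sigma> \<rho> \<longrightarrow> forward_grid t d1 n' \<sigma>' \<rho>' \<longrightarrow>
    prob {\<omega>\<in>space M. norm (grid_sum n \<sigma> \<rho> \<omega>
      - grid_sum n' \<sigma>' \<rho>' \<omega>) > \<epsilon>/2} < \<epsilon>/2)"
    by (elim exE)
  note d1 = d10[THEN conjunct1] d10[THEN conjunct2, rule_format]
  obtain d2 where d2: "d2 > 0" "\<And>s t. 0 \<le> s \<Longrightarrow> s \<le> t \<Longrightarrow> t - s < d2 \<Longrightarrow>
      prob {\<omega>\<in>space M. norm (Z t \<omega> - Z s \<omega>) > \<epsilon> / (2 * C)} < \<epsilon>/2"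
    using small_time_prob[of "\<epsilon> / (2 * C)" "\<epsilon>/2"] \<epsilon> C(1) by auto
  define d0 where "d0 = min d1 d2"
  have "prob {\<omega>\<in>space M. norm (grid_sum n \<sigma> \<rho> \<omega> - conv_approx d t \<omega>) > \<epsilon>} < \<epsilon>"
    if t: "t \<in> {0..T}" and d: "0 < d" "d < d0" and g: "forward_grid t d0 n \<sigma> \<rho>" for t d n \<sigma> \<rho>
  proof -
    define q where "q = nat \<lceil>t / d\<rceil>"
    have q_iff: "j < q \<longleftrightarrow> real j * d < t" for j
      unfolding q_def by (rule less_nat_ceiling_divide_iff[OF d(1)])
    define \<sigma>' where "\<sigma>' = (\<lambda>j::nat. min t (real j * d))"
    define \<rho>' where "\<rho>' = (\<lambda>j::nat. t - real j * d)"
    define S where "S = grid_sum n \<sigma> \<rho>"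
    define S' where "S' = grid_sum q \<sigma>' \<rho>'"
    have g1: "forward_grid t d1 n \<sigma> \<rho>" using g by (auto simp: forward_grid_def d0_def)
    have tq: "t \<le> real q * d" using q_iff[of q] by simp
    have g': "forward_grid t d1 q \<sigma>' \<rho>'"
      unfolding q_def \<sigma>'_def \<rho>'_def using t d by (intro forward_grid_uniform) (auto simp: d0_def)
    have SM: "S \<in> borel_measurable M" "S' \<in> borel_measurable M"
      unfolding S_def S'_def by (rule forward_grid_sum_measurable[OF g1], rule forward_grid_sum_measurable[OF g'])
    have [measurable]: "Z (real q * d) \<in> borel_measurable M" "Z t \<in> borel_measurable M"
      using t d by (auto intro!: measurable_W)
    have last: "norm (conv_approx d t \<omega> - S' \<omega>) \<le> C * norm (Z (real q * d) \<omega> - Z t \<omega>)" for \<omega>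
    proof (cases q)
      case 0
      then show ?thesis using C(1) by (simp add: conv_approx_def S'_def q_def)
    next
      case (Suc p)
      have pt: "real p * d < t" using q_iff[of p] Suc by simp
      interpret Rp: bounded_linear "R (t - real p * d)" using pt by (intro R_linear) simp
      have "(\<Sum>j<p. R (t - real j * d) (Z (real (Suc j) * d) \<omega> - Z (real j * d) \<omega>))
          = (\<Sum>j<p. R (\<rho>' j) (Z (\<sigma>' (Suc j)) \<omega> - Z (\<sigma>' j) \<omega>))"
      proof (rule sum.cong[OF refl])
        fix j assume "j \<in> {..<p}"
        then have "real (Suc j) * d \<le> real p * d" "real j * d \<le> real p * d"
          using d by (auto intro!: mult_right_mono simp del: of_nat_Suc)
        then have "\<sigma>' (Suc j) = real (Suc j) * d" "\<sigma>' j = real j * d" using pt by (auto simp: \<sigma>'_def)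
        then show "R (t - real j * d) (Z (real (Suc j) * d) \<omega> - Z (real j * d) \<omega>) = R (\<rho>' j) (Z (\<sigma>' (Suc j)) \<omega> - Z (\<sigma>' j) \<omega>)"
          by (simp add: \<rho>'_def)
      qed
      moreover have "\<sigma>' p = real p * d" "\<sigma>' (Suc p) = t" using pt tq Suc by (auto simp: \<sigma>'_def)
      ultimately have "conv_approx d t \<omega> - S' \<omega> = R (t - real p * d) (Z (real q * d) \<omega> - Z t \<omega>)"
        unfolding conv_approx_def q_def[symmetric] S'_def Suc by (simp add: \<rho>'_def Rp.diff)
      moreover have "0 \<le> real p * d" using d by simp
      ultimately show ?thesis using C(2)[of "t - real p * d" "Z (real q * d) \<omega> - Z t \<omega>"] pt t by simp
    qed
    have "real q * d - t < d2"
    proof (cases q)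
      case 0
      then show ?thesis using t d2 by simp
    next
      case (Suc p)
      then show ?thesis using q_iff[of p] d by (simp add: algebra_simps d0_def)
    qed
    then have p2: "prob {\<omega>\<in>space M. norm (Z (real q * d) \<omega> - Z t \<omega>) > \<epsilon> / (2 * C)} < \<epsilon>/2"
      using t tq by (intro d2(2)) auto
    note [measurable] = SM conv_approx_measurable[OF d(1), of t]
    have "norm (Z (real q * d) \<omega> - Z t \<omega>) > \<epsilon> / (2 * C)" if "norm (S' \<omega> - conv_approx d t \<omega>) > \<epsilon>/2" for \<omega>
    proof -
      have "\<epsilon>/2 < C * norm (Z (real q * d) \<omega> - Z t \<omega>)"
        using that last[of \<omega>] by (simp add: norm_minus_commute)
      then show ?thesis using C(1) by (simp add: field_simps)
    qed
    then have "prob {\<omega>\<in>space M. norm (S' \<omega> - conv_approx d t \<omega>) > \<epsilon>/2}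
      \<le> prob {\<omega>\<in>space M. norm (Z (real q * d) \<omega> - Z t \<omega>) > \<epsilon> / (2 * C)}"
      by (intro finite_measure_mono) auto
    then have p2: "prob {\<omega>\<in>space M. norm (S' \<omega> - conv_approx d t \<omega>) > \<epsilon>/2} < \<epsilon>/2"
      using p2 by (rule le_less_trans)
    have "prob {\<omega>\<in>space M. norm (S \<omega> - S' \<omega>) > \<epsilon>/2} < \<epsilon>/2"
      unfolding S_def S'_def by (rule d1(2)[OF t g1 g'])
    then have "prob {\<omega>\<in>space M. norm ((S \<omega> - S' \<omega>) + (S' \<omega> - conv_approx d t \<omega>)) > \<epsilon>} < \<epsilon>"
      using p2 by (intro prob_norm_add_less) simp_all
    then show ?thesis by (simp add: S_def)
  qed
  note main = this
  show ?thesis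
  proof (intro exI[of _ d0] conjI ballI allI impI)
    show "d0 > 0" using d1(1) d2(1) by (simp add: d0_def)
  qed (rule main)
qed

end

text \<open>\<open>conv_sum\<close> partitions elapsed time; the reflection t - \<open>tt\<close>
  together with the index reversal n - i turns this into a grid in the time of
  \<open>Z\<close>.\<close>

lemma tagged_partition_forward_grid:
  assumes tp: "tagged_partition t n tt s" and mesh: "\<And>i. i < n \<Longrightarrow> tt (Suc i) - tt i < d"
  shows "forward_grid t d n (\<lambda>i. t - tt (n - i)) (\<lambda>i. s (n - i))"
    and "conv_sum R Z t n tt s \<omega> = (\<Sum>i<n. R (s (n - i)) (Z (t - tt (n - Suc i)) \<omega> - Z (t - tt (n - i)) \<omega>))"
proof -
  show "forward_grid t d n (\<lambda>i. t - tt (n - i)) (\<lambda>i. s (n - i))"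
    unfolding forward_grid_def
  proof (intro conjI allI impI)
    fix i assume i: "i < n"
    define j where "j = n - Suc i"
    have j: "j < n" "n - i = Suc j" using i by (auto simp: j_def)
    have "tt j < tt (Suc j)" "tt j \<le> s (Suc j)" "s (Suc j) \<le> tt (Suc j)"
      using tp j(1) by (auto simp: tagged_partition_def dest!: bspec[of _ _ "Suc j"])
    then show "t - tt (n - i) \<le> t - tt (n - Suc i)" "t - tt (n - Suc i) - (t - tt (n - i)) < d"
      "t - (t - tt (n - Suc i)) \<le> s (n - i)" "s (n - i) \<le> t - (t - tt (n - i))"
      using mesh[OF j(1)] j(2) j_def[symmetric] by auto
  qed (use tp in \<open>auto simp: tagged_partition_def\<close>)
  show "conv_sum R Z t n tt s \<omega> = (\<Sum>i<n. R (s (n - i)) (Z (t - tt (n - Suc i)) \<omega> - Z (t - tt (n - i)) \<omega>))"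
    unfolding conv_sum_def
    by (rule sum.reindex_bij_witness[where i="\<lambda>i. n - i" and j="\<lambda>i. n - i"]) (auto simp: Suc_diff_le)
qed

section \<open>Localization and second moments\<close>

text \<open>One-sided limits bound the path near each point, and finitely many such neighbourhoods
  cover the compact interval.\<close>

lemma cadlag_bounded:
  fixes z :: "real \<Rightarrow> 'h::real_normed_vector"
  assumes right: "\<And>t. 0 \<le> t \<Longrightarrow> continuous (at_right t) z"
    and left: "\<And>t. 0 < t \<Longrightarrow> \<exists>l. (z \<longlongrightarrow> l) (at_left t)"
  shows "\<exists>B. \<forall>s\<in>{0..S}. norm (z s) \<le> B"
proof -
  have loc: "\<exists>e>0. \<exists>B. \<forall>y\<in>{0..S}. \<bar>y - x\<bar> < e \<longrightarrow> norm (z y) \<le> B" if x: "x \<in> {0..S}" for x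
  proof -
    have "(z \<longlongrightarrow> z x) (at_right x)" using right[of x] x by (simp add: continuous_within)
    then have "\<forall>\<^sub>F y in at_right x. norm (z y) < norm (z x) + 1"
      by (intro order_tendstoD(2)[OF tendsto_norm]) auto
    then obtain b where b: "b > x" "\<And>y. x < y \<Longrightarrow> y < b \<Longrightarrow> norm (z y) < norm (z x) + 1"
      \<comment> \<open>Only the left limit requires a case distinction afterwards: at x = 0 there
        is no time to the left, and the bound 0 holds vacuously.\<close>
      by (auto simp: eventually_at_right_field)
    obtain c B where c: "c < x" "\<And>y. 0 \<le> y \<Longrightarrow> c < y \<Longrightarrow> y < x \<Longrightarrow> norm (z y) < B"
    proof (cases "x = 0")
      case True
      then show ?thesis using that[of "-1" 0] by simp
    next
      case False
      then obtain l where "(z \<longlongrightarrow> l) (at_left x)" using left[of x] x by auto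
      then have "\<forall>\<^sub>F y in at_left x. norm (z y) < norm l + 1"
        by (intro order_tendstoD(2)[OF tendsto_norm]) auto
      then show ?thesis using that by (auto simp: eventually_at_left_field)
    qed
    show ?thesis
    proof (rule exI[of _ "min (b - x) (x - c)"], intro conjI exI[of _ "max (norm (z x) + 1) B"] ballI impI)
      show "0 < min (b - x) (x - c)" using b c by simp
    next
      fix y assume y: "y \<in> {0..S}" "\<bar>y - x\<bar> < min (b - x) (x - c)"
      consider "y < x" | "y = x" | "x < y" by linarith
      then show "norm (z y) \<le> max (norm (z x) + 1) B"
      proof cases
        case 1
        then show ?thesis using c(2)[of y] y by auto
      next
        case 3
        then show ?thesis using b(2)[of y] y by auto
      qed simp
    qed
  qed
  then obtain e B where eB: "\<And>x. x \<in> {0..S} \<Longrightarrow> e x > 0"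
    "\<And>x y. x \<in> {0..S} \<Longrightarrow> y \<in> {0..S} \<Longrightarrow> \<bar>y - x\<bar> < e x \<Longrightarrow> norm (z y) \<le> B x"
    by metis
  have "{0..S} \<subseteq> (\<Union>x\<in>{0..S}. ball x (e x))" using eB(1) by auto
  then obtain D where D: "D \<subseteq> {0..S}" "finite D" "{0..S} \<subseteq> (\<Union>x\<in>D. ball x (e x))"
    using compactE_image[of "{0..S}" "{0..S}" "\<lambda>x. ball x (e x)"] by (metis compact_Icc open_ball)
  have "norm (z s) \<le> (\<Sum>x\<in>D. \<bar>B x\<bar>)" if s: "s \<in> {0..S}" for s
  proof -
    obtain x where x: "x \<in> D" "s \<in> ball x (e x)" using D(3) s by blast
    then have "norm (z s) \<le> B x" using D(1) s by (intro eB(2)) (auto simp: dist_real_def)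
    also have "\<dots> \<le> \<bar>B x\<bar>" by simp
    also have "\<dots> \<le> (\<Sum>x\<in>D. \<bar>B x\<bar>)" using D(2) x(1) by (intro member_le_sum) auto
    finally show ?thesis .
  qed
  then show ?thesis by blast
qed

context levy_convolution
begin

text \<open>Both approximants are compared with one and the same stopped uniform sum of mesh
  d0/2.\<close>

lemma conv_approx_cauchy:
  assumes \<epsilon>: "0 < \<epsilon>"
  shows "\<exists>d0>0. \<forall>t\<in>{0..T}. \<forall>d d'. 0 < d \<longrightarrow> d < d0 \<longrightarrow> 0 < d' \<longrightarrow> d' < d0 \<longrightarrow>
    prob {\<omega>\<in>space M. norm (conv_approx d t \<omega> - conv_approx d' t \<omega>) > \<epsilon>} < \<epsilon>"
proof -
  have \<epsilon>2: "0 < \<epsilon>/2" using \<epsilon> by simp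
  from conv_approx_close[OF \<epsilon>2] obtain d0 where d00: "d0 > 0 \<and> (\<forall>t\<in>{0..T}. \<forall>d n \<sigma> \<rho>. 0 < d \<longrightarrow> d < d0 \<longrightarrow> forward_grid t d0 n \<sigma> \<rho> \<longrightarrow>
    prob {\<omega>\<in>space M. norm (grid_sum n \<sigma> \<rho> \<omega> - conv_approx d t \<omega>) > \<epsilon>/2} < \<epsilon>/2)"
    by (elim exE)
  note d0 = d00[THEN conjunct1] d00[THEN conjunct2, rule_format]
  have "prob {\<omega>\<in>space M. norm (conv_approx d t \<omega> - conv_approx d' t \<omega>) > \<epsilon>} < \<epsilon>"
    if t: "t \<in> {0..T}" and d: "0 < d" "d < d0" and d': "0 < d'" "d' < d0" for t d d'
  proof -
    define n where "n = nat \<lceil>t / (d0/2)\<rceil>"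
    define S where "S = (\<lambda>\<omega>. \<Sum>i<n. R (t - real i * (d0/2)) (Z (min t (real (Suc i) * (d0/2))) \<omega> - Z (min t (real i * (d0/2))) \<omega>))"
    have g: "forward_grid t d0 n (\<lambda>j. min t (real j * (d0/2))) (\<lambda>j. t - real j * (d0/2))"
      unfolding n_def using t d0(1) by (intro forward_grid_uniform) auto
    have p: "prob {\<omega>\<in>space M. norm (S \<omega> - conv_approx d t \<omega>) > \<epsilon>/2} < \<epsilon>/2"
      "prob {\<omega>\<in>space M. norm (S \<omega> - conv_approx d' t \<omega>) > \<epsilon>/2} < \<epsilon>/2"
      unfolding S_def using d0(2)[OF t d g] d0(2)[OF t d' g] by auto
    have SM: "S \<in> borel_measurable M"
      unfolding S_def by (rule forward_grid_sum_measurable[OF g])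
    note [measurable] = SM conv_approx_measurable[OF d(1), of t] conv_approx_measurable[OF d'(1), of t]
    have "prob {\<omega>\<in>space M. norm ((conv_approx d t \<omega> - S \<omega>) + (S \<omega> - conv_approx d' t \<omega>)) > \<epsilon>} < \<epsilon>"
      using p by (intro prob_norm_add_less) (simp_all add: norm_minus_commute)
    then show ?thesis by simp
  qed
  note main = this
  show ?thesis by (intro exI[of _ d0] conjI ballI allI impI d0(1)) (rule main)
qed

text \<open>On this event the increments of \<open>Z\<close> are bounded by \<open>k + 1\<close>, so that rescaling by \<open>1 / (k + 1)\<close>
  makes the truncation invisible.\<close>
definition bounded_path_event :: "nat \<Rightarrow> 'w set" where
  "bounded_path_event k = {\<omega>\<in>space M. \<forall>s\<in>{0..T+1}. norm (Z s \<omega>) \<le> real (Suc k) / 2}"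

text \<open>Right continuity reduces the uncountable condition to rational times. The end T + 1 must
  be added, since it cannot be reached from the right inside the interval.\<close>

lemma bounded_path_event_sets: "bounded_path_event k \<in> sets M"
proof -
  define c where "c = real (Suc k) / 2"
  define Q where "Q = insert (T + 1) (\<rat> \<inter> {0..T+1})"
  have "countable Q" unfolding Q_def using countable_rat by (intro countable_insert countable_Int1)
  have Q: "s \<in> {0..T+1}" if "s \<in> Q" for s using that T_nonneg by (auto simp: Q_def)
  have "bounded_path_event k = {\<omega>\<in>space M. \<forall>s\<in>Q. norm (Z s \<omega>) \<le> c}"
  proof (intro set_eqI iffI)
    fix \<omega> assume "\<omega> \<in> {\<omega>\<in>space M. \<forall>s\<in>Q. norm (Z s \<omega>) \<le> c}"
    then have \<omega>: "\<omega> \<in> space M" "\<And>s. s \<in> Q \<Longrightarrow> norm (Z s \<omega>) \<le> c" by auto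
    have "norm (Z s \<omega>) \<le> c" if s: "s \<in> {0..T+1}" for s
    proof (rule ccontr)
      assume gt: "\<not> norm (Z s \<omega>) \<le> c"
      then have sT: "s < T + 1" using s \<omega>(2)[of "T + 1"] by (cases "s = T + 1") (auto simp: Q_def)
      have "((\<lambda>r. Z r \<omega>) \<longlongrightarrow> Z s \<omega>) (at_right s)"
        using levy_process_D(7)[OF levy \<omega>(1), of s] s by (simp add: continuous_within)
      then have "\<forall>\<^sub>F r in at_right s. norm (Z r \<omega>) > c"
        using gt by (intro order_tendstoD(1)[OF tendsto_norm]) auto
      then obtain b where b: "b > s" "\<And>r. s < r \<Longrightarrow> r < b \<Longrightarrow> norm (Z r \<omega>) > c"
        by (auto simp: eventually_at_right_field)
      obtain q where q: "q \<in> \<rat>" "s < q" "q < min b (T + 1)"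
        using Rats_dense_in_real[of s "min b (T + 1)"] b sT by auto
      then have "q \<in> Q" using s by (auto simp: Q_def)
      then show False using b(2)[of q] \<omega>(2)[of q] q by auto
    qed
    then show "\<omega> \<in> bounded_path_event k" using \<omega>(1) by (simp add: bounded_path_event_def c_def)
  qed (use Q in \<open>auto simp: bounded_path_event_def c_def\<close>)
  also have "\<dots> \<in> sets M"
  proof -
    have "{\<omega> \<in> space M. norm (Z s \<omega>) \<le> c} \<in> sets M" if "s \<in> Q" for s
    proof -
      have [measurable]: "Z s \<in> borel_measurable M" using Q[OF that] by (intro measurable_W) auto
      show ?thesis by measurable
    qed
    then have "(\<Inter>s\<in>Q. {\<omega> \<in> space M. norm (Z s \<omega>) \<le> c}) \<in> sets M"
      using \<open>countable Q\<close> by (intro sets.countable_INT') (auto simp: Q_def)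
    also have "(\<Inter>s\<in>Q. {\<omega> \<in> space M. norm (Z s \<omega>) \<le> c}) = {\<omega>\<in>space M. \<forall>s\<in>Q. norm (Z s \<omega>) \<le> c}"
      by (auto simp: Q_def)
    finally show ?thesis .
  qed
  finally show ?thesis .
qed

lemma bounded_path_event_eventually:
  assumes "\<omega> \<in> space M"
  shows "\<exists>k0. \<forall>k\<ge>k0. \<omega> \<in> bounded_path_event k"
proof -
  obtain B where B: "\<And>s. s \<in> {0..T+1} \<Longrightarrow> norm (Z s \<omega>) \<le> B"
    using cadlag_bounded[of "\<lambda>s. Z s \<omega>" "T + 1"] levy_process_D(7,8)[OF levy assms] by blast
  have "\<omega> \<in> bounded_path_event k" if "k \<ge> nat \<lceil>2 * B\<rceil>" for k
  proof -
    have "2 * B \<le> real (Suc k)" using that by linarith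
    then show ?thesis using B assms by (force simp: bounded_path_event_def)
  qed
  then show ?thesis by blast
qed

text \<open>Restriction to the event creates second moments that \<open>Z\<close> itself may lack.
  There the sum is k + 1 times the truncated sum of the rescaled process, to which
  \<open>truncated_sum_second_moment\<close> applies with \<eta> = 1/48 once k is large. The
  constant depends on k, but neither on the mesh nor on t.\<close>

lemma conv_approx_second_moment:
  "\<exists>k0. \<forall>k\<ge>k0. \<exists>K. \<forall>d t. 0 < d \<longrightarrow> d \<le> 1 \<longrightarrow> t \<in> {0..T} \<longrightarrow>
    (\<integral>\<^sup>+\<omega>. indicator (bounded_path_event k) \<omega> * ennreal ((norm (conv_approx d t \<omega>))\<^sup>2) \<partial>M) \<le> ennreal K"
proof -
  obtain C where C: "C > 0" "\<And>s x. s \<in> {0..T} \<Longrightarrow> norm (R s x) \<le> C * norm x"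
    using R_bound_pos by blast
  have "\<forall>\<^sub>F n in sequentially. small_on M (\<lambda>t \<omega>. (1 / real (Suc n)) *\<^sub>R Z t \<omega>) (T + 1) (1/48)"
  proof (rule small_on_eventually[OF levy])
    show "(\<lambda>n. (1 / real (Suc n)) *\<^sub>R x) \<longlonglongrightarrow> 0" for x :: 'h
      using tendsto_scaleR[OF LIMSEQ_inverse_real_of_nat tendsto_const[of x]] by (simp add: inverse_eq_divide)
    show "norm ((1 / real (Suc n)) *\<^sub>R x) \<le> norm x" for n and x :: 'h
      by (simp add: divide_le_eq mult_le_cancel_left1 mult_left_le)
  qed (auto intro: bounded_linear_scaleR_right)
  then obtain k0 where k0: "\<And>k. k \<ge> k0 \<Longrightarrow> small_on M (\<lambda>t \<omega>. (1 / real (Suc k)) *\<^sub>R Z t \<omega>) (T + 1) (1/48)"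
    by (auto simp: eventually_sequentially)
  have "(\<integral>\<^sup>+\<omega>. indicator (bounded_path_event k) \<omega> * ennreal ((norm (conv_approx d t \<omega>))\<^sup>2) \<partial>M)
      \<le> ennreal ((real (Suc k))\<^sup>2 * (C\<^sup>2 * (16 * (1/48) + 1152 * (1/48)\<^sup>2)))"
    if k: "k \<ge> k0" and d: "0 < d" "d \<le> 1" and t: "t \<in> {0..T}" for k d t
  proof -
    define \<beta> where "\<beta> = 1 / real (Suc k)"
    have \<beta>: "0 < \<beta>" by (simp add: \<beta>_def)
    define q where "q = nat \<lceil>t / d\<rceil>"
    have q_iff: "j < q \<longleftrightarrow> real j * d < t" for j
      unfolding q_def by (rule less_nat_ceiling_divide_iff[OF d(1)])
    \<comment> \<open>The last cell overshoots t by less than d \<le> 1; hence the horizon T + 1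
      here and in \<open>bounded_path_event\<close>.\<close>
    have qT: "real q * d \<le> T + 1"
    proof (cases q)
      case (Suc p)
      then have "real p * d < t" using q_iff[of p] by simp
      then show ?thesis using t d Suc by (simp add: algebra_simps)
    qed (use T_nonneg in simp)
    interpret W: stationary_increments M "\<lambda>t \<omega>. \<beta> *\<^sub>R Z t \<omega>"
      by (rule stationary_increments_linear_image[OF levy bounded_linear_scaleR_right])
    define S where "S = (\<lambda>\<omega>. (norm (\<Sum>j<q. R (t - real j * d) (unit_trunc (\<beta> *\<^sub>R Z (real (Suc j) * d) \<omega> - \<beta> *\<^sub>R Z (real j * d) \<omega>))))\<^sup>2)"
    have rT: "t - real j * d \<in> {0..T}" if "j < q" for j
      using that q_iff[of j] t d by (auto intro: order_trans[of _ t])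
    have S: "integrable M S" "expectation S \<le> C\<^sup>2 * (16 * (1/48) + 1152 * (1/48)\<^sup>2)"
    proof -
      have small: "small_on M (\<lambda>t \<omega>. \<beta> *\<^sub>R Z t \<omega>) (T + 1) (1/48)" using k0[OF k] by (simp add: \<beta>_def)
      have lin: "bounded_linear (R (t - real j * d))" if "j < q" for j
        using rT[OF that] by (intro R_linear) auto
      have step: "real j * d \<le> real (Suc j) * d" for j using d by (intro mult_right_mono) auto
      note W.truncated_sum_second_moment[of "T + 1" "1/48" "\<lambda>j. real j * d" q "\<lambda>j. R (t - real j * d)" C,
          OF small order_refl _ _ step qT lin C(2)[OF rT]]
      then show "integrable M S" "expectation S \<le> C\<^sup>2 * (16 * (1/48) + 1152 * (1/48)\<^sup>2)"
        using T_nonneg C(1) by (simp_all add: S_def)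
    qed
    have "(\<integral>\<^sup>+\<omega>. indicator (bounded_path_event k) \<omega> * ennreal ((norm (conv_approx d t \<omega>))\<^sup>2) \<partial>M)
      \<le> (\<integral>\<^sup>+\<omega>. ennreal ((real (Suc k))\<^sup>2 * S \<omega>) \<partial>M)"
    proof (intro nn_integral_mono)
      fix \<omega>
      show "indicator (bounded_path_event k) \<omega> * ennreal ((norm (conv_approx d t \<omega>))\<^sup>2) \<le> ennreal ((real (Suc k))\<^sup>2 * S \<omega>)"
      proof (cases "\<omega> \<in> bounded_path_event k")
        case True
        have "R (t - real j * d) (unit_trunc (\<beta> *\<^sub>R Z (real (Suc j) * d) \<omega> - \<beta> *\<^sub>R Z (real j * d) \<omega>))
            = \<beta> *\<^sub>R R (t - real j * d) (Z (real (Suc j) * d) \<omega> - Z (real j * d) \<omega>)" if "j < q" for j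
        proof -
          interpret Rj: bounded_linear "R (t - real j * d)" using rT[OF that] by (intro R_linear) auto
          have "real (Suc j) * d \<le> real q * d" "real j * d \<le> real q * d"
            using that d by (auto intro!: mult_right_mono simp del: of_nat_Suc)
          then have "real (Suc j) * d \<le> T + 1" "real j * d \<le> T + 1" using qT by linarith+
          then have "real (Suc j) * d \<in> {0..T+1}" "real j * d \<in> {0..T+1}" using d by (auto simp del: of_nat_Suc)
          then have "norm (Z (real (Suc j) * d) \<omega>) \<le> real (Suc k) / 2" "norm (Z (real j * d) \<omega>) \<le> real (Suc k) / 2"
            using True by (auto simp: bounded_path_event_def)
          then have "norm (Z (real (Suc j) * d) \<omega> - Z (real j * d) \<omega>) \<le> real (Suc k)"
            using norm_triangle_le_diff[OF add_mono, of "Z (real (Suc j) * d) \<omega>" "real (Suc k) / 2" "Z (real j * d) \<omega>" "real (Suc k) / 2"]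
            by (simp only: field_sum_of_halves)
          then have "\<beta> * norm (Z (real (Suc j) * d) \<omega> - Z (real j * d) \<omega>) \<le> \<beta> * real (Suc k)"
            using \<beta> by (intro mult_left_mono) auto
          then have "norm (\<beta> *\<^sub>R (Z (real (Suc j) * d) \<omega> - Z (real j * d) \<omega>)) \<le> 1"
            using \<beta> by (simp add: \<beta>_def del: of_nat_Suc)
          then have "unit_trunc (\<beta> *\<^sub>R (Z (real (Suc j) * d) \<omega> - Z (real j * d) \<omega>)) = \<beta> *\<^sub>R (Z (real (Suc j) * d) \<omega> - Z (real j * d) \<omega>)"
            by (rule unit_trunc_id)
          then show ?thesis unfolding scaleR_diff_right[symmetric] by (simp only: Rj.scaleR)
        qed
        then have "S \<omega> = (norm (\<beta> *\<^sub>R conv_approx d t \<omega>))\<^sup>2"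
          unfolding S_def conv_approx_def q_def[symmetric] by (simp add: scaleR_sum_right)
        then have "(norm (conv_approx d t \<omega>))\<^sup>2 = (real (Suc k))\<^sup>2 * S \<omega>"
          using \<beta> by (simp add: \<beta>_def power_mult_distrib power_divide del: of_nat_Suc)
        then show ?thesis using True by simp
      qed simp
    qed
    also have "\<dots> = ennreal (expectation (\<lambda>\<omega>. (real (Suc k))\<^sup>2 * S \<omega>))"
      using S(1) by (intro nn_integral_eq_integral) (auto simp: S_def)
    also have "\<dots> \<le> ennreal ((real (Suc k))\<^sup>2 * (C\<^sup>2 * (16 * (1/48) + 1152 * (1/48)\<^sup>2)))"
      using S by (intro ennreal_leI) (auto intro!: mult_left_mono simp del: of_nat_Suc)
    finally show ?thesis .
  qed
  then show ?thesis by blast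
qed

end

section \<open>The stochastic convolution as a measurable process\<close>

text \<open>A second moment bound gives uniform integrability: D \<le> min l D + D^2 / l splits off
  a bounded part, which converges by domination, and a tail of mean at most |K| / l.\<close>

lemma (in prob_space) tendsto_L1_of_L2_bounded:
  fixes D :: "nat \<Rightarrow> 'a \<Rightarrow> real"
  assumes [measurable]: "\<And>n. D n \<in> borel_measurable M" and nonneg: "\<And>n \<omega>. 0 \<le> D n \<omega>"
    and lim: "AE \<omega> in M. (\<lambda>n. D n \<omega>) \<longlonglongrightarrow> 0"
    and bound: "\<And>n. (\<integral>\<^sup>+\<omega>. ennreal ((D n \<omega>)\<^sup>2) \<partial>M) \<le> ennreal K"
  shows "(\<lambda>n. \<integral>\<^sup>+\<omega>. ennreal (D n \<omega>) \<partial>M) \<longlonglongrightarrow> 0"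
proof (rule order_tendstoI)
  fix a :: ennreal assume "0 < a"
  then obtain b where b: "0 < b" "b < a" using dense by blast
  then have "b \<noteq> top" by auto
  then obtain e where e: "b = ennreal e" "0 < e" using b(1) by (cases b) auto
  \<comment> \<open>This level makes the tail contribute at most e/2; the summand 1 keeps l positive
    for K = 0.\<close>
  define l where "l = 2 * (\<bar>K\<bar> + 1) / e"
  have l: "0 < l" using e by (simp add: l_def)
  have "(\<lambda>n. expectation (\<lambda>\<omega>. min l (D n \<omega>))) \<longlonglongrightarrow> expectation (\<lambda>\<omega>. 0)"
  proof (rule integral_dominated_convergence[where w="\<lambda>_. l"])
    show "AE \<omega> in M. (\<lambda>n. min l (D n \<omega>)) \<longlonglongrightarrow> 0"
      using lim
    proof eventually_elim
      case (elim \<omega>)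
      show ?case using tendsto_min[OF tendsto_const[of l] elim] l by simp
    qed
  qed (use l nonneg in auto)
  then have "\<forall>\<^sub>F n in sequentially. expectation (\<lambda>\<omega>. min l (D n \<omega>)) < e/2"
    using e by (intro order_tendstoD(2)) auto
  then show "\<forall>\<^sub>F n in sequentially. (\<integral>\<^sup>+\<omega>. ennreal (D n \<omega>) \<partial>M) < a"
  proof eventually_elim
    case (elim n)
    have int: "integrable M (\<lambda>\<omega>. min l (D n \<omega>))"
      using l nonneg by (intro integrable_bounded[where c=l]) auto
    have "(\<integral>\<^sup>+\<omega>. ennreal (D n \<omega>) \<partial>M) \<le> (\<integral>\<^sup>+\<omega>. ennreal (min l (D n \<omega>)) + ennreal (1/l) * ennreal ((D n \<omega>)\<^sup>2) \<partial>M)"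
    proof (rule nn_integral_mono)
      fix \<omega>
      have "D n \<omega> \<le> min l (D n \<omega>) + 1/l * (D n \<omega>)\<^sup>2"
      proof (cases "D n \<omega> \<le> l")
        case False
        then have "l * D n \<omega> \<le> D n \<omega> * D n \<omega>" using nonneg by (intro mult_right_mono) auto
        then have "D n \<omega> \<le> 1/l * (D n \<omega>)\<^sup>2" using l by (simp add: field_simps power2_eq_square)
        then show ?thesis using l nonneg[of n \<omega>] False by simp
      qed (use l in simp)
      then have "ennreal (D n \<omega>) \<le> ennreal (min l (D n \<omega>) + 1/l * (D n \<omega>)\<^sup>2)" by (rule ennreal_leI)
      also have "\<dots> = ennreal (min l (D n \<omega>)) + ennreal (1/l) * ennreal ((D n \<omega>)\<^sup>2)"
        using l nonneg[of n \<omega>] by (simp flip: ennreal_plus ennreal_mult)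
      finally show "ennreal (D n \<omega>) \<le> ennreal (min l (D n \<omega>)) + ennreal (1/l) * ennreal ((D n \<omega>)\<^sup>2)" .
    qed
    also have "\<dots> = (\<integral>\<^sup>+\<omega>. ennreal (min l (D n \<omega>)) \<partial>M) + ennreal (1/l) * (\<integral>\<^sup>+\<omega>. ennreal ((D n \<omega>)\<^sup>2) \<partial>M)"
      by (simp add: nn_integral_add nn_integral_cmult)
    also have "\<dots> \<le> ennreal (expectation (\<lambda>\<omega>. min l (D n \<omega>))) + ennreal (1/l) * ennreal \<bar>K\<bar>"
      using l nonneg bound[of n]
      by (intro add_mono mult_left_mono) (auto simp: nn_integral_eq_integral[OF int] intro: order_trans ennreal_leI)
    also have "\<dots> = ennreal (expectation (\<lambda>\<omega>. min l (D n \<omega>)) + 1/l * \<bar>K\<bar>)"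
      using l nonneg by (simp flip: ennreal_plus ennreal_mult)
    also have "\<dots> < ennreal e"
    proof (rule ennreal_lessI[OF e(2)])
      have "1/l * \<bar>K\<bar> = e/2 * (\<bar>K\<bar> / (\<bar>K\<bar> + 1))" using e by (simp add: l_def field_simps)
      also have "\<dots> \<le> e/2 * 1" using e by (intro mult_left_mono) auto
      finally show "expectation (\<lambda>\<omega>. min l (D n \<omega>)) + 1/l * \<bar>K\<bar> < e" using elim by linarith
    qed
    finally show ?case using b e by simp
  qed
qed simp

lemma (in prob_space) nn_integral_le_of_sq:
  fixes f :: "'a \<Rightarrow> real"
  assumes [measurable]: "f \<in> borel_measurable M" and "(\<integral>\<^sup>+\<omega>. ennreal ((f \<omega>)\<^sup>2) \<partial>M) \<le> ennreal K"
  shows "(\<integral>\<^sup>+\<omega>. ennreal (f \<omega>) \<partial>M) \<le> 1 + ennreal K"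
proof -
  have "(\<integral>\<^sup>+\<omega>. ennreal (f \<omega>) \<partial>M) \<le> (\<integral>\<^sup>+\<omega>. 1 + ennreal ((f \<omega>)\<^sup>2) \<partial>M)"
  proof (rule nn_integral_mono)
    fix \<omega>
    have "f \<omega> \<le> 1 + (f \<omega>)\<^sup>2" using zero_le_power2[of "f \<omega> - 1/2"] by (simp add: power2_eq_square algebra_simps)
    then have "ennreal (f \<omega>) \<le> ennreal (1 + (f \<omega>)\<^sup>2)" by (rule ennreal_leI)
    then show "ennreal (f \<omega>) \<le> 1 + ennreal ((f \<omega>)\<^sup>2)" by (simp add: ennreal_plus)
  qed
  also have "\<dots> = 1 + (\<integral>\<^sup>+\<omega>. ennreal ((f \<omega>)\<^sup>2) \<partial>M)"
    by (subst nn_integral_add) (auto simp: emeasure_space_1)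
  also have "\<dots> \<le> 1 + ennreal K" by (intro add_left_mono assms)
  finally show ?thesis .
qed

text \<open>The rates are summable, as Borel-Cantelli requires, and one sequence works for every t
  in [0, T], so the approximants can be treated as functions of time and path together. The
  exceptional null sets may still depend on t.\<close>

locale levy_convolution_mesh = levy_convolution M Z R T
  for M :: "'w measure" and Z :: "real \<Rightarrow> 'w \<Rightarrow> 'h::{real_inner, banach, second_countable_topology}"
    and R :: "real \<Rightarrow> 'h \<Rightarrow> 'h" and T :: real +
  fixes \<delta> :: "nat \<Rightarrow> real"
  assumes \<delta>_pos: "0 < \<delta> k" and \<delta>_le_1: "\<delta> k \<le> 1" and \<delta>_lim: "\<delta> \<longlonglongrightarrow> 0"
    and \<delta>_fast: "t \<in> {0..T} \<Longrightarrow>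
      prob {\<omega>\<in>space M. norm (conv_approx (\<delta> k) t \<omega> - conv_approx (\<delta> (Suc k)) t \<omega>) > (1/2)^k} < (1/2)^k"

lemma (in levy_convolution) mesh_exists: "\<exists>\<delta>. levy_convolution_mesh M Z R T \<delta>"
proof -
  have ex: "\<forall>k. \<exists>d0>0. \<forall>t\<in>{0..T}. \<forall>d d'. 0 < d \<longrightarrow> d < d0 \<longrightarrow> 0 < d' \<longrightarrow> d' < d0 \<longrightarrow>
    prob {\<omega>\<in>space M. norm (conv_approx d t \<omega> - conv_approx d' t \<omega>) > (1/2)^k} < (1/2)^k"
    by (intro allI conv_approx_cauchy) simp
  from choice[OF ex] obtain D where D0: "\<forall>k. D k > 0 \<and> (\<forall>t\<in>{0..T}. \<forall>d d'. 0 < d \<longrightarrow> d < D k \<longrightarrow>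
    0 < d' \<longrightarrow> d' < D k \<longrightarrow> prob {\<omega>\<in>space M. norm (conv_approx d t \<omega> - conv_approx d' t \<omega>) > (1/2)^k} < (1/2)^k)"
    by (elim exE)
  note D = D0[THEN spec, THEN conjunct1] D0[THEN spec, THEN conjunct2, rule_format]
  \<comment> \<open>The minimum over all indices up to k puts both \<delta> k and its successor
    below D k. Halving makes this strict, and 1 / (k + 1) forces the limit 0.\<close>
  define \<delta> where "\<delta> = (\<lambda>k::nat. Min (insert (1 / real (Suc k)) (D ` {..k})) / 2)"
  have pos: "0 < \<delta> k" for k using D(1) by (auto simp: \<delta>_def)
  have le: "\<delta> k \<le> 1 / real (Suc k)" for k
  proof -
    have "Min (insert (1 / real (Suc k)) (D ` {..k})) \<le> 1 / real (Suc k)" by (rule Min_le) auto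
    then show ?thesis using pos[of k] unfolding \<delta>_def by linarith
  qed
  have less: "\<delta> k < D i" if "i \<le> k" for i k
  proof -
    have "Min (insert (1 / real (Suc k)) (D ` {..k})) \<le> D i" using that by (intro Min_le) auto
    then show ?thesis using pos[of k] D(1)[of i] unfolding \<delta>_def by linarith
  qed
  have lim: "\<delta> \<longlonglongrightarrow> 0"
  proof (rule tendsto_sandwich[of "\<lambda>_. 0" \<delta> sequentially "\<lambda>k. 1 / real (Suc k)"])
    show "(\<lambda>k. 1 / real (Suc k)) \<longlonglongrightarrow> 0"
      using LIMSEQ_inverse_real_of_nat by (simp add: inverse_eq_divide)
  qed (use pos le in \<open>auto intro!: always_eventually less_imp_le simp del: of_nat_Suc\<close>)
  have le_1: "\<delta> k \<le> 1" for k using le[of k] by (rule order_trans) simp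
  show ?thesis
    by (intro exI[of _ \<delta>] levy_convolution_mesh.intro levy_convolution_mesh_axioms.intro levy_convolution_axioms
        pos le_1 lim D(2) less) simp_all
qed

context levy_convolution_mesh
begin

text \<open>Local boundedness upgrades strong continuity to joint continuity in time and vector.
  \<open>R\<close> is specified for nonnegative times only, so \<open>max 0\<close> extends it by
  its value at 0.\<close>

lemma R_jointly_measurable:
  "(\<lambda>p. R (max 0 (fst p)) (snd p)) \<in> borel_measurable (borel :: (real \<times> 'h) measure)"
proof (intro borel_measurable_continuous_onI)
  have "((\<lambda>p. R (max 0 (fst p)) (snd p)) \<longlongrightarrow> R (max 0 r) x) (at (r, x))" for r x
  proof -
    define S where "S = max 0 r + 1"
    obtain C where C: "\<forall>s\<in>{0..S}. \<forall>x. norm (R s x) \<le> C * norm x"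
      using R_bounded[of S] by (auto simp: S_def)
    have "\<forall>\<^sub>F p in at (r, x). fst p < r + 1"
      by (intro order_tendstoD(2)[OF tendsto_fst[OF tendsto_ident_at]]) simp
    then have ev: "\<forall>\<^sub>F p in at (r, x). norm (R (max 0 (fst p)) (snd p) - R (max 0 r) x)
        \<le> \<bar>C\<bar> * norm (snd p - x) + norm (R (max 0 (fst p)) x - R (max 0 r) x)"
    proof eventually_elim
      case (elim p)
      then have p: "max 0 (fst p) \<in> {0..S}" by (auto simp: S_def)
      interpret Rp: bounded_linear "R (max 0 (fst p))" by (intro R_linear) simp
      have eq: "R (max 0 (fst p)) (snd p) - R (max 0 r) x = R (max 0 (fst p)) (snd p - x) + (R (max 0 (fst p)) x - R (max 0 r) x)"
        by (simp add: Rp.diff)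
      have "norm (R (max 0 (fst p)) (snd p - x)) \<le> \<bar>C\<bar> * norm (snd p - x)"
        using C p by (meson abs_ge_self mult_right_mono norm_ge_zero order_trans)
      then show ?case unfolding eq
        using norm_triangle_ineq[of "R (max 0 (fst p)) (snd p - x)" "R (max 0 (fst p)) x - R (max 0 r) x"] by linarith
    qed
    have lim: "((\<lambda>p. \<bar>C\<bar> * norm (snd p - x) + norm (R (max 0 (fst p)) x - R (max 0 r) x)) \<longlongrightarrow>
        \<bar>C\<bar> * norm (x - x) + norm (R (max 0 r) x - R (max 0 r) x)) (at (r, x))"
    proof (intro tendsto_intros)
      show "(snd \<longlongrightarrow> x) (at (r, x))" using tendsto_snd[OF tendsto_ident_at[of "(r, x)" UNIV]] by simp
      have "continuous_on UNIV (\<lambda>s. R (max 0 s) x)"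
        by (rule continuous_on_compose2[OF R_continuous[of x]]) (auto intro!: continuous_intros)
      then have "isCont (\<lambda>s. R (max 0 s) x) r" by (simp add: continuous_on_eq_continuous_at)
      then show "((\<lambda>p. R (max 0 (fst p)) x) \<longlongrightarrow> R (max 0 r) x) (at (r, x))"
        using isCont_tendsto_compose[of r "\<lambda>s. R (max 0 s) x" fst] tendsto_fst[OF tendsto_ident_at[of "(r, x)" UNIV]] by simp
    qed
    have "\<bar>C\<bar> * norm (x - x) + norm (R (max 0 r) x - R (max 0 r) x) = 0" by simp
    then have "((\<lambda>p. R (max 0 (fst p)) (snd p) - R (max 0 r) x) \<longlongrightarrow> 0) (at (r, x))"
      using Lim_null_comparison[OF ev] lim by simp
    then show ?thesis by (simp add: LIM_zero_iff)
  qed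
  then show "continuous_on UNIV (\<lambda>p. R (max 0 (fst p)) (snd p))"
    by (auto simp: continuous_on_def)
qed

text \<open>For times up to T this is \<open>conv_approx\<close>, with the number of summands fixed
  by T and the condition on t moved inside the sum; each summand is then jointly measurable in t and
  \<omega>.\<close>

definition joint_approx :: "real \<Rightarrow> real \<Rightarrow> 'w \<Rightarrow> 'h" where
  "joint_approx d t \<omega> = (\<Sum>j<nat \<lceil>T / d\<rceil>. if real j * d < t
     then R (max 0 (t - real j * d)) (Z (real (Suc j) * d) \<omega> - Z (real j * d) \<omega>) else 0)"

lemma joint_approx_eq:
  assumes "0 < d" "t \<le> T"
  shows "joint_approx d t \<omega> = conv_approx d t \<omega>"
proof -
  have "j < nat \<lceil>T / d\<rceil>" if "real j * d < t" for j
    using that assms less_nat_ceiling_divide_iff[of d j T] by simp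
  then have "{..<nat \<lceil>T / d\<rceil>} \<inter> {j. real j * d < t} = {..<nat \<lceil>t / d\<rceil>}"
    using less_nat_ceiling_divide_iff[OF assms(1), of _ t] by auto
  then have "joint_approx d t \<omega> = (\<Sum>j<nat \<lceil>t / d\<rceil>. R (max 0 (t - real j * d)) (Z (real (Suc j) * d) \<omega> - Z (real j * d) \<omega>))"
    unfolding joint_approx_def by (simp add: sum.If_cases)
  also have "\<dots> = conv_approx d t \<omega>"
    unfolding conv_approx_def using less_nat_ceiling_divide_iff[OF assms(1), of _ t]
    by (intro sum.cong refl) (simp add: max_def)
  finally show ?thesis .
qed

lemma joint_approx_measurable [measurable]:
  assumes "0 < d"
  shows "(\<lambda>(t, \<omega>). joint_approx d t \<omega>) \<in> borel_measurable (lborel \<Otimes>\<^sub>M M)"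
  unfolding joint_approx_def split_beta'
proof (rule borel_measurable_sum)
  fix j :: nat
  have [measurable]: "Z (real (Suc j) * d) \<in> borel_measurable M" "Z (real j * d) \<in> borel_measurable M"
    using assms by (auto intro!: measurable_W)
  have "(\<lambda>p. (fst p - real j * d, Z (real (Suc j) * d) (snd p) - Z (real j * d) (snd p))) \<in> lborel \<Otimes>\<^sub>M M \<rightarrow>\<^sub>M borel"
    unfolding borel_prod[symmetric] by measurable
  from measurable_compose[OF this R_jointly_measurable]
  have [measurable]: "(\<lambda>p. R (max 0 (fst p - real j * d)) (Z (real (Suc j) * d) (snd p) - Z (real j * d) (snd p))) \<in> borel_measurable (lborel \<Otimes>\<^sub>M M)"
    by simp
  show "(\<lambda>p. if real j * d < fst p then R (max 0 (fst p - real j * d)) (Z (real (Suc j) * d) (snd p) - Z (real j * d) (snd p)) else 0)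
      \<in> borel_measurable (lborel \<Otimes>\<^sub>M M)"
    by measurable
qed

text \<open>Where the sequence diverges, \<open>lim\<close> takes one fixed arbitrary value, so the
  limit is defined and jointly measurable before convergence is known.\<close>

definition conv_lim :: "real \<Rightarrow> 'w \<Rightarrow> 'h" where
  "conv_lim t \<omega> = lim (\<lambda>k. joint_approx (\<delta> k) t \<omega>)"

lemma conv_lim_measurable [measurable]: "(\<lambda>(t, \<omega>). conv_lim t \<omega>) \<in> borel_measurable (lborel \<Otimes>\<^sub>M M)"
proof -
  have "(\<lambda>p. lim (\<lambda>k. (\<lambda>(t, \<omega>). joint_approx (\<delta> k) t \<omega>) p)) \<in> borel_measurable (lborel \<Otimes>\<^sub>M M)"
    using joint_approx_measurable[OF \<delta>_pos] by (rule borel_measurable_lim_metric)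
  then show ?thesis by (simp add: conv_lim_def split_beta')
qed

lemma conv_lim_measurable_fixed: "conv_lim t \<in> borel_measurable M"
  using measurable_compose[OF measurable_Pair1' conv_lim_measurable, of t] by simp

text \<open>By Borel-Cantelli, consecutive approximants eventually differ by at most (1/2)^k; the
  differences are then summable and completeness yields the limit.\<close>

lemma joint_approx_tendsto:
  assumes t: "t \<in> {0..T}"
  shows "AE \<omega> in M. (\<lambda>k. joint_approx (\<delta> k) t \<omega>) \<longlonglongrightarrow> conv_lim t \<omega>"
proof -
  define V where "V = (\<lambda>k \<omega>. joint_approx (\<delta> k) t \<omega>)"
  have V: "V k = conv_approx (\<delta> k) t" for k using t \<delta>_pos by (auto simp: V_def joint_approx_eq)
  have [measurable]: "V k \<in> borel_measurable M" for k unfolding V by (rule conv_approx_measurable[OF \<delta>_pos])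
  define A where "A = (\<lambda>k. {\<omega>\<in>space M. norm (V k \<omega> - V (Suc k) \<omega>) > (1/2)^k})"
  have "AE \<omega> in M. \<forall>\<^sub>F k in sequentially. \<omega> \<in> space M - A k"
  proof (rule borel_cantelli_AE1)
    show "A k \<in> sets M" for k by (simp add: A_def)
    show "emeasure M (A k) < \<infinity>" for k by (simp add: less_top[symmetric])
    show "summable (\<lambda>k. measure M (A k))"
    proof (rule summable_comparison_test[where g="\<lambda>k. (1/2)^k :: real"])
      show "\<exists>N. \<forall>n\<ge>N. norm (measure M (A n)) \<le> (1/2)^n"
        using \<delta>_fast[OF t] by (auto simp: A_def V intro!: exI[of _ 0] less_imp_le)
    qed (rule summable_geometric, simp)
  qed
  then show ?thesis
  proof eventually_elim
    case (elim \<omega>)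
    have "summable (\<lambda>k. V (Suc k) \<omega> - V k \<omega>)"
    proof (rule summable_comparison_test_ev[where g="\<lambda>k. (1/2)^k :: real"])
      show "\<forall>\<^sub>F k in sequentially. norm (V (Suc k) \<omega> - V k \<omega>) \<le> (1/2)^k"
        using elim by eventually_elim (auto simp: A_def norm_minus_commute)
    qed (rule summable_geometric, simp)
    then have "convergent (\<lambda>n. \<Sum>k<n. V (Suc k) \<omega> - V k \<omega>)" by (simp add: summable_iff_convergent)
    then have "convergent (\<lambda>n. V n \<omega> - V 0 \<omega>)" by (simp only: sum_lessThan_telescope[of "\<lambda>k. V k \<omega>"])
    then have "convergent (\<lambda>n. V 0 \<omega> + (V n \<omega> - V 0 \<omega>))" by (intro convergent_add convergent_const)
    then have "convergent (\<lambda>n. V n \<omega>)" by simp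
    then show ?case by (simp add: convergent_LIMSEQ_iff conv_lim_def V_def)
  qed
qed

text \<open>Every sum of mesh below d0 is close to one fixed approximant, which is close to its
  almost sure limit. Admitting any almost sure modification leaves room for redefining the process
  on a null set.\<close>

lemma is_stoch_conv_version:
  assumes t: "t \<in> {0..T}" and YM: "Y \<in> borel_measurable M" and Y: "AE \<omega> in M. Y \<omega> = conv_lim t \<omega>"
  shows "is_stoch_conv M R Z t Y"
  unfolding is_stoch_conv_def
proof (intro conjI allI impI YM)
  fix e :: real assume e: "0 < e"
  then have e2: "0 < e/2" by simp
  from conv_approx_close[OF e2] obtain d0 where d00: "d0 > 0 \<and> (\<forall>t\<in>{0..T}. \<forall>d n \<sigma> \<rho>. 0 < d \<longrightarrow> d < d0 \<longrightarrow> forward_grid t d0 n \<sigma> \<rho> \<longrightarrow>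
    prob {\<omega>\<in>space M. norm (grid_sum n \<sigma> \<rho> \<omega> - conv_approx d t \<omega>) > e/2} < e/2)"
    by (elim exE)
  note d0 = d00[THEN conjunct1] d00[THEN conjunct2, rule_format]
  note [measurable] = YM conv_approx_measurable[OF \<delta>_pos]
  have AEc: "AE \<omega> in M. (\<lambda>k. conv_approx (\<delta> k) t \<omega>) \<longlonglongrightarrow> Y \<omega>"
    using joint_approx_tendsto[OF t] Y by eventually_elim (use t \<delta>_pos in \<open>simp add: joint_approx_eq\<close>)
  have "(\<lambda>k. expectation (\<lambda>\<omega>. min 1 (norm (conv_approx (\<delta> k) t \<omega> - Y \<omega>)))) \<longlonglongrightarrow> expectation (\<lambda>\<omega>. 0)"
  proof (rule integral_dominated_convergence[where w="\<lambda>_. 1"])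
    show "AE \<omega> in M. (\<lambda>k. min 1 (norm (conv_approx (\<delta> k) t \<omega> - Y \<omega>))) \<longlonglongrightarrow> 0"
      using AEc
    proof eventually_elim
      case (elim \<omega>)
      have "(\<lambda>k. norm (conv_approx (\<delta> k) t \<omega> - Y \<omega>)) \<longlonglongrightarrow> 0"
        using elim by (intro tendsto_norm_zero) (simp add: LIM_zero)
      from tendsto_min[OF tendsto_const[of 1] this] show ?case by simp
    qed
  qed auto
  \<comment> \<open>Markov's inequality at level \<open>min 1 (e/2)\<close> divides by that level,
    hence the product.\<close>
  then have "\<forall>\<^sub>F k in sequentially. expectation (\<lambda>\<omega>. min 1 (norm (conv_approx (\<delta> k) t \<omega> - Y \<omega>))) < min 1 (e/2) * (e/2)"
    using e by (intro order_tendstoD(2)) auto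
  moreover have "\<forall>\<^sub>F k in sequentially. \<delta> k < d0" using \<delta>_lim d0(1) by (rule order_tendstoD(2))
  ultimately have "\<forall>\<^sub>F k in sequentially. \<delta> k < d0 \<and> expectation (\<lambda>\<omega>. min 1 (norm (conv_approx (\<delta> k) t \<omega> - Y \<omega>))) < min 1 (e/2) * (e/2)"
    by eventually_elim simp
  then obtain k where k: "\<delta> k < d0" "expectation (\<lambda>\<omega>. min 1 (norm (conv_approx (\<delta> k) t \<omega> - Y \<omega>))) < min 1 (e/2) * (e/2)"
    using eventually_happens'[OF sequentially_bot] by blast
  have pk: "prob {\<omega>\<in>space M. norm (conv_approx (\<delta> k) t \<omega> - Y \<omega>) > e/2} < e/2"
  proof -
    have int: "integrable M (\<lambda>\<omega>. min 1 (norm (conv_approx (\<delta> k) t \<omega> - Y \<omega>)))"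
      by (intro integrable_bounded[where c=1]) auto
    have "prob {\<omega>\<in>space M. norm (conv_approx (\<delta> k) t \<omega> - Y \<omega>) > e/2}
        \<le> prob {\<omega>\<in>space M. min 1 (e/2) \<le> min 1 (norm (conv_approx (\<delta> k) t \<omega> - Y \<omega>))}"
      by (intro finite_measure_mono) auto
    also have "\<dots> \<le> expectation (\<lambda>\<omega>. min 1 (norm (conv_approx (\<delta> k) t \<omega> - Y \<omega>))) / min 1 (e/2)"
      using e by (intro integral_Markov_inequality_measure[OF int, where A="{}"]) auto
    also have "\<dots> < e/2" using k(2) e by (simp add: pos_divide_less_eq mult.commute)
    finally show ?thesis .
  qed
  show "\<exists>d>0. \<forall>n tt s. tagged_partition t n tt s \<and> (\<forall>i<n. tt (Suc i) - tt i < d) \<longrightarrow>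
    prob {\<omega>\<in>space M. norm (conv_sum R Z t n tt s \<omega> - Y \<omega>) > e} < e"
  proof (intro exI[of _ d0] conjI d0(1) allI impI)
    fix n tt s assume "tagged_partition t n tt s \<and> (\<forall>i<n. tt (Suc i) - tt i < d0)"
    then have tp: "tagged_partition t n tt s" and mesh: "\<And>i. i < n \<Longrightarrow> tt (Suc i) - tt i < d0" by auto
    have g: "forward_grid t d0 n (\<lambda>i. t - tt (n - i)) (\<lambda>i. s (n - i))"
      using tp mesh by (rule tagged_partition_forward_grid(1))
    have S_eq: "conv_sum R Z t n tt s = (\<lambda>\<omega>. \<Sum>i<n. R (s (n - i)) (Z (t - tt (n - Suc i)) \<omega> - Z (t - tt (n - i)) \<omega>))"
      using tp mesh by (intro ext tagged_partition_forward_grid(2))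
    define S where "S = conv_sum R Z t n tt s"
    have pS: "prob {\<omega>\<in>space M. norm (S \<omega> - conv_approx (\<delta> k) t \<omega>) > e/2} < e/2"
      unfolding S_def S_eq by (rule d0(2)[OF t \<delta>_pos k(1) g])
    have [measurable]: "S \<in> borel_measurable M"
      unfolding S_def S_eq by (rule forward_grid_sum_measurable[OF g])
    have "prob {\<omega>\<in>space M. norm ((S \<omega> - conv_approx (\<delta> k) t \<omega>) + (conv_approx (\<delta> k) t \<omega> - Y \<omega>)) > e} < e"
      using pS pk by (intro prob_norm_add_less) simp_all
    then show "prob {\<omega>\<in>space M. norm (conv_sum R Z t n tt s \<omega> - Y \<omega>) > e} < e" by (simp add: S_def)
  qed
qed

lemma joint_approx_measurable_fixed: "joint_approx (\<delta> n) t \<in> borel_measurable M"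
  using measurable_compose[OF measurable_Pair1' joint_approx_measurable[OF \<delta>_pos], of t] by simp

text \<open>Fatou's lemma carries the uniform bound for the approximants on the event over to the
  limit; the squared difference costs 2 |K| + 2 |K|.\<close>

lemma error_second_moment:
  assumes "\<And>d t. 0 < d \<Longrightarrow> d \<le> 1 \<Longrightarrow> t \<in> {0..T} \<Longrightarrow>
      (\<integral>\<^sup>+\<omega>. indicator A \<omega> * ennreal ((norm (conv_approx d t \<omega>))\<^sup>2) \<partial>M) \<le> ennreal K"
    and [measurable]: "A \<in> sets M" and t: "t \<in> {0..T}"
  shows "(\<integral>\<^sup>+\<omega>. ennreal ((indicator A \<omega> * norm (conv_lim t \<omega>))\<^sup>2) \<partial>M) \<le> ennreal (4 * \<bar>K\<bar>)"
    and "(\<integral>\<^sup>+\<omega>. ennreal ((indicator A \<omega> * norm (joint_approx (\<delta> n) t \<omega> - conv_lim t \<omega>))\<^sup>2) \<partial>M) \<le> ennreal (4 * \<bar>K\<bar>)"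
proof -
  note [measurable] = joint_approx_measurable_fixed conv_lim_measurable_fixed
  have V: "(\<integral>\<^sup>+\<omega>. ennreal ((indicator A \<omega> * norm (joint_approx (\<delta> n) t \<omega>))\<^sup>2) \<partial>M) \<le> ennreal \<bar>K\<bar>" for n
  proof -
    have "(\<integral>\<^sup>+\<omega>. ennreal ((indicator A \<omega> * norm (joint_approx (\<delta> n) t \<omega>))\<^sup>2) \<partial>M)
        = (\<integral>\<^sup>+\<omega>. indicator A \<omega> * ennreal ((norm (conv_approx (\<delta> n) t \<omega>))\<^sup>2) \<partial>M)"
      using t \<delta>_pos by (intro nn_integral_cong) (auto simp: joint_approx_eq split: split_indicator)
    also have "\<dots> \<le> ennreal K" using assms(1) \<delta>_pos \<delta>_le_1 t by blast
    also have "\<dots> \<le> ennreal \<bar>K\<bar>" by (intro ennreal_leI) simp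
    finally show ?thesis .
  qed
  have L: "(\<integral>\<^sup>+\<omega>. ennreal ((indicator A \<omega> * norm (conv_lim t \<omega>))\<^sup>2) \<partial>M) \<le> ennreal \<bar>K\<bar>"
  proof -
    have "(\<integral>\<^sup>+\<omega>. ennreal ((indicator A \<omega> * norm (conv_lim t \<omega>))\<^sup>2) \<partial>M)
        = (\<integral>\<^sup>+\<omega>. liminf (\<lambda>n. ennreal ((indicator A \<omega> * norm (joint_approx (\<delta> n) t \<omega>))\<^sup>2)) \<partial>M)"
    proof (intro nn_integral_cong_AE)
      show "AE \<omega> in M. ennreal ((indicator A \<omega> * norm (conv_lim t \<omega>))\<^sup>2)
          = liminf (\<lambda>n. ennreal ((indicator A \<omega> * norm (joint_approx (\<delta> n) t \<omega>))\<^sup>2))"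
        using joint_approx_tendsto[OF t]
      proof eventually_elim
        case (elim \<omega>)
        have "(\<lambda>n. ennreal ((indicator A \<omega> * norm (joint_approx (\<delta> n) t \<omega>))\<^sup>2)) \<longlonglongrightarrow> ennreal ((indicator A \<omega> * norm (conv_lim t \<omega>))\<^sup>2)"
          by (intro tendsto_intros elim tendsto_ennrealI)
        then show ?case by (rule lim_imp_Liminf[OF sequentially_bot, symmetric])
      qed
    qed
    also have "\<dots> \<le> liminf (\<lambda>n. \<integral>\<^sup>+\<omega>. ennreal ((indicator A \<omega> * norm (joint_approx (\<delta> n) t \<omega>))\<^sup>2) \<partial>M)"
      by (intro nn_integral_liminf) measurable
    also have "\<dots> \<le> liminf (\<lambda>n. ennreal \<bar>K\<bar>)"
      by (intro Liminf_mono always_eventually allI V)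
    also have "\<dots> = ennreal \<bar>K\<bar>" by (simp add: Liminf_const)
    finally show ?thesis .
  qed
  have "ennreal \<bar>K\<bar> \<le> ennreal (4 * \<bar>K\<bar>)" by (intro ennreal_leI) simp
  with L show "(\<integral>\<^sup>+\<omega>. ennreal ((indicator A \<omega> * norm (conv_lim t \<omega>))\<^sup>2) \<partial>M) \<le> ennreal (4 * \<bar>K\<bar>)"
    by (rule order_trans)
  have "(\<integral>\<^sup>+\<omega>. ennreal ((indicator A \<omega> * norm (joint_approx (\<delta> n) t \<omega> - conv_lim t \<omega>))\<^sup>2) \<partial>M)
    \<le> (\<integral>\<^sup>+\<omega>. ennreal 2 * ennreal ((indicator A \<omega> * norm (joint_approx (\<delta> n) t \<omega>))\<^sup>2)
        + ennreal 2 * ennreal ((indicator A \<omega> * norm (conv_lim t \<omega>))\<^sup>2) \<partial>M)"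
  proof (rule nn_integral_mono)
    fix \<omega>
    let ?a = "indicator A \<omega> * norm (joint_approx (\<delta> n) t \<omega>)" and ?b = "indicator A \<omega> * norm (conv_lim t \<omega>)"
    have "(indicator A \<omega> * norm (joint_approx (\<delta> n) t \<omega> - conv_lim t \<omega>))\<^sup>2 \<le> (?a + ?b)\<^sup>2"
      by (intro power_mono) (auto split: split_indicator intro: norm_triangle_ineq4)
    also have "\<dots> \<le> 2 * ?a\<^sup>2 + 2 * ?b\<^sup>2"
      using zero_le_power2[of "?a - ?b"] by (simp add: power2_eq_square algebra_simps)
    finally have "ennreal ((indicator A \<omega> * norm (joint_approx (\<delta> n) t \<omega> - conv_lim t \<omega>))\<^sup>2) \<le> ennreal (2 * ?a\<^sup>2 + 2 * ?b\<^sup>2)"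
      by (rule ennreal_leI)
    also have "\<dots> = ennreal 2 * ennreal (?a\<^sup>2) + ennreal 2 * ennreal (?b\<^sup>2)"
      by (simp flip: ennreal_plus ennreal_mult del: ennreal_numeral)
    finally show "ennreal ((indicator A \<omega> * norm (joint_approx (\<delta> n) t \<omega> - conv_lim t \<omega>))\<^sup>2)
      \<le> ennreal 2 * ennreal (?a\<^sup>2) + ennreal 2 * ennreal (?b\<^sup>2)" .
  qed
  also have "\<dots> = ennreal 2 * (\<integral>\<^sup>+\<omega>. ennreal ((indicator A \<omega> * norm (joint_approx (\<delta> n) t \<omega>))\<^sup>2) \<partial>M)
        + ennreal 2 * (\<integral>\<^sup>+\<omega>. ennreal ((indicator A \<omega> * norm (conv_lim t \<omega>))\<^sup>2) \<partial>M)"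
    by (subst nn_integral_add) (auto simp: nn_integral_cmult simp del: ennreal_numeral)
  also have "\<dots> \<le> ennreal 2 * ennreal \<bar>K\<bar> + ennreal 2 * ennreal \<bar>K\<bar>"
    by (intro add_mono mult_left_mono V L) auto
  also have "\<dots> = ennreal (4 * \<bar>K\<bar>)"
    by (simp flip: ennreal_plus ennreal_mult del: ennreal_numeral)
  finally show "(\<integral>\<^sup>+\<omega>. ennreal ((indicator A \<omega> * norm (joint_approx (\<delta> n) t \<omega> - conv_lim t \<omega>))\<^sup>2) \<partial>M) \<le> ennreal (4 * \<bar>K\<bar>)" .
qed

text \<open>Tonelli turns the expected path integral into a time integral of first moments, which
  are uniformly bounded on each event of bounded paths; dominated convergence in \<tau> makes the
  expected error vanish. Fatou then yields a zero liminf for almost every path, and this is enough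
  for a limit passage. The weight g will be both a multiple of |\<alpha> t| and the indicator of
  [0, T].\<close>

lemma weighted_path_bounds:
  fixes g :: "real \<Rightarrow> real"
  assumes [measurable]: "g \<in> borel_measurable borel" and fin: "(\<integral>\<^sup>+\<tau>. ennreal (g \<tau>) \<partial>lborel) < \<infinity>"
    and supp: "\<And>\<tau>. \<tau> \<notin> {0..T} \<Longrightarrow> g \<tau> = 0"
  shows "AE \<omega> in M. (\<integral>\<^sup>+\<tau>. ennreal (g \<tau>) * ennreal (norm (conv_lim \<tau> \<omega>)) \<partial>lborel) < \<infinity> \<and>
    liminf (\<lambda>n. \<integral>\<^sup>+\<tau>. ennreal (g \<tau>) * ennreal (norm (joint_approx (\<delta> n) \<tau> \<omega> - conv_lim \<tau> \<omega>)) \<partial>lborel) = 0"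
proof -
  interpret P: pair_sigma_finite lborel M ..
  note [measurable] = joint_approx_measurable_fixed conv_lim_measurable_fixed
  note Jm [measurable] = joint_approx_measurable[OF \<delta>_pos]
  obtain k0 where k0: "\<And>k. k \<ge> k0 \<Longrightarrow> \<exists>K. \<forall>d t. 0 < d \<longrightarrow> d \<le> 1 \<longrightarrow> t \<in> {0..T} \<longrightarrow>
    (\<integral>\<^sup>+\<omega>. indicator (bounded_path_event k) \<omega> * ennreal ((norm (conv_approx d t \<omega>))\<^sup>2) \<partial>M) \<le> ennreal K"
    using conv_approx_second_moment by blast
  have "AE \<omega> in M. (\<integral>\<^sup>+\<tau>. ennreal (g \<tau>) * ennreal (indicator (bounded_path_event k) \<omega> * norm (conv_lim \<tau> \<omega>)) \<partial>lborel) < \<infinity> \<and>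
    liminf (\<lambda>n. \<integral>\<^sup>+\<tau>. ennreal (g \<tau>) * ennreal (indicator (bounded_path_event k) \<omega> * norm (joint_approx (\<delta> n) \<tau> \<omega> - conv_lim \<tau> \<omega>)) \<partial>lborel) = 0"
    if k: "k \<ge> k0" for k
  proof -
    define A where "A = bounded_path_event k"
    have [measurable]: "A \<in> sets M" by (simp add: A_def bounded_path_event_sets)
    obtain K where K: "\<And>d t. 0 < d \<Longrightarrow> d \<le> 1 \<Longrightarrow> t \<in> {0..T} \<Longrightarrow>
      (\<integral>\<^sup>+\<omega>. indicator A \<omega> * ennreal ((norm (conv_approx d t \<omega>))\<^sup>2) \<partial>M) \<le> ennreal K"
      using k0[OF k] unfolding A_def by blast
    define f where "f = (\<lambda>\<tau> \<omega>. indicator A \<omega> * norm (conv_lim \<tau> \<omega>))"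
    define D where "D = (\<lambda>n \<tau> \<omega>. indicator A \<omega> * norm (joint_approx (\<delta> n) \<tau> \<omega> - conv_lim \<tau> \<omega>))"
    define c where "c = 1 + ennreal (4 * \<bar>K\<bar>)"
    have c: "c < \<infinity>" by (simp add: c_def)
    have fm [measurable]: "(\<lambda>(\<tau>, \<omega>). f \<tau> \<omega>) \<in> borel_measurable (lborel \<Otimes>\<^sub>M M)" unfolding f_def by measurable
    have Dm [measurable]: "(\<lambda>(\<tau>, \<omega>). D n \<tau> \<omega>) \<in> borel_measurable (lborel \<Otimes>\<^sub>M M)" for n unfolding D_def by measurable
    have fm' [measurable]: "f \<tau> \<in> borel_measurable M" for \<tau> unfolding f_def by measurable
    have Dm' [measurable]: "D n \<tau> \<in> borel_measurable M" for n \<tau> unfolding D_def by measurable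
    have e1: "(\<integral>\<^sup>+\<omega>. ennreal (f \<tau> \<omega>) \<partial>M) \<le> c" and e2: "(\<integral>\<^sup>+\<omega>. ennreal (D n \<tau> \<omega>) \<partial>M) \<le> c" if "\<tau> \<in> {0..T}" for \<tau> n
      using error_second_moment[OF K _ that] unfolding c_def f_def D_def
      by (auto intro!: nn_integral_le_of_sq)
    have g1: "ennreal (g \<tau>) * (\<integral>\<^sup>+\<omega>. ennreal (f \<tau> \<omega>) \<partial>M) \<le> ennreal (g \<tau>) * c"
      and g2: "ennreal (g \<tau>) * (\<integral>\<^sup>+\<omega>. ennreal (D n \<tau> \<omega>) \<partial>M) \<le> ennreal (g \<tau>) * c" for \<tau> n
      using e1[of \<tau>] e2[of \<tau> n] supp[of \<tau>] by (cases "\<tau> \<in> {0..T}"; auto intro!: mult_left_mono)+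
    have gc: "(\<integral>\<^sup>+\<tau>. ennreal (g \<tau>) * c \<partial>lborel) < \<infinity>"
      using fin c by (simp add: nn_integral_multc ennreal_mult_less_top)
    have "(\<integral>\<^sup>+\<omega>. \<integral>\<^sup>+\<tau>. ennreal (g \<tau>) * ennreal (f \<tau> \<omega>) \<partial>lborel \<partial>M) = (\<integral>\<^sup>+\<tau>. \<integral>\<^sup>+\<omega>. ennreal (g \<tau>) * ennreal (f \<tau> \<omega>) \<partial>M \<partial>lborel)"
      by (rule P.Fubini') measurable
    also have "\<dots> = (\<integral>\<^sup>+\<tau>. ennreal (g \<tau>) * (\<integral>\<^sup>+\<omega>. ennreal (f \<tau> \<omega>) \<partial>M) \<partial>lborel)"
      by (intro nn_integral_cong nn_integral_cmult) measurable
    also have "\<dots> \<le> (\<integral>\<^sup>+\<tau>. ennreal (g \<tau>) * c \<partial>lborel)" by (intro nn_integral_mono g1)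
    finally have "(\<integral>\<^sup>+\<omega>. \<integral>\<^sup>+\<tau>. ennreal (g \<tau>) * ennreal (f \<tau> \<omega>) \<partial>lborel \<partial>M) \<noteq> \<infinity>" using gc by auto
    then have A1: "AE \<omega> in M. (\<integral>\<^sup>+\<tau>. ennreal (g \<tau>) * ennreal (f \<tau> \<omega>) \<partial>lborel) \<noteq> \<infinity>"
      by (intro nn_integral_noteq_infinite) measurable
    have lim_e: "(\<lambda>n. \<integral>\<^sup>+\<omega>. ennreal (D n \<tau> \<omega>) \<partial>M) \<longlonglongrightarrow> 0" if \<tau>: "\<tau> \<in> {0..T}" for \<tau>
    proof (rule tendsto_L1_of_L2_bounded)
      show "AE \<omega> in M. (\<lambda>n. D n \<tau> \<omega>) \<longlonglongrightarrow> 0"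
        using joint_approx_tendsto[OF \<tau>]
      proof eventually_elim
        case (elim \<omega>)
        have "(\<lambda>n. norm (joint_approx (\<delta> n) \<tau> \<omega> - conv_lim \<tau> \<omega>)) \<longlonglongrightarrow> 0"
          using elim by (intro tendsto_norm_zero) (simp add: LIM_zero)
        then show ?case unfolding D_def by (rule tendsto_mult_right_zero)
      qed
      show "(\<integral>\<^sup>+\<omega>. ennreal ((D n \<tau> \<omega>)\<^sup>2) \<partial>M) \<le> ennreal (4 * \<bar>K\<bar>)" for n
        unfolding D_def by (rule error_second_moment(2)[OF K _ \<tau>]) auto
    qed (auto simp: D_def)
    have "(\<lambda>n. \<integral>\<^sup>+\<tau>. ennreal (g \<tau>) * (\<integral>\<^sup>+\<omega>. ennreal (D n \<tau> \<omega>) \<partial>M) \<partial>lborel) \<longlonglongrightarrow> integral\<^sup>N lborel (\<lambda>_::real. 0)"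
    proof (rule nn_integral_dominated_convergence[where w="\<lambda>\<tau>. ennreal (g \<tau>) * c"])
      show "AE \<tau> in lborel. (\<lambda>n. ennreal (g \<tau>) * (\<integral>\<^sup>+\<omega>. ennreal (D n \<tau> \<omega>) \<partial>M)) \<longlonglongrightarrow> 0"
      proof (rule AE_I2)
        fix \<tau>
        show "(\<lambda>n. ennreal (g \<tau>) * (\<integral>\<^sup>+\<omega>. ennreal (D n \<tau> \<omega>) \<partial>M)) \<longlonglongrightarrow> 0"
        proof (cases "\<tau> \<in> {0..T}")
          case True
          from ennreal_tendsto_cmult[OF _ lim_e[OF True], of "ennreal (g \<tau>)"] show ?thesis by simp
        qed (simp add: supp)
      qed
    qed (use g2 gc in auto)
    moreover have "(\<integral>\<^sup>+\<omega>. \<integral>\<^sup>+\<tau>. ennreal (g \<tau>) * ennreal (D n \<tau> \<omega>) \<partial>lborel \<partial>M)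
        = (\<integral>\<^sup>+\<tau>. ennreal (g \<tau>) * (\<integral>\<^sup>+\<omega>. ennreal (D n \<tau> \<omega>) \<partial>M) \<partial>lborel)" for n
    proof -
      have "(\<integral>\<^sup>+\<omega>. \<integral>\<^sup>+\<tau>. ennreal (g \<tau>) * ennreal (D n \<tau> \<omega>) \<partial>lborel \<partial>M) = (\<integral>\<^sup>+\<tau>. \<integral>\<^sup>+\<omega>. ennreal (g \<tau>) * ennreal (D n \<tau> \<omega>) \<partial>M \<partial>lborel)"
        by (rule P.Fubini') measurable
      also have "\<dots> = (\<integral>\<^sup>+\<tau>. ennreal (g \<tau>) * (\<integral>\<^sup>+\<omega>. ennreal (D n \<tau> \<omega>) \<partial>M) \<partial>lborel)"
        by (intro nn_integral_cong nn_integral_cmult) measurable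
      finally show ?thesis .
    qed
    ultimately have "(\<lambda>n. \<integral>\<^sup>+\<omega>. \<integral>\<^sup>+\<tau>. ennreal (g \<tau>) * ennreal (D n \<tau> \<omega>) \<partial>lborel \<partial>M) \<longlonglongrightarrow> 0" by simp
    then have "liminf (\<lambda>n. \<integral>\<^sup>+\<omega>. \<integral>\<^sup>+\<tau>. ennreal (g \<tau>) * ennreal (D n \<tau> \<omega>) \<partial>lborel \<partial>M) = 0"
      by (rule lim_imp_Liminf[OF sequentially_bot])
    moreover have "(\<integral>\<^sup>+\<omega>. liminf (\<lambda>n. \<integral>\<^sup>+\<tau>. ennreal (g \<tau>) * ennreal (D n \<tau> \<omega>) \<partial>lborel) \<partial>M)
        \<le> liminf (\<lambda>n. \<integral>\<^sup>+\<omega>. \<integral>\<^sup>+\<tau>. ennreal (g \<tau>) * ennreal (D n \<tau> \<omega>) \<partial>lborel \<partial>M)"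
      by (rule nn_integral_liminf) measurable
    ultimately have "(\<integral>\<^sup>+\<omega>. liminf (\<lambda>n. \<integral>\<^sup>+\<tau>. ennreal (g \<tau>) * ennreal (D n \<tau> \<omega>) \<partial>lborel) \<partial>M) = 0" by simp
    then have A2: "AE \<omega> in M. liminf (\<lambda>n. \<integral>\<^sup>+\<tau>. ennreal (g \<tau>) * ennreal (D n \<tau> \<omega>) \<partial>lborel) = 0"
      by (subst (asm) nn_integral_0_iff_AE) measurable
    show ?thesis
      using A1 A2 by eventually_elim (simp add: f_def D_def A_def less_top)
  qed
  \<comment> \<open>Countably many events give a single null set, and every path lies in all events
    with large index, so the localization can be removed.\<close>
  then have "AE \<omega> in M. \<forall>k\<in>{k0..}. (\<integral>\<^sup>+\<tau>. ennreal (g \<tau>) * ennreal (indicator (bounded_path_event k) \<omega> * norm (conv_lim \<tau> \<omega>)) \<partial>lborel) < \<infinity> \<and>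
    liminf (\<lambda>n. \<integral>\<^sup>+\<tau>. ennreal (g \<tau>) * ennreal (indicator (bounded_path_event k) \<omega> * norm (joint_approx (\<delta> n) \<tau> \<omega> - conv_lim \<tau> \<omega>)) \<partial>lborel) = 0"
    by (intro AE_ball_countable') auto
  with AE_space show ?thesis
  proof eventually_elim
    case (elim \<omega>)
    obtain k1 where k1: "\<And>k. k \<ge> k1 \<Longrightarrow> \<omega> \<in> bounded_path_event k"
      using bounded_path_event_eventually[OF elim(1)] by blast
    show ?case using bspec[OF elim(2), of "max k0 k1"] k1[of "max k0 k1"] by simp
  qed
qed

end

section \<open>The weak equation\<close>

lemma closed_eq_UNIV_of_dense:
  assumes "closure D = UNIV" "closed S" "D \<subseteq> S"
  shows "S = UNIV"
  using closure_minimal[OF assms(3,2)] assms(1) by blast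

text \<open>Density of the domain makes the representing vector unique, so the definite description
  in \<open>adj\<close> denotes it.\<close>

lemma adj_eq:
  fixes A :: "'h::real_inner \<Rightarrow> 'h"
  assumes A: "closed_dense_operator DA A" and \<xi>: "\<xi> \<in> adj_dom DA A" and x: "x \<in> DA"
  shows "A x \<bullet> \<xi> = x \<bullet> adj DA A \<xi>"
proof -
  have dense: "closure DA = UNIV" using A by (simp add: closed_dense_operator_def)
  obtain z where z: "\<forall>x\<in>DA. A x \<bullet> \<xi> = x \<bullet> z" using \<xi> by (auto simp: adj_dom_def)
  have "y = z" if y: "\<forall>x\<in>DA. A x \<bullet> \<xi> = x \<bullet> y" for y
  proof -
    have "closed {x. x \<bullet> (y - z) = 0}" by (intro closed_Collect_eq continuous_intros)
    moreover have "DA \<subseteq> {x. x \<bullet> (y - z) = 0}" using y z by (auto simp: inner_diff_right)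
    ultimately have "{x. x \<bullet> (y - z) = 0} = UNIV" by (rule closed_eq_UNIV_of_dense[OF dense])
    then have "(y - z) \<bullet> (y - z) = 0" by blast
    then show ?thesis by simp
  qed
  with z have "adj DA A \<xi> = z" unfolding adj_def by (intro the_equality) auto
  then show ?thesis using z x by simp
qed

lemma reversed_kernel_integrable:
  assumes "loc_integrable_Rplus a" "0 \<le> t"
  shows "integrable lborel (\<lambda>\<tau>. indicator {0..t} \<tau> * a (t - \<tau>))"
proof -
  have "integrable lborel (\<lambda>\<tau>. indicator {0..t} \<tau> * a \<tau>)"
    using assms by (simp add: loc_integrable_Rplus_def set_integrable_def)
  from lborel_integrable_real_affine[OF this, of "-1" t]
  have "integrable lborel (\<lambda>\<tau>. indicator {0..t} (t - \<tau>) * a (t - \<tau>))" by simp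
  moreover have "indicator {0..t} (t - \<tau>) = (indicator {0..t} \<tau> :: real)" for \<tau>
    by (auto split: split_indicator)
  ultimately show ?thesis by simp
qed

lemma integrable_mult_continuous:
  fixes h :: "real \<Rightarrow> real"
  assumes \<alpha>: "integrable lborel \<alpha>" and h: "h \<in> borel_measurable borel"
    and bound: "\<And>\<tau>. \<alpha> \<tau> \<noteq> 0 \<Longrightarrow> \<bar>h \<tau>\<bar> \<le> B"
  shows "integrable lborel (\<lambda>\<tau>. \<alpha> \<tau> * h \<tau>)"
proof (rule Bochner_Integration.integrable_bound)
  show "integrable lborel (\<lambda>\<tau>. B * \<bar>\<alpha> \<tau>\<bar>)" using \<alpha> by simp
  have [measurable]: "\<alpha> \<in> borel_measurable borel" using \<alpha> by (auto dest: borel_measurable_integrable)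
  show "(\<lambda>\<tau>. \<alpha> \<tau> * h \<tau>) \<in> borel_measurable lborel" using h by measurable
  have "\<bar>\<alpha> \<tau> * h \<tau>\<bar> \<le> \<bar>B * \<bar>\<alpha> \<tau>\<bar>\<bar>" for \<tau>
  proof (cases "\<alpha> \<tau> = 0")
    case False
    have "\<bar>h \<tau>\<bar> * \<bar>\<alpha> \<tau>\<bar> \<le> \<bar>B\<bar> * \<bar>\<alpha> \<tau>\<bar>" using bound[OF False] by (intro mult_right_mono) auto
    then show ?thesis by (simp add: abs_mult mult.commute)
  qed simp
  then show "AE \<tau> in lborel. norm (\<alpha> \<tau> * h \<tau>) \<le> norm (B * \<bar>\<alpha> \<tau>\<bar>)" by (auto intro: AE_I2)
qed

lemma resolvent_family_D:
  assumes "resolvent_family DA A a R"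
  shows "0 \<le> t \<Longrightarrow> bounded_linear (R t)"
    "0 \<le> t \<Longrightarrow> \<exists>C. \<forall>s\<in>{0..t}. \<forall>x. norm (R s x) \<le> C * norm x"
    "continuous_on {0..} (\<lambda>t. R t x)"
proof -
  note r1 = assms[unfolded resolvent_family_def]
  note r2 = r1[THEN conjunct2] note r3 = r2[THEN conjunct2]
  show "0 \<le> t \<Longrightarrow> bounded_linear (R t)" using r1[THEN conjunct1] by simp
  show "0 \<le> t \<Longrightarrow> \<exists>C. \<forall>s\<in>{0..t}. \<forall>x. norm (R s x) \<le> C * norm x" using r2[THEN conjunct1] by simp
  show "continuous_on {0..} (\<lambda>t. R t x)" using r3[THEN conjunct1] by simp
qed

locale volterra_resolvent =
  fixes DA :: "'h::{real_inner, banach, second_countable_topology} set" and A :: "'h \<Rightarrow> 'h"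
    and a :: "real \<Rightarrow> real" and R :: "real \<Rightarrow> 'h \<Rightarrow> 'h" and \<xi> :: 'h
  assumes op: "closed_dense_operator DA A" and kernel: "loc_integrable_Rplus a"
    and resolvent: "resolvent_family DA A a R" and \<xi>: "\<xi> \<in> adj_dom DA A"
begin

text \<open>Building the indicator into the kernel turns integrals over [0, t] into integrals over
  the line, which can be translated without adjusting limits.\<close>

definition \<alpha> :: "real \<Rightarrow> real \<Rightarrow> real" where
  "\<alpha> t \<tau> = indicator {0..t} \<tau> * a (t - \<tau>)"

lemma \<alpha>_integrable: "0 \<le> t \<Longrightarrow> integrable lborel (\<alpha> t)"
  unfolding \<alpha>_def by (rule reversed_kernel_integrable[OF kernel])

lemmas R_linear = resolvent_family_D(1)[OF resolvent]
  and R_bounded = resolvent_family_D(2)[OF resolvent]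
  and R_continuous = resolvent_family_D(3)[OF resolvent]

lemma R_max_measurable [measurable]: "(\<lambda>s. R (max 0 s) x) \<in> borel_measurable borel"
  by (intro borel_measurable_continuous_onI continuous_on_compose2[OF R_continuous[of x]] continuous_intros) auto

lemma weak_integrand_bound:
  assumes "0 \<le> t"
  shows "\<exists>B\<ge>0. \<forall>x \<tau>. \<alpha> t \<tau> \<noteq> 0 \<longrightarrow> \<bar>R (max 0 \<tau>) x \<bullet> adj DA A \<xi>\<bar> \<le> B * norm x"
proof -
  obtain C where C: "\<forall>s\<in>{0..t}. \<forall>x. norm (R s x) \<le> C * norm x" using R_bounded[OF assms] by blast
  have "\<bar>R (max 0 \<tau>) x \<bullet> adj DA A \<xi>\<bar> \<le> \<bar>C\<bar> * norm (adj DA A \<xi>) * norm x" if "\<alpha> t \<tau> \<noteq> 0" for x \<tau>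
  proof -
    have \<tau>: "\<tau> \<in> {0..t}" using that by (auto simp: \<alpha>_def split: split_indicator_asm)
    have "\<bar>R (max 0 \<tau>) x \<bullet> adj DA A \<xi>\<bar> \<le> norm (R (max 0 \<tau>) x) * norm (adj DA A \<xi>)" by (rule Cauchy_Schwarz_ineq2)
    also have "norm (R (max 0 \<tau>) x) \<le> C * norm x" using C \<tau> by (simp add: max_def)
    also have "C * norm x \<le> \<bar>C\<bar> * norm x" by (intro mult_right_mono) auto
    finally show ?thesis by (simp add: mult_right_mono mult_ac)
  qed
  then show ?thesis by (intro exI[of _ "\<bar>C\<bar> * norm (adj DA A \<xi>)"]) auto
qed

lemma weak_integrand_integrable:
  assumes "0 \<le> t"
  shows "integrable lborel (\<lambda>\<tau>. \<alpha> t \<tau> * (R (max 0 \<tau>) x \<bullet> adj DA A \<xi>))"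
proof -
  obtain B where "\<forall>x \<tau>. \<alpha> t \<tau> \<noteq> 0 \<longrightarrow> \<bar>R (max 0 \<tau>) x \<bullet> adj DA A \<xi>\<bar> \<le> B * norm x"
    using weak_integrand_bound[OF assms] by blast
  then show ?thesis
    by (intro integrable_mult_continuous[OF \<alpha>_integrable[OF assms], where B="B * norm x"]) auto
qed

text \<open>Pairing with \<open>\<xi>\<close> moves \<open>A\<close> to the adjoint, after which both sides are bounded in \<open>x\<close> and
  the resolvent equation extends from the domain of \<open>A\<close> to the whole space.\<close>
lemma weak_resolvent_equation:
  assumes t: "0 \<le> t"
  shows "R t x \<bullet> \<xi> = x \<bullet> \<xi> + (\<integral>\<tau>. \<alpha> t \<tau> * (R (max 0 \<tau>) x \<bullet> adj DA A \<xi>) \<partial>lborel)"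
proof -
  define I where "I = (\<lambda>x. \<integral>\<tau>. \<alpha> t \<tau> * (R (max 0 \<tau>) x \<bullet> adj DA A \<xi>) \<partial>lborel)"
  obtain B where B: "B \<ge> 0" "\<And>x \<tau>. \<alpha> t \<tau> \<noteq> 0 \<Longrightarrow> \<bar>R (max 0 \<tau>) x \<bullet> adj DA A \<xi>\<bar> \<le> B * norm x"
    using weak_integrand_bound[OF t] by blast
  have lin: "linear (R (max 0 \<tau>))" for \<tau> using R_linear[of "max 0 \<tau>"] by (simp add: bounded_linear.linear)
  have "bounded_linear I"
  proof (rule bounded_linear_intro)
    show "I (x + y) = I x + I y" for x y
      unfolding I_def using weak_integrand_integrable[OF t]
      by (subst Bochner_Integration.integral_add[symmetric]) (auto simp: linear_add[OF lin] inner_add_left algebra_simps)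
    show "I (c *\<^sub>R x) = c *\<^sub>R I x" for c x
      unfolding I_def by (subst integral_scaleR_right[symmetric]) (auto simp: linear_scale[OF lin] mult_ac)
    show "norm (I x) \<le> norm x * (\<integral>\<tau>. \<bar>\<alpha> t \<tau>\<bar> * B \<partial>lborel)" for x
    proof -
      have "norm (I x) \<le> (\<integral>\<tau>. norm (\<alpha> t \<tau> * (R (max 0 \<tau>) x \<bullet> adj DA A \<xi>)) \<partial>lborel)"
        unfolding I_def by (rule integral_norm_bound)
      also have "\<dots> \<le> (\<integral>\<tau>. norm x * (\<bar>\<alpha> t \<tau>\<bar> * B) \<partial>lborel)"
      proof (rule integral_mono)
        show "norm (\<alpha> t \<tau> * (R (max 0 \<tau>) x \<bullet> adj DA A \<xi>)) \<le> norm x * (\<bar>\<alpha> t \<tau>\<bar> * B)" for \<tau>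
        proof (cases "\<alpha> t \<tau> = 0")
          case False
          have "\<bar>\<alpha> t \<tau>\<bar> * \<bar>R (max 0 \<tau>) x \<bullet> adj DA A \<xi>\<bar> \<le> \<bar>\<alpha> t \<tau>\<bar> * (B * norm x)"
            using B(2)[OF False] by (intro mult_left_mono) auto
          then show ?thesis by (simp add: abs_mult mult_ac)
        qed simp
      qed (use weak_integrand_integrable[OF t] \<alpha>_integrable[OF t] in auto)
      finally show ?thesis by simp
    qed
  qed
  then have "continuous_on UNIV I" by (rule linear_continuous_on)
  moreover have "continuous_on UNIV (R t)" by (rule linear_continuous_on[OF R_linear[OF t]])
  ultimately have cl: "closed {x. R t x \<bullet> \<xi> = x \<bullet> \<xi> + I x}"
    by (intro closed_Collect_eq continuous_intros)
  have sub: "DA \<subseteq> {x. R t x \<bullet> \<xi> = x \<bullet> \<xi> + I x}"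
  proof
    fix x assume x: "x \<in> DA"
    then have RD: "\<forall>\<tau>\<in>{0..t}. R \<tau> x \<in> DA" and int: "set_integrable lborel {0..t} (\<lambda>\<tau>. a (t - \<tau>) *\<^sub>R A (R \<tau> x))"
      and eq: "R t x = x + (LINT \<tau>:{0..t}|lborel. a (t - \<tau>) *\<^sub>R A (R \<tau> x))"
      using resolvent t unfolding resolvent_family_def by blast+
    have "R t x \<bullet> \<xi> = x \<bullet> \<xi> + (\<integral>\<tau>. indicator {0..t} \<tau> *\<^sub>R (a (t - \<tau>) *\<^sub>R A (R \<tau> x)) \<partial>lborel) \<bullet> \<xi>"
      by (subst eq) (simp add: inner_add_left set_lebesgue_integral_def)
    also have "(\<integral>\<tau>. indicator {0..t} \<tau> *\<^sub>R (a (t - \<tau>) *\<^sub>R A (R \<tau> x)) \<partial>lborel) \<bullet> \<xi>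
        = (\<integral>\<tau>. (indicator {0..t} \<tau> *\<^sub>R (a (t - \<tau>) *\<^sub>R A (R \<tau> x))) \<bullet> \<xi> \<partial>lborel)"
      using int unfolding set_integrable_def by (intro integral_inner_left[symmetric]) auto
    also have "\<dots> = I x"
      unfolding I_def \<alpha>_def using RD
      by (intro Bochner_Integration.integral_cong) (auto simp: adj_eq[OF op \<xi>] max_def split: split_indicator)
    finally show "x \<in> {x. R t x \<bullet> \<xi> = x \<bullet> \<xi> + I x}" by simp
  qed
  have "closure DA = UNIV" using op by (simp add: closed_dense_operator_def)
  then have "{x. R t x \<bullet> \<xi> = x \<bullet> \<xi> + I x} = UNIV"
    using cl sub by (rule closed_eq_UNIV_of_dense)
  then show ?thesis by (auto simp: I_def)
qed

end

locale volterra_levy = volterra_resolvent DA A a R \<xi> + levy_convolution_mesh M Z R T \<delta>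
  for DA :: "'h::{real_inner, banach, second_countable_topology} set" and A :: "'h \<Rightarrow> 'h"
    and a :: "real \<Rightarrow> real" and R :: "real \<Rightarrow> 'h \<Rightarrow> 'h" and \<xi> :: 'h
    and M :: "'w measure" and Z :: "real \<Rightarrow> 'w \<Rightarrow> 'h" and T :: real and \<delta> :: "nat \<Rightarrow> real"
begin

text \<open>For each grid increment the weak resolvent equation is used at the remaining time t - j
  d and its integral translated by j d. Summation over j makes the integrands add up to the
  approximant at \<tau>, while the free terms telescope to \<open>Z\<close> at the grid point
  reached.\<close>

lemma approx_weak_equation:
  assumes d: "0 < d" and t: "t \<in> {0..T}" and \<omega>: "\<omega> \<in> space M"
  shows "integrable lborel (\<lambda>\<tau>. \<alpha> t \<tau> * (joint_approx d \<tau> \<omega> \<bullet> adj DA A \<xi>))"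
    and "conv_approx d t \<omega> \<bullet> \<xi> = Z (real (nat \<lceil>t / d\<rceil>) * d) \<omega> \<bullet> \<xi>
      + (\<integral>\<tau>. \<alpha> t \<tau> * (joint_approx d \<tau> \<omega> \<bullet> adj DA A \<xi>) \<partial>lborel)"
proof -
  define q where "q = nat \<lceil>t / d\<rceil>"
  define X where "X = (\<lambda>j. Z (real (Suc j) * d) \<omega> - Z (real j * d) \<omega>)"
  define h where "h = (\<lambda>j \<tau>. \<alpha> t \<tau> * (R (max 0 (\<tau> - real j * d)) (X j) \<bullet> adj DA A \<xi>))"
  have q_iff: "j < q \<longleftrightarrow> real j * d < t" for j
    unfolding q_def by (rule less_nat_ceiling_divide_iff[OF d])
  have shift: "integrable lborel (\<lambda>\<tau>. indicator {real j * d<..} \<tau> * h j \<tau>) \<and>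
    (\<integral>\<tau>. indicator {real j * d<..} \<tau> * h j \<tau> \<partial>lborel) = R (t - real j * d) (X j) \<bullet> \<xi> - X j \<bullet> \<xi>"
    if j: "j < q" for j
  proof -
    define s where "s = real j * d"
    define f where "f = (\<lambda>\<tau>. \<alpha> (t - s) \<tau> * (R (max 0 \<tau>) (X j) \<bullet> adj DA A \<xi>))"
    have s: "0 \<le> s" "0 \<le> t - s" using q_iff[of j] j d by (auto simp: s_def)
    have f: "integrable lborel f" unfolding f_def by (rule weak_integrand_integrable[OF s(2)])
    have fs: "integrable lborel (\<lambda>\<tau>. f (\<tau> - s))" "(\<integral>\<tau>. f (\<tau> - s) \<partial>lborel) = integral\<^sup>L lborel f"
      using lborel_integrable_real_affine[OF f, of 1 "- s"] lborel_integral_real_affine[of 1 f "- s"] by simp_all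
    \<comment> \<open>At \<tau> = s the two sides may differ: the shifted kernel includes its
      endpoint, whereas the approximant counts a cell only strictly after its start. A single point
      is null.\<close>
    have eq: "f (\<tau> - s) = indicator {s<..} \<tau> * h j \<tau>" if "\<tau> \<noteq> s" for \<tau>
      using that s by (auto simp: f_def h_def \<alpha>_def s_def[symmetric] split: split_indicator)
    have AE: "AE \<tau> in lborel. f (\<tau> - s) = indicator {s<..} \<tau> * h j \<tau>"
      using AE_lborel_singleton[of s] by eventually_elim (rule eq)
    have [measurable]: "\<alpha> t \<in> borel_measurable borel"
      using \<alpha>_integrable[of t] t by (auto dest: borel_measurable_integrable)
    have [measurable]: "(\<lambda>\<tau>. R (max 0 (\<tau> - s)) (X j)) \<in> borel_measurable borel"
      using measurable_compose[OF _ R_max_measurable[of "X j"], of "\<lambda>\<tau>. \<tau> - s" borel] by simp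
    have [measurable]: "h j \<in> borel_measurable borel" unfolding h_def s_def[symmetric] by measurable
    have "integrable lborel (\<lambda>\<tau>. indicator {s<..} \<tau> * h j \<tau>)"
      using fs(1) AE by (subst integrable_cong_AE[symmetric]) (auto dest: borel_measurable_integrable)
    moreover have "(\<integral>\<tau>. indicator {s<..} \<tau> * h j \<tau> \<partial>lborel) = (\<integral>\<tau>. f (\<tau> - s) \<partial>lborel)"
      using fs(1) AE by (intro integral_cong_AE) (auto dest: borel_measurable_integrable)
    moreover have "integral\<^sup>L lborel f = R (t - s) (X j) \<bullet> \<xi> - X j \<bullet> \<xi>"
      using weak_resolvent_equation[OF s(2), of "X j"] by (simp add: f_def)
    ultimately show ?thesis using fs(2) by (simp add: s_def)
  qed
  have J: "\<alpha> t \<tau> * (joint_approx d \<tau> \<omega> \<bullet> adj DA A \<xi>) = (\<Sum>j<q. indicator {real j * d<..} \<tau> * h j \<tau>)" for \<tau>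
  proof (cases "\<tau> \<in> {0..t}")
    case True
    then have \<tau>: "\<tau> \<le> T" "\<tau> \<le> t" using t by auto
    \<comment> \<open>The approximant at an earlier time \<tau> has fewer summands; the indicators
      kill the surplus ones in the sum up to q.\<close>
    have sub: "nat \<lceil>\<tau> / d\<rceil> \<le> q" unfolding q_def using \<tau> d by (intro nat_mono ceiling_mono divide_right_mono) auto
    have "joint_approx d \<tau> \<omega> = (\<Sum>j<nat \<lceil>\<tau> / d\<rceil>. R (\<tau> - real j * d) (X j))"
      using joint_approx_eq[OF d \<tau>(1)] by (simp add: conv_approx_def X_def)
    then have "\<alpha> t \<tau> * (joint_approx d \<tau> \<omega> \<bullet> adj DA A \<xi>) = (\<Sum>j<nat \<lceil>\<tau> / d\<rceil>. \<alpha> t \<tau> * (R (\<tau> - real j * d) (X j) \<bullet> adj DA A \<xi>))"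
      by (simp add: inner_sum_left sum_distrib_left)
    also have "\<dots> = (\<Sum>j<nat \<lceil>\<tau> / d\<rceil>. indicator {real j * d<..} \<tau> * h j \<tau>)"
      using less_nat_ceiling_divide_iff[OF d, of _ \<tau>] by (intro sum.cong refl) (simp add: h_def max_def)
    also have "\<dots> = (\<Sum>j<q. indicator {real j * d<..} \<tau> * h j \<tau>)"
    proof (rule sum.mono_neutral_left)
      show "{..<nat \<lceil>\<tau> / d\<rceil>} \<subseteq> {..<q}" using sub by auto
      show "\<forall>j\<in>{..<q} - {..<nat \<lceil>\<tau> / d\<rceil>}. indicator {real j * d<..} \<tau> * h j \<tau> = 0"
      proof
        fix j assume "j \<in> {..<q} - {..<nat \<lceil>\<tau> / d\<rceil>}"
        then have "\<not> real j * d < \<tau>"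
          by (simp only: Diff_iff lessThan_iff less_nat_ceiling_divide_iff[OF d] not_False_eq_True)
        then show "indicator {real j * d<..} \<tau> * h j \<tau> = 0" by simp
      qed
    qed simp
    finally show ?thesis .
  qed (simp add: h_def \<alpha>_def)
  show "integrable lborel (\<lambda>\<tau>. \<alpha> t \<tau> * (joint_approx d \<tau> \<omega> \<bullet> adj DA A \<xi>))"
    unfolding J using shift by (intro Bochner_Integration.integrable_sum) auto
  have "(\<integral>\<tau>. \<alpha> t \<tau> * (joint_approx d \<tau> \<omega> \<bullet> adj DA A \<xi>) \<partial>lborel) = (\<Sum>j<q. R (t - real j * d) (X j) \<bullet> \<xi> - X j \<bullet> \<xi>)"
    unfolding J using shift by (subst Bochner_Integration.integral_sum) (auto intro!: sum.cong)
  also have "\<dots> = conv_approx d t \<omega> \<bullet> \<xi> - (\<Sum>j<q. X j) \<bullet> \<xi>"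
    unfolding conv_approx_def q_def[symmetric] inner_sum_left sum_subtractf by (simp only: X_def)
  also have "(\<Sum>j<q. X j) = Z (real q * d) \<omega>"
    unfolding X_def using W_0[OF \<omega>] sum_lessThan_telescope[of "\<lambda>j. Z (real j * d) \<omega>" q] by simp
  finally show "conv_approx d t \<omega> \<bullet> \<xi> = Z (real (nat \<lceil>t / d\<rceil>) * d) \<omega> \<bullet> \<xi>
      + (\<integral>\<tau>. \<alpha> t \<tau> * (joint_approx d \<tau> \<omega> \<bullet> adj DA A \<xi>) \<partial>lborel)"
    by (simp add: q_def)
qed

text \<open>Rounding up approaches t from the right without skipping t itself, so right continuity
  of the path suffices.\<close>

lemma Z_grid_tendsto:
  assumes \<omega>: "\<omega> \<in> space M" and t: "0 \<le> t"
  shows "(\<lambda>n. Z (real (nat \<lceil>t / \<delta> n\<rceil>) * \<delta> n) \<omega>) \<longlonglongrightarrow> Z t \<omega>"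
proof -
  define r where "r = (\<lambda>n. real (nat \<lceil>t / \<delta> n\<rceil>) * \<delta> n)"
  have r: "t \<le> r n" "r n \<le> t + \<delta> n" for n
  proof -
    have "real (nat \<lceil>t / \<delta> n\<rceil>) = of_int \<lceil>t / \<delta> n\<rceil>" using t \<delta>_pos[of n] by simp
    then have "t / \<delta> n \<le> real (nat \<lceil>t / \<delta> n\<rceil>)" "real (nat \<lceil>t / \<delta> n\<rceil>) \<le> t / \<delta> n + 1"
      using ceiling_correct[of "t / \<delta> n"] by linarith+
    then show "t \<le> r n" "r n \<le> t + \<delta> n" unfolding r_def using \<delta>_pos[of n] by (auto simp: field_simps)
  qed
  have "r \<longlonglongrightarrow> t"
    by (rule tendsto_sandwich[of "\<lambda>_. t" r _ "\<lambda>n. t + \<delta> n"]) (use r in \<open>auto intro!: tendsto_eq_intros \<delta>_lim\<close>)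
  have "continuous (at t within {t..}) (\<lambda>s. Z s \<omega>)"
    using levy_process_D(7)[OF levy \<omega> t] by (simp add: continuous_within at_within_Ici_at_right)
  then have "((\<lambda>s. Z s \<omega>) \<circ> r) \<longlonglongrightarrow> Z t \<omega>"
    using \<open>r \<longlonglongrightarrow> t\<close> r(1) unfolding continuous_within_sequentially by auto
  then show ?thesis by (simp add: comp_def r_def)
qed

text \<open>The residual x of the equation does not depend on n, yet for each n it is at most p n,
  the errors at time t, plus the error of the integral. The first tends to zero, the second has
  liminf zero, so x vanishes.\<close>

lemma conv_lim_weak_equation:
  assumes t: "t \<in> {0..T}"
  shows "AE \<omega> in M. integrable lborel (\<lambda>\<tau>. \<alpha> t \<tau> * (conv_lim \<tau> \<omega> \<bullet> adj DA A \<xi>)) \<and>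
    conv_lim t \<omega> \<bullet> \<xi> = (\<integral>\<tau>. \<alpha> t \<tau> * (conv_lim \<tau> \<omega> \<bullet> adj DA A \<xi>) \<partial>lborel) + Z t \<omega> \<bullet> \<xi>"
proof -
  define \<eta> where "\<eta> = adj DA A \<xi>"
  define g where "g = (\<lambda>\<tau>. norm \<eta> * \<bar>\<alpha> t \<tau>\<bar>)"
  have \<alpha>i: "integrable lborel (\<alpha> t)" using t by (intro \<alpha>_integrable) simp
  then have \<alpha>m [measurable]: "\<alpha> t \<in> borel_measurable borel" by (auto dest: borel_measurable_integrable)
  have gi: "integrable lborel g" unfolding g_def using \<alpha>i by simp
  have gm: "g \<in> borel_measurable borel" unfolding g_def by measurable
  have gfin: "(\<integral>\<^sup>+\<tau>. ennreal (g \<tau>) \<partial>lborel) < \<infinity>"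
    using gi by (subst nn_integral_eq_integral) (auto simp: g_def)
  have gsupp: "g \<tau> = 0" if "\<tau> \<notin> {0..T}" for \<tau>
    using that t by (auto simp: g_def \<alpha>_def split: split_indicator)
  have weight: "ennreal \<bar>\<alpha> t \<tau> * (y \<bullet> \<eta>)\<bar> \<le> ennreal (g \<tau>) * ennreal (norm y)" for \<tau> y
  proof -
    have "\<bar>\<alpha> t \<tau> * (y \<bullet> \<eta>)\<bar> \<le> \<bar>\<alpha> t \<tau>\<bar> * (norm y * norm \<eta>)"
      unfolding abs_mult by (intro mult_left_mono Cauchy_Schwarz_ineq2) simp
    then have "ennreal \<bar>\<alpha> t \<tau> * (y \<bullet> \<eta>)\<bar> \<le> ennreal (g \<tau> * norm y)" by (intro ennreal_leI) (simp add: g_def mult_ac)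
    then show ?thesis by (simp add: ennreal_mult g_def)
  qed
  have "AE \<omega> in M. (\<integral>\<^sup>+\<tau>. ennreal (g \<tau>) * ennreal (norm (conv_lim \<tau> \<omega>)) \<partial>lborel) < \<infinity> \<and>
    liminf (\<lambda>n. \<integral>\<^sup>+\<tau>. ennreal (g \<tau>) * ennreal (norm (joint_approx (\<delta> n) \<tau> \<omega> - conv_lim \<tau> \<omega>)) \<partial>lborel) = 0"
    using gm gfin gsupp by (rule weighted_path_bounds)
  from AE_space this joint_approx_tendsto[OF t]
  show ?thesis
    unfolding \<eta>_def[symmetric]
  proof eventually_elim
    case (elim \<omega>)
    define V where "V = (\<lambda>n \<tau>. joint_approx (\<delta> n) \<tau> \<omega>)"
    have cm: "(\<lambda>\<tau>. conv_lim \<tau> \<omega>) \<in> borel_measurable lborel"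
      using measurable_compose[OF measurable_Pair2'[OF elim(1)] conv_lim_measurable] by simp
    have int: "integrable lborel (\<lambda>\<tau>. \<alpha> t \<tau> * (conv_lim \<tau> \<omega> \<bullet> \<eta>))"
    proof (rule integrableI_bounded)
      show "(\<lambda>\<tau>. \<alpha> t \<tau> * (conv_lim \<tau> \<omega> \<bullet> \<eta>)) \<in> borel_measurable lborel" using cm by measurable
      have "(\<integral>\<^sup>+\<tau>. ennreal (norm (\<alpha> t \<tau> * (conv_lim \<tau> \<omega> \<bullet> \<eta>))) \<partial>lborel)
          \<le> (\<integral>\<^sup>+\<tau>. ennreal (g \<tau>) * ennreal (norm (conv_lim \<tau> \<omega>)) \<partial>lborel)"
        unfolding real_norm_def by (intro nn_integral_mono weight)
      then show "(\<integral>\<^sup>+\<tau>. ennreal (norm (\<alpha> t \<tau> * (conv_lim \<tau> \<omega> \<bullet> \<eta>))) \<partial>lborel) < \<infinity>"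
        using elim(2) by (auto intro: le_less_trans)
    qed
    define I where "I = (\<integral>\<tau>. \<alpha> t \<tau> * (conv_lim \<tau> \<omega> \<bullet> \<eta>) \<partial>lborel)"
    define x where "x = \<bar>conv_lim t \<omega> \<bullet> \<xi> - I - Z t \<omega> \<bullet> \<xi>\<bar>"
    define p where "p = (\<lambda>n. \<bar>(conv_lim t \<omega> - V n t) \<bullet> \<xi>\<bar> + \<bar>(Z (real (nat \<lceil>t / \<delta> n\<rceil>) * \<delta> n) \<omega> - Z t \<omega>) \<bullet> \<xi>\<bar>)"
    define e where "e = (\<lambda>n. \<integral>\<^sup>+\<tau>. ennreal (g \<tau>) * ennreal (norm (V n \<tau> - conv_lim \<tau> \<omega>)) \<partial>lborel)"
    have "p \<longlonglongrightarrow> \<bar>(conv_lim t \<omega> - conv_lim t \<omega>) \<bullet> \<xi>\<bar> + \<bar>(Z t \<omega> - Z t \<omega>) \<bullet> \<xi>\<bar>"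
      unfolding p_def V_def using t by (intro tendsto_intros elim(3) Z_grid_tendsto[OF elim(1)]) auto
    then have p: "p \<longlonglongrightarrow> 0" by simp
    \<comment> \<open>Stated in extended nonnegative reals, where a negative x - p n counts as zero
      and \<open>e n\<close> may be infinite.\<close>
    have key: "ennreal (x - p n) \<le> e n" for n
    proof -
      define In where "In = (\<integral>\<tau>. \<alpha> t \<tau> * (V n \<tau> \<bullet> \<eta>) \<partial>lborel)"
      have iV: "integrable lborel (\<lambda>\<tau>. \<alpha> t \<tau> * (V n \<tau> \<bullet> \<eta>))"
        unfolding V_def \<eta>_def by (rule approx_weak_equation(1)[OF \<delta>_pos t elim(1)])
      have Veq: "V n t \<bullet> \<xi> = Z (real (nat \<lceil>t / \<delta> n\<rceil>) * \<delta> n) \<omega> \<bullet> \<xi> + In"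
        using approx_weak_equation(2)[OF \<delta>_pos t elim(1), of n] joint_approx_eq[OF \<delta>_pos, of t n \<omega>] t
        by (simp add: V_def In_def \<eta>_def)
      have "In - I = (\<integral>\<tau>. \<alpha> t \<tau> * (V n \<tau> \<bullet> \<eta>) - \<alpha> t \<tau> * (conv_lim \<tau> \<omega> \<bullet> \<eta>) \<partial>lborel)"
        unfolding In_def I_def by (rule Bochner_Integration.integral_diff[OF iV int, symmetric])
      also have "\<dots> = (\<integral>\<tau>. \<alpha> t \<tau> * ((V n \<tau> - conv_lim \<tau> \<omega>) \<bullet> \<eta>) \<partial>lborel)"
        by (simp add: inner_diff_left right_diff_distrib)
      finally have diff: "In - I = (\<integral>\<tau>. \<alpha> t \<tau> * ((V n \<tau> - conv_lim \<tau> \<omega>) \<bullet> \<eta>) \<partial>lborel)" .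
      have "integrable lborel (\<lambda>\<tau>. \<alpha> t \<tau> * ((V n \<tau> - conv_lim \<tau> \<omega>) \<bullet> \<eta>))"
        using Bochner_Integration.integrable_diff[OF iV int] by (simp add: inner_diff_left right_diff_distrib)
      then have "ennreal \<bar>In - I\<bar> \<le> (\<integral>\<^sup>+\<tau>. ennreal \<bar>\<alpha> t \<tau> * ((V n \<tau> - conv_lim \<tau> \<omega>) \<bullet> \<eta>)\<bar> \<partial>lborel)"
        unfolding diff using integral_norm_bound_ennreal by fastforce
      also have "\<dots> \<le> e n" unfolding e_def by (intro nn_integral_mono weight)
      finally have "ennreal \<bar>In - I\<bar> \<le> e n" .
      moreover have "x - p n \<le> \<bar>In - I\<bar>"
        unfolding x_def p_def using Veq by (simp add: inner_diff_left)
      ultimately show ?thesis using ennreal_leI order_trans by blast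
    qed
    have "x = 0"
    proof (rule ccontr)
      assume "x \<noteq> 0"
      then have x: "0 < x" by (simp add: x_def)
      have "\<forall>\<^sub>F n in sequentially. p n < x/2" using p x by (intro order_tendstoD(2)) auto
      then have "\<forall>\<^sub>F n in sequentially. ennreal (x/2) \<le> e n"
      proof eventually_elim
        case (elim n)
        then have "ennreal (x/2) \<le> ennreal (x - p n)" by (intro ennreal_leI) simp
        then show ?case using key[of n] by (rule order_trans)
      qed
      then have "ennreal (x/2) \<le> liminf e" by (rule Liminf_bounded)
      also have "liminf e = 0" using elim(2) by (simp add: e_def V_def)
      finally show False using x by simp
    qed
    then show ?case using int by (simp add: x_def I_def)
  qed
qed

end

theorem theorem7:
  fixes M :: "'w measure"
    and Z :: "real \<Rightarrow> 'w \<Rightarrow> 'h::{real_inner,banach,second_countable_topology}"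
    and DA :: "'h set" and A :: "'h \<Rightarrow> 'h"
    and a :: "real \<Rightarrow> real" and R :: "real \<Rightarrow> 'h \<Rightarrow> 'h" and T :: real
  assumes "closed_dense_operator DA A"
    and "loc_integrable_Rplus a"
    and "resolvent_family DA A a R"
    and "levy_process M Z"
  shows "\<exists>Y :: real \<Rightarrow> 'w \<Rightarrow> 'h.
           (\<forall>t\<in>{0..T}. is_stoch_conv M R Z t (Y t)) \<and>
           (\<forall>\<omega>\<in>space M. set_integrable lborel {0..T} (\<lambda>\<tau>. Y \<tau> \<omega>)) \<and>
           (\<forall>t\<in>{0..T}. \<forall>\<xi>\<in>adj_dom DA A. AE \<omega> in M.
              set_integrable lborel {0..t} (\<lambda>\<tau>. inner (a (t - \<tau>) *\<^sub>R Y \<tau> \<omega>) (adj DA A \<xi>)) \<and>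
              inner (Y t \<omega>) \<xi> =
                (LINT \<tau>:{0..t}|lborel. inner (a (t - \<tau>) *\<^sub>R Y \<tau> \<omega>) (adj DA A \<xi>))
                + inner (Z t \<omega>) \<xi>)"
proof (cases "0 \<le> T")
  case False
  \<comment> \<open>For T < 0 the interval is empty and the zero process serves.\<close>
  then show ?thesis by (intro exI[of _ "\<lambda>_ _. 0"]) auto
next
  case True
  have lc: "levy_convolution M Z R T"
    by (rule levy_convolution.intro[OF assms(4) resolvent_family_D[OF assms(3)] True])
  then obtain \<delta> where "levy_convolution_mesh M Z R T \<delta>"
    using levy_convolution.mesh_exists by blast
  then interpret levy_convolution_mesh M Z R T \<delta> .
  \<comment> \<open>The event that the path is integrable on [0, T]. It is measurable because
    \<open>conv_lim\<close> is jointly measurable.\<close>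
  define N where "N = {\<omega>\<in>space M. (\<integral>\<^sup>+\<tau>. ennreal (indicator {0..T} \<tau>) * ennreal (norm (conv_lim \<tau> \<omega>)) \<partial>lborel) < \<infinity>}"
  have "(\<lambda>\<omega>. \<integral>\<^sup>+\<tau>. ennreal (indicator {0..T} \<tau>) * ennreal (norm (conv_lim \<tau> \<omega>)) \<partial>lborel) \<in> borel_measurable M"
    by measurable
  then have [measurable]: "N \<in> sets M" unfolding N_def by measurable
  have "AE \<omega> in M. (\<integral>\<^sup>+\<tau>. ennreal (indicator {0..T} \<tau>) * ennreal (norm (conv_lim \<tau> \<omega>)) \<partial>lborel) < \<infinity> \<and>
    liminf (\<lambda>n. \<integral>\<^sup>+\<tau>. ennreal (indicator {0..T} \<tau>) * ennreal (norm (joint_approx (\<delta> n) \<tau> \<omega> - conv_lim \<tau> \<omega>)) \<partial>lborel) = 0"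
    by (rule weighted_path_bounds) (use True in \<open>auto simp: ennreal_indicator\<close>)
  with AE_space have AEN: "AE \<omega> in M. \<omega> \<in> N" by eventually_elim (simp add: N_def)
  \<comment> \<open>Integrability is claimed for every path, so the process is set to zero off
    \<open>N\<close>. This changes it on a null set only: it remains a version of the convolution,
    and the almost sure equation persists.\<close>
  define Y where "Y = (\<lambda>t \<omega>. if \<omega> \<in> N then conv_lim t \<omega> else 0)"
  show ?thesis
  proof (intro exI[of _ Y] conjI ballI)
    show "is_stoch_conv M R Z t (Y t)" if "t \<in> {0..T}" for t
    proof (rule is_stoch_conv_version[OF that])
      show "Y t \<in> borel_measurable M" unfolding Y_def using conv_lim_measurable_fixed[of t] by measurable
      show "AE \<omega> in M. Y t \<omega> = conv_lim t \<omega>" using AEN by eventually_elim (simp add: Y_def)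
    qed
    show "set_integrable lborel {0..T} (\<lambda>\<tau>. Y \<tau> \<omega>)" if \<omega>: "\<omega> \<in> space M" for \<omega>
    proof (cases "\<omega> \<in> N")
      case True
      have [measurable]: "(\<lambda>\<tau>. conv_lim \<tau> \<omega>) \<in> borel_measurable lborel"
        using measurable_compose[OF measurable_Pair2'[OF \<omega>] conv_lim_measurable] by simp
      have "integrable lborel (\<lambda>\<tau>. indicator {0..T} \<tau> *\<^sub>R conv_lim \<tau> \<omega>)"
      proof (rule integrableI_bounded)
        have "(\<integral>\<^sup>+\<tau>. ennreal (norm (indicator {0..T} \<tau> *\<^sub>R conv_lim \<tau> \<omega>)) \<partial>lborel)
            = (\<integral>\<^sup>+\<tau>. ennreal (indicator {0..T} \<tau>) * ennreal (norm (conv_lim \<tau> \<omega>)) \<partial>lborel)"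
          by (intro nn_integral_cong) (auto split: split_indicator)
        then show "(\<integral>\<^sup>+\<tau>. ennreal (norm (indicator {0..T} \<tau> *\<^sub>R conv_lim \<tau> \<omega>)) \<partial>lborel) < \<infinity>"
          using True by (simp add: N_def)
      qed measurable
      then show ?thesis using True by (simp add: set_integrable_def Y_def)
    qed (simp add: Y_def set_integrable_def)
    fix t \<xi> assume t: "t \<in> {0..T}" and \<xi>: "\<xi> \<in> adj_dom DA A"
    interpret volterra_levy DA A a R \<xi> M Z T \<delta>
      using assms \<xi> by unfold_locales
    have eq: "indicator {0..t} \<tau> *\<^sub>R inner (a (t - \<tau>) *\<^sub>R y) (adj DA A \<xi>) = \<alpha> t \<tau> * (y \<bullet> adj DA A \<xi>)" for \<tau> y
      by (simp add: \<alpha>_def)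
    show "AE \<omega> in M. set_integrable lborel {0..t} (\<lambda>\<tau>. inner (a (t - \<tau>) *\<^sub>R Y \<tau> \<omega>) (adj DA A \<xi>)) \<and>
      inner (Y t \<omega>) \<xi> = (LINT \<tau>:{0..t}|lborel. inner (a (t - \<tau>) *\<^sub>R Y \<tau> \<omega>) (adj DA A \<xi>)) + inner (Z t \<omega>) \<xi>"
      using AEN conv_lim_weak_equation[OF t]
    proof eventually_elim
      case (elim \<omega>)
      then show ?case
        unfolding set_integrable_def set_lebesgue_integral_def eq by (simp add: Y_def)
    qed
  qed
qed

end
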